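(* Fix $k \in [1,\infty)$. Let $P_{k,\mathrm{s}}^{\mathrm{c}}$, $P_{k,\mathrm{s}}$, $P_{k,\mathrm{w}}^{\mathrm{c}}$, $P_{k,\mathrm{w}}$ be four subsets of $[1,\infty]$ such that: (i) each of the four sets is of the form $\{\infty\}$, $[p_0,\infty]$ or $(p_0,\infty]$ for some $p_0 \in [1,\infty)$ (the form and $p_0$ may depend on the set); (ii) $P_{k,\mathrm{s}} \subset P_{k,\mathrm{s}}^{\mathrm{c}}$, $P_{k,\mathrm{w}} \subset P_{k,\mathrm{w}}^{\mathrm{c}}$, $P_{k,\mathrm{s}}^{\mathrm{c}} \subset P_{k,\mathrm{w}}^{\mathrm{c}} \subset \overline{P_{k,\mathrm{s}}^{\mathrm{c}}}$ and $P_{k,\mathrm{s}} \subset P_{k,\mathrm{w}} \subset \overline{P_{k,\mathrm{s}}}$, where $\overline{E}$ denotes the closure of $E$ in the usual topology of $\mathbb{R}\cup\{\infty\}$; (iii) if $k \geq 2$, then $P_{k,\mathrm{w}}^{\mathrm{c}} = [1,\infty]$; (iv) if $k \geq 3$, then $P_{k,\mathrm{w}} = [1,\infty]$. Then there exists a non-doubling metric measure space for which the associated modified Hardy--Littlewood maximal operators, centered $M_k^{\mathrm{c}}$ and non-centered $M_k$, satisfy, for every $p \in [1,\infty]$: - $M_k^{\mathrm{c}}$ is of strong type $(p,p)$ if and only if $p \in P_{k,\mathrm{s}}^{\mathrm{c}}$; - $M_k$ is of strong type $(p,p)$ if and only if $p \in P_{k,\mathrm{s}}$; - $M_k^{\mathrm{c}}$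 is of weak type $(p,p)$ if and only if $p \in P_{k,\mathrm{w}}^{\mathrm{c}}$; - $M_k$ is of weak type $(p,p)$ if and only if $p \in P_{k,\mathrm{w}}$.
   Context: A metric measure space $(X,\rho,\mu)$ is a nonempty metric space $(X,\rho)$ with a Borel measure $\mu$; throughout, $(X,\rho)$ is bounded and separable, and every open ball $B(x,r)=\{y\in X:\rho(x,y)<r\}$ ($x\in X$, $r>0$) has finite and strictly positive measure. The space is non-doubling if there is no finite constant $C$ with $\mu(B(x,2r))\le C\mu(B(x,r))$ for all $x\in X$, $r>0$. For $k\ge 1$ and measurable $f$, the modified Hardy--Littlewood maximal operators are $$M_k^{\mathrm{c}}f(x)=\sup_{r>0}\frac{1}{\mu(B(x,kr))}\int_{B(x,r)}|f|\,d\mu,\qquad M_kf(x)=\sup_{(y,r):\,x\in B(y,r)}\frac{1}{\mu(B(y,kr))}\int_{B(y,r)}|f|\,d\mu,$$ the second supremum being over all centers $y\in X$ and radii $r>0$ with $x\in B(y,r)$. For $p\in[1,\infty)$, $\|g\|_{p,\infty}=\sup_{\lambda>0}\lambda\,\mu(\{x:|g(x)|>\lambda\})^{1/p}$, and $\|g\|_{\infty,\infty}=\|g\|_\infty$. An operator $T$ is of strong (respectively weak) type $(p,p)$ if there is a finite constant $C$ with $\|Tf\|_p\le C\|f\|_p$ (respectively $\|Tf\|_{p,\infty}\le C\|f\|_p$) for all $f\in L^p(X,\mu)$. *)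

theory Defs
  imports "HOL-Analysis.Analysis" "HOL-Probability.Essential_Supremum"
begin

text \<open>
  Metric spaces are carrier-based, so that a space can be existentially quantified
  inside a formula. Carriers inside \<^typ>\<open>real\<close> with an arbitrary metric suffice for this, because a separable
  metric space has at most continuum many points. A Borel measure lives exactly on the Borel sigma-algebra of the metric topology.
\<close>

locale metric_measure_space = Metric_space X d
  for X :: "'a set" and d :: "'a \<Rightarrow> 'a \<Rightarrow> real" +
  fixes \<mu> :: "'a measure"
  assumes nonempty: "X \<noteq> {}"
    and space_eq: "space \<mu> = X"
    and sets_eq: "sets \<mu> = sigma_sets X {U. openin mtopology U}"
    and bounded: "mbounded X"
    and separable: "separable_space mtopology"
    and ball_finite: "\<And>x r. x \<in> X \<Longrightarrow> 0 < r \<Longrightarrow> emeasure \<mu> (mball x r) < \<infinity>"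
    and ball_positive: "\<And>x r. x \<in> X \<Longrightarrow> 0 < r \<Longrightarrow> 0 < emeasure \<mu> (mball x r)"
begin

definition doubling :: bool where
  "doubling \<longleftrightarrow> (\<exists>C::real. \<forall>x\<in>X. \<forall>r>0.
     emeasure \<mu> (mball x (2 * r)) \<le> ennreal C * emeasure \<mu> (mball x r))"

definition centered_maximal :: "real \<Rightarrow> ('a \<Rightarrow> real) \<Rightarrow> 'a \<Rightarrow> ennreal" where
  "centered_maximal k f x =
     (SUP r\<in>{0<..}. (\<integral>\<^sup>+y\<in>mball x r. ennreal \<bar>f y\<bar> \<partial>\<mu>) / emeasure \<mu> (mball x (k * r)))"

definition noncentered_maximal :: "real \<Rightarrow> ('a \<Rightarrow> real) \<Rightarrow> 'a \<Rightarrow> ennreal" where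
  "noncentered_maximal k f x =
     (SUP (y, r)\<in>{(y, r). y \<in> X \<and> 0 < r \<and> x \<in> mball y r}.
        (\<integral>\<^sup>+z\<in>mball y r. ennreal \<bar>f z\<bar> \<partial>\<mu>) / emeasure \<mu> (mball y (k * r)))"

end

text \<open>Real powers on \<open>[0, \<infinity>]\<close>; only used with positive exponents, where \<open>\<infinity>\<^sup>a = \<infinity>\<close>
  and \<open>0\<^sup>a = 0\<close>.\<close>

definition ennreal_powr :: "ennreal \<Rightarrow> real \<Rightarrow> ennreal" where
  "ennreal_powr x a = (if x = \<infinity> then \<infinity> else ennreal (enn2real x powr a))"

text \<open>
  The norms act on \<open>[0, \<infinity>]\<close>-valued functions, since maximal functions may take the value
  \<open>\<infinity>\<close>; a real function \<open>f\<close> enters through \<open>\<bar>f\<bar>\<close>. Both maximal functions of a measurable function are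
  measurable, so the conventions of the library for non-measurable arguments play no role.
\<close>

definition Lp_norm :: "'a measure \<Rightarrow> ereal \<Rightarrow> ('a \<Rightarrow> ennreal) \<Rightarrow> ennreal" where
  "Lp_norm M p g =
     (if p = \<infinity> then esssup M g
      else ennreal_powr (\<integral>\<^sup>+x. ennreal_powr (g x) (real_of_ereal p) \<partial>M) (1 / real_of_ereal p))"

definition weak_Lp_norm :: "'a measure \<Rightarrow> ereal \<Rightarrow> ('a \<Rightarrow> ennreal) \<Rightarrow> ennreal" where
  "weak_Lp_norm M p g =
     (if p = \<infinity> then esssup M g
      else (SUP t\<in>{0::real<..}.
              ennreal t * ennreal_powr (emeasure M {x \<in> space M. ennreal t < g x})
                            (1 / real_of_ereal p)))"

definition Lp_functions :: "'a measure \<Rightarrow> ereal \<Rightarrow> ('a \<Rightarrow> real) set" where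
  "Lp_functions M p = {f \<in> borel_measurable M. Lp_norm M p (\<lambda>x. ennreal \<bar>f x\<bar>) < \<infinity>}"

definition strong_type :: "'a measure \<Rightarrow> ereal \<Rightarrow> (('a \<Rightarrow> real) \<Rightarrow> 'a \<Rightarrow> ennreal) \<Rightarrow> bool" where
  "strong_type M p T \<longleftrightarrow> (\<exists>C::real. \<forall>f\<in>Lp_functions M p.
     Lp_norm M p (T f) \<le> ennreal C * Lp_norm M p (\<lambda>x. ennreal \<bar>f x\<bar>))"

definition weak_type :: "'a measure \<Rightarrow> ereal \<Rightarrow> (('a \<Rightarrow> real) \<Rightarrow> 'a \<Rightarrow> ennreal) \<Rightarrow> bool" where
  "weak_type M p T \<longleftrightarrow> (\<exists>C::real. \<forall>f\<in>Lp_functions M p.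
     weak_Lp_norm M p (T f) \<le> ennreal C * Lp_norm M p (\<lambda>x. ennreal \<bar>f x\<bar>))"

text \<open>Exponents range over \<^typ>\<open>ereal\<close>, so that \<open>{1..}\<close> is \<open>[1, \<infinity>]\<close> with \<open>\<infinity>\<close> included.\<close>

definition admissible_exponents :: "ereal set \<Rightarrow> bool" where
  "admissible_exponents P \<longleftrightarrow>
     P = {\<infinity>} \<or> (\<exists>p0::real. 1 \<le> p0 \<and> (P = {ereal p0..} \<or> P = {ereal p0<..}))"

end

theory Submission
  imports Defs
begin

text \<open>
  The space is a disjoint union of finite spaces of diameter at most \<open>2\<close>, placed at mutual distance
  \<open>3k\<close> and rescaled so that the total mass is finite. A ball either lies in one component or is the
  whole space, and averaging over the whole space is bounded on every \<open>L\<^sup>p\<close>; so a maximal inequality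
  holds if and only if it holds on the components with a uniform constant. Families of components
  can be interleaved, which intersects the sets of good exponents.

  Every component has a center of mass 1. Testing on the indicator of the center, a point of mass
  \<open>m i \<ge> 1\<close> that shares with the center a ball whose enlargement has mass comparable to \<open>m i\<close> sees the value
  \<open>1 / m i\<close>. In a star the resulting lower bounds, boundedness of \<open>\<Sum> m i powr (1 - p)\<close> for strong type and of
  \<open>\<Sum> {m i | m i \<le> T} / T powr p\<close> for weak type, are also sufficient. Any admissible pair of exponent sets
  is realized by a choice of the masses. If \<open>k < 2\<close> the critical balls can be centered at the heavy
  points; if \<open>k < 3\<close> they can be centered at light midpoints while all centered balls at heavy points
  that reach the center contain every heavy point, so that only the non-centered operator is
  affected. For larger \<open>k\<close> only strong type \<open>(1,1)\<close> can fail, and it fails on chains: heavy points with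
  rapidly growing masses at geometrically growing distances. The ratio of the distances decides
  whether the enlargement of a centered ball reaches the next, much heavier, point.
\<close>

section \<open>Finite weighted spaces and linearised maximal inequalities\<close>

text \<open>Two problems have to be solved: damaging both operators alike, with prescribed exponents
  \<open>P_s_c\<close> and \<open>P_w_c\<close>, and damaging only the non-centered one, with
  \<open>P_s\<close> and \<open>P_w\<close>. Because of the inclusions
  \<open>P_s \<subseteq> P_s_c\<close> and \<open>P_w \<subseteq> P_w_c\<close>, intersecting the
  two solutions yields all four sets. A third family, harmless for every p, makes the result
  non-doubling in every case. The closure condition lets a weak set exceed the strong one by the
  endpoint p0 at most. Equal sets come from stars with a single common mass, unequal ones from
  masses growing like i^(1 / (p0 - 1)). This exponent breaks down at p0 = 1, the one discrepancy
  that must be available for every k; chains supply it. The thresholds 2 and 3 are ratios of radii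
  in a star. A ball around a heavy point or a midpoint reaches the center as soon as its radius
  exceeds 1/2, whereas the next heavy point is at distance 1 in the first case and 3/2 in the
  second.\<close>

definition finite_mms :: "'a set \<Rightarrow> ('a \<Rightarrow> 'a \<Rightarrow> real) \<Rightarrow> ('a \<Rightarrow> real) \<Rightarrow> bool" where
  "finite_mms S d w \<longleftrightarrow> finite S \<and> S \<noteq> {} \<and> Metric_space S d \<and>
     (\<forall>x\<in>S. \<forall>y\<in>S. d x y \<le> 2) \<and> (\<forall>x\<in>S. 0 < w x)"

definition fball :: "'a set \<Rightarrow> ('a \<Rightarrow> 'a \<Rightarrow> real) \<Rightarrow> 'a \<Rightarrow> real \<Rightarrow> 'a set" where
  "fball S d x r = {y \<in> S. d x y < r}"

definition centered_pairs ::
    "'a set \<Rightarrow> ('a \<Rightarrow> 'a \<Rightarrow> real) \<Rightarrow> real \<Rightarrow> 'a \<Rightarrow> ('a set \<times> 'a set) set" where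
  "centered_pairs S d k x = {(fball S d x r, fball S d x (k * r)) | r. 0 < r}"

definition noncentered_pairs ::
    "'a set \<Rightarrow> ('a \<Rightarrow> 'a \<Rightarrow> real) \<Rightarrow> real \<Rightarrow> 'a \<Rightarrow> ('a set \<times> 'a set) set" where
  "noncentered_pairs S d k x =
     {(fball S d y r, fball S d y (k * r)) | y r. y \<in> S \<and> 0 < r \<and> x \<in> fball S d y r}"

text \<open>The maximal function is linearised: \<open>g\<close> (resp. \<open>t\<close> on \<open>E\<close>) is any function bounded at each
  point by one of the averages. This avoids suprema altogether.\<close>

definition strong_const ::
    "'a set \<Rightarrow> ('a \<Rightarrow> real) \<Rightarrow> ('a \<Rightarrow> ('a set \<times> 'a set) set) \<Rightarrow> real \<Rightarrow> real \<Rightarrow> bool" where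
  "strong_const S w \<B> p C \<longleftrightarrow> (\<forall>f g. (\<forall>x\<in>S. 0 \<le> f x) \<longrightarrow>
     (\<forall>x\<in>S. 0 \<le> g x \<and> (\<exists>(B, B')\<in>\<B> x. g x * sum w B' \<le> (\<Sum>y\<in>B. w y * f y))) \<longrightarrow>
     (\<Sum>x\<in>S. w x * g x powr p) \<le> C * (\<Sum>x\<in>S. w x * f x powr p))"

definition weak_const ::
    "'a set \<Rightarrow> ('a \<Rightarrow> real) \<Rightarrow> ('a \<Rightarrow> ('a set \<times> 'a set) set) \<Rightarrow> real \<Rightarrow> real \<Rightarrow> bool" where
  "weak_const S w \<B> p C \<longleftrightarrow> (\<forall>f t E. (\<forall>x\<in>S. 0 \<le> f x) \<longrightarrow> 0 < t \<longrightarrow> E \<subseteq> S \<longrightarrow>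
     (\<forall>x\<in>E. \<exists>(B, B')\<in>\<B> x. t * sum w B' < (\<Sum>y\<in>B. w y * f y)) \<longrightarrow>
     t powr p * sum w E \<le> C * (\<Sum>x\<in>S. w x * f x powr p))"

lemma fball_subset: "fball S d x r \<subseteq> S"
  by (auto simp: fball_def)

lemma fball_mono: "r \<le> r' \<Longrightarrow> fball S d x r \<subseteq> fball S d x r'"
  by (auto simp: fball_def)

lemma fball_enlarge: "1 \<le> k \<Longrightarrow> 0 < r \<Longrightarrow> fball S d x r \<subseteq> fball S d x (k * r)"
  by (rule fball_mono) simp

lemma centered_subset_noncentered:
  assumes "Metric_space S d" "x \<in> S"
  shows "centered_pairs S d k x \<subseteq> noncentered_pairs S d k x"
proof -
  interpret Metric_space S d by fact
  show ?thesis using assms(2) by (fastforce simp: centered_pairs_def noncentered_pairs_def fball_def)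
qed

lemma strong_const_mono: "strong_const S w \<B> p C \<Longrightarrow> strong_const S w \<B> p C'"
  and weak_const_mono: "weak_const S w \<B> p C \<Longrightarrow> weak_const S w \<B> p C'"
  if "C \<le> C'" "\<And>x. x \<in> S \<Longrightarrow> 0 < w x"
proof -
  have "0 \<le> (\<Sum>x\<in>S. w x * f x powr p)" for f
    by (intro sum_nonneg mult_nonneg_nonneg) (auto simp: that(2) less_imp_le)
  then have "C * (\<Sum>x\<in>S. w x * f x powr p) \<le> C' * (\<Sum>x\<in>S. w x * f x powr p)" for f
    using that(1) by (intro mult_right_mono)
  then show "strong_const S w \<B> p C \<Longrightarrow> strong_const S w \<B> p C'"
    "weak_const S w \<B> p C \<Longrightarrow> weak_const S w \<B> p C'"
    unfolding strong_const_def weak_const_def by (blast intro: order_trans)+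
qed

lemma centered_pairs_ex: "\<exists>(B, B')\<in>centered_pairs S d k x. B \<subseteq> S"
  unfolding centered_pairs_def
  by (intro bexI[of _ "(fball S d x 1, fball S d x (k * 1))"]) (auto simp: fball_def)

lemma noncentered_pairs_ex:
  assumes "Metric_space S d" "x \<in> S"
  shows "\<exists>(B, B')\<in>noncentered_pairs S d k x. B \<subseteq> S"
  using centered_subset_noncentered[OF assms, of k] centered_pairs_ex[of S d k x] by blast

lemma strong_const_subset:
  assumes "strong_const S w \<B> p C" "\<And>x. x \<in> S \<Longrightarrow> \<A> x \<subseteq> \<B> x"
  shows "strong_const S w \<A> p C"
  using assms unfolding strong_const_def by (smt (verit, best) subsetD)

lemma weak_const_subset:
  assumes "weak_const S w \<B> p C" "\<And>x. x \<in> S \<Longrightarrow> \<A> x \<subseteq> \<B> x"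
  shows "weak_const S w \<A> p C"
  unfolding weak_const_def
proof (intro allI impI)
  fix f t E
  assume *: "\<forall>x\<in>S. 0 \<le> f x" "0 < t" "E \<subseteq> S"
    "\<forall>x\<in>E. \<exists>(B, B')\<in>\<A> x. t * sum w B' < (\<Sum>y\<in>B. w y * f y)"
  then have "\<forall>x\<in>E. \<exists>(B, B')\<in>\<B> x. t * sum w B' < (\<Sum>y\<in>B. w y * f y)"
    using assms(2) by blast
  then show "t powr p * sum w E \<le> C * (\<Sum>x\<in>S. w x * f x powr p)"
    using * assms(1) unfolding weak_const_def by blast
qed

text \<open>Chebyshev's inequality in linearised form: the test function is \<open>t\<close> on
  \<open>E\<close> and 0 elsewhere. Off \<open>E\<close> the value 0 still has to be bounded by some
  average, hence the requirement that every point has a pair.\<close>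

lemma strong_const_imp_weak_const:
  assumes "strong_const S w \<B> p C" "finite S" "\<And>x. x \<in> S \<Longrightarrow> 0 < w x"
    and "\<And>x. x \<in> S \<Longrightarrow> \<exists>(B, B')\<in>\<B> x. B \<subseteq> S"
  shows "weak_const S w \<B> p C"
  unfolding weak_const_def
proof (intro allI impI)
  fix f t E
  assume *: "\<forall>x\<in>S. 0 \<le> f x" "0 < t" "E \<subseteq> S"
    "\<forall>x\<in>E. \<exists>(B, B')\<in>\<B> x. t * sum w B' < (\<Sum>y\<in>B. w y * f y)"
  define g where "g x = (if x \<in> E then t else 0)" for x
  have "0 \<le> g x \<and> (\<exists>(B, B')\<in>\<B> x. g x * sum w B' \<le> (\<Sum>y\<in>B. w y * f y))" if "x \<in> S" for x
  proof (cases "x \<in> E")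
    case True
    with * show ?thesis by (force simp: g_def)
  next
    case False
    obtain B B' where B: "(B, B') \<in> \<B> x" "B \<subseteq> S" using assms(4)[OF \<open>x \<in> S\<close>] by auto
    have "0 \<le> (\<Sum>y\<in>B. w y * f y)"
      using B(2) * assms(3) by (intro sum_nonneg mult_nonneg_nonneg) (auto intro!: less_imp_le[of 0 "w _"])
    with B(1) False show ?thesis by (auto simp: g_def intro!: bexI[of _ "(B, B')"])
  qed
  then have "(\<Sum>x\<in>S. w x * g x powr p) \<le> C * (\<Sum>x\<in>S. w x * f x powr p)"
    using assms(1) *(1) unfolding strong_const_def by blast
  moreover have "(\<Sum>x\<in>S. w x * g x powr p) = (\<Sum>x\<in>E. w x * t powr p)"
    using *(3) assms(2) by (intro sum.mono_neutral_cong_right) (auto simp: g_def)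
  ultimately show "t powr p * sum w E \<le> C * (\<Sum>x\<in>S. w x * f x powr p)"
    by (simp add: mult.commute flip: sum_distrib_right)
qed

text \<open>Truncation at height \<open>c\<close>: above it u = u^p u^(1-p), and u^(1-p) is at most
  c^(1-p) because 1 - p \<le> 0.\<close>

lemma le_add_powr:
  fixes u c p :: real
  assumes "0 \<le> u" "0 < c" "1 \<le> p"
  shows "u \<le> c + u powr p * c powr (1 - p)"
proof (cases "u \<le> c")
  case False
  then have "0 < u" using assms by simp
  have "u = u powr p * u powr (1 - p)" using \<open>0 < u\<close> by (simp flip: powr_add)
  also have "\<dots> \<le> u powr p * c powr (1 - p)"
    using False assms by (intro mult_left_mono powr_mono2') auto
  finally show ?thesis using assms by simp
qed (simp add: add_increasing2)

text \<open>Here \<open>V\<close> is a mass, \<open>J\<close> an energy and \<open>g\<close> an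
  average whose integrand was split at height \<open>g / 2\<close>. The low part is absorbed on the
  left; the factor 2^p comes from passing from (g/2)^p back to g^p.\<close>

lemma powr_le_of_split:
  fixes g p V J :: real
  assumes "0 < g" "g * V \<le> g / 2 * V + (g / 2) powr (1 - p) * J"
  shows "V * g powr p \<le> 2 powr p * J"
proof -
  define c where "c = g / 2"
  have c: "0 < c" using assms by (simp add: c_def)
  have "c * V \<le> c powr (1 - p) * J" using assms(2) by (simp add: c_def)
  then have "c powr (p - 1) * (c * V) \<le> c powr (p - 1) * (c powr (1 - p) * J)"
    by (intro mult_left_mono) auto
  also have "c powr (p - 1) * (c powr (1 - p) * J) = J"
    using c by (simp add: mult.assoc[symmetric] flip: powr_add)
  also have "c powr (p - 1) * (c * V) = V * c powr p"
    using c by (simp add: powr_diff)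
  finally have "V * c powr p \<le> J" .
  moreover have "g powr p = 2 powr p * c powr p"
    using c by (simp add: c_def powr_divide)
  ultimately show ?thesis by (simp add: mult.left_commute)
qed

text \<open>Splitting at height \<open>g / 2\<close> replaces Jensen's inequality, at the cost of the factor \<open>2\<^sup>p\<close>.\<close>

lemma average_powr_le:
  fixes w f :: "'a \<Rightarrow> real"
  assumes p: "1 \<le> p" and nonneg: "\<And>y. y \<in> B \<Longrightarrow> 0 \<le> w y" "\<And>y. y \<in> B \<Longrightarrow> 0 \<le> f y"
    and g: "0 \<le> g" "sum w B \<le> V" "g * V \<le> (\<Sum>y\<in>B. w y * f y)"
  shows "V * g powr p \<le> 2 powr p * (\<Sum>y\<in>B. w y * f y powr p)"
proof (cases "g = 0")
  case True
  then show ?thesis by (auto intro!: sum_nonneg mult_nonneg_nonneg nonneg)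
next
  case False
  define c where "c = g / 2"
  have c: "0 < c" using False g by (simp add: c_def)
  have "(\<Sum>y\<in>B. w y * f y) \<le> (\<Sum>y\<in>B. w y * (c + f y powr p * c powr (1 - p)))"
    using c p by (intro sum_mono mult_left_mono le_add_powr nonneg)
  also have "\<dots> = c * sum w B + c powr (1 - p) * (\<Sum>y\<in>B. w y * f y powr p)"
    by (simp add: algebra_simps sum.distrib sum_distrib_left)
  also have "\<dots> \<le> c * V + c powr (1 - p) * (\<Sum>y\<in>B. w y * f y powr p)" using c g by simp
  finally show ?thesis
    using g False by (intro powr_le_of_split) (auto simp: c_def)
qed

lemma add_powr_le:
  fixes u v p :: real
  assumes "0 \<le> u" "0 \<le> v" "0 \<le> p"
  shows "(u + v) powr p \<le> 2 powr p * (u powr p + v powr p)"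
proof -
  have "(u + v) powr p \<le> (2 * max u v) powr p"
    using assms by (intro powr_mono2) auto
  also have "\<dots> = 2 powr p * max u v powr p" using assms by (simp add: powr_mult)
  also have "\<dots> \<le> 2 powr p * (u powr p + v powr p)"
    by (intro mult_left_mono) (auto simp: max_def)
  finally show ?thesis .
qed

section \<open>Hub spaces\<close>

text \<open>The points are \<open>x\<^sub>i = Inl i\<close> and \<open>z\<^sub>i = Inr i\<close>, with the center \<open>x\<^sub>0\<close> at distance \<open>s\<^sub>i\<close> from \<open>x\<^sub>i\<close>.
  Each \<open>z\<^sub>i\<close> (for \<open>i \<ge> 1\<close>; the parameter will satisfy \<open>s\<^sub>0 = 0\<close>) is a midpoint of the center and \<open>x\<^sub>i\<close>,
  and all geodesics from \<open>z\<^sub>i\<close> to points other than \<open>x\<^sub>i\<close> pass through the center.\<close>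

fun hub_dist :: "(nat \<Rightarrow> real) \<Rightarrow> nat + nat \<Rightarrow> nat + nat \<Rightarrow> real" where
  "hub_dist s (Inl i) (Inl j) = (if i = j then 0 else max (s i) (s j))"
| "hub_dist s (Inr i) (Inr j) = (if i = j then 0 else (s i + s j) / 2)"
| "hub_dist s (Inl i) (Inr j) = s j / 2 + (if i = j then 0 else s i)"
| "hub_dist s (Inr j) (Inl i) = s j / 2 + (if i = j then 0 else s i)"

abbreviation hub_center :: "nat + nat" where "hub_center \<equiv> Inl 0"

definition hub_index :: "nat + nat \<Rightarrow> nat" where
  "hub_index = case_sum (\<lambda>i. i) (\<lambda>i. i)"

text \<open>For each \<open>i\<close> one of \<open>x\<^sub>i\<close>, \<open>z\<^sub>i\<close> is heavy, with mass \<open>m i\<close>, and the other is light, with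
  mass \<open>2\<^sup>-\<^sup>i\<close>; the flag says whether \<open>z\<^sub>i\<close> is the heavy one.\<close>

definition hub_heavy :: "bool \<Rightarrow> nat \<Rightarrow> nat + nat" where
  "hub_heavy b i = (if b then Inr i else Inl i)"

definition hub_light :: "bool \<Rightarrow> nat \<Rightarrow> nat + nat" where
  "hub_light b i = (if b then Inl i else Inr i)"

definition hub_points :: "nat \<Rightarrow> (nat + nat) set" where
  "hub_points N = insert hub_center (Inl ` {1..N} \<union> Inr ` {1..N})"

definition hub_weight :: "bool \<Rightarrow> (nat \<Rightarrow> real) \<Rightarrow> nat + nat \<Rightarrow> real" where
  "hub_weight b m q = (if q = hub_center then 1
     else if q = hub_heavy b (hub_index q) then m (hub_index q) else (1 / 2) ^ hub_index q)"

locale hub =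
  fixes N :: nat and s m :: "nat \<Rightarrow> real" and b :: bool
  assumes s_0: "s 0 = 0"
    and s_pos: "\<And>i. 1 \<le> i \<Longrightarrow> 0 < s i"
    and s_le: "\<And>i. i \<le> N \<Longrightarrow> s i \<le> 1"
    and m_ge: "\<And>i. 1 \<le> i \<Longrightarrow> 1 \<le> m i"
begin

abbreviation "S \<equiv> hub_points N"
abbreviation "d \<equiv> hub_dist s"
abbreviation "w \<equiv> hub_weight b m"
abbreviation "h \<equiv> hub_heavy b"
abbreviation "l \<equiv> hub_light b"
abbreviation "a \<equiv> hub_center"

lemma s_nonneg: "0 \<le> s i"
  using s_0 s_pos[of i] by (cases "i = 0") auto

lemma inj_h: "inj h" and inj_l: "inj l"
  by (auto simp: inj_def hub_heavy_def hub_light_def)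

lemma h_eq_iff [simp]: "h i = h j \<longleftrightarrow> i = j" and l_eq_iff [simp]: "l i = l j \<longleftrightarrow> i = j"
  and h_neq_l: "h i \<noteq> l j" "l i \<noteq> h j"
  by (auto simp: hub_heavy_def hub_light_def)

lemma h_neq_a [simp]: "1 \<le> i \<Longrightarrow> h i \<noteq> a" "1 \<le> i \<Longrightarrow> l i \<noteq> a"
  "Suc 0 \<le> i \<Longrightarrow> h i \<noteq> a" "Suc 0 \<le> i \<Longrightarrow> l i \<noteq> a"
  by (auto simp: hub_heavy_def hub_light_def)

lemma index_h [simp]: "hub_index (h i) = i" "hub_index (l i) = i"
  by (auto simp: hub_heavy_def hub_light_def hub_index_def)

lemma S_eq: "S = insert a (h ` {1..N} \<union> l ` {1..N})"
  by (auto simp: hub_points_def hub_heavy_def hub_light_def)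

lemma S_cases [consumes 1, case_names center heavy light]:
  assumes "q \<in> S"
  obtains "q = a" | i where "i \<in> {1..N}" "q = h i" | i where "i \<in> {1..N}" "q = l i"
  using assms by (auto simp: S_eq)

lemma in_S [simp]: "a \<in> S" "i \<in> {1..N} \<Longrightarrow> h i \<in> S" "i \<in> {1..N} \<Longrightarrow> l i \<in> S"
  by (auto simp: S_eq)

lemma finite_S [simp]: "finite S"
  by (simp add: S_eq)

lemma w_simps [simp]: "w a = 1" "1 \<le> i \<Longrightarrow> w (h i) = m i" "1 \<le> i \<Longrightarrow> w (l i) = (1 / 2) ^ i"
  "Suc 0 \<le> i \<Longrightarrow> w (h i) = m i" "Suc 0 \<le> i \<Longrightarrow> w (l i) = (1 / 2) ^ i"
  using h_neq_l by (auto simp: hub_weight_def)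

lemma m_pos: "1 \<le> i \<Longrightarrow> 0 < m i"
  using m_ge[of i] by simp

lemma w_pos: "q \<in> S \<Longrightarrow> 0 < w q"
  by (auto elim!: S_cases simp: m_pos)

lemma w_nonneg: "q \<in> S \<Longrightarrow> 0 \<le> w q"
  using w_pos by (simp add: less_imp_le)

lemma sum_S: "sum F S = F a + (\<Sum>i=1..N. F (h i)) + (\<Sum>i=1..N. F (l i))" for F :: "_ \<Rightarrow> real"
proof -
  have "sum F S = F a + sum F (h ` {1..N} \<union> l ` {1..N})"
    unfolding S_eq by (subst sum.insert) (auto simp: hub_heavy_def hub_light_def)
  also have "sum F (h ` {1..N} \<union> l ` {1..N}) = sum F (h ` {1..N}) + sum F (l ` {1..N})"
    by (rule sum.union_disjoint) (auto simp: hub_heavy_def hub_light_def)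
  also have "sum F (h ` {1..N}) = (\<Sum>i=1..N. F (h i))"
    by (subst sum.reindex) (auto intro: inj_on_subset[OF inj_h])
  also have "sum F (l ` {1..N}) = (\<Sum>i=1..N. F (l i))"
    by (subst sum.reindex) (auto intro: inj_on_subset[OF inj_l])
  finally show ?thesis by simp
qed

lemma sum_light_le: "(\<Sum>i=1..n. (1 / 2 :: real) ^ i) \<le> 1"
proof -
  have "(\<Sum>i=1..n. (1 / 2 :: real) ^ i) = 1 - (1 / 2) ^ n"
    by (induction n) (auto simp: field_simps)
  then show ?thesis by simp
qed

lemma metric: "Metric_space S d"
proof
  show "0 \<le> d x y" for x y
    using s_nonneg by (cases x; cases y) (auto simp: le_max_iff_disj)
  show "d x y = d y x" for x y
    by (cases x; cases y) auto
  show "d x y = 0 \<longleftrightarrow> x = y" if "x \<in> S" "y \<in> S" for x y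
  proof -
    have "max (s i) (s j) > 0" if "i \<noteq> j" for i j
      using that s_pos[of i] s_pos[of j] by (cases "i = 0") (auto simp: less_max_iff_disj)
    moreover have "s i / 2 + s j > 0" if "1 \<le> i" for i j
      using that s_pos[of i] s_nonneg[of j] by auto
    moreover have "s i + s j > 0" if "1 \<le> i" for i j
      using that s_pos[of i] s_nonneg[of j] by auto
    ultimately show ?thesis using that s_pos
      by (auto simp: hub_points_def less_le split: if_splits)
  qed
  show "d x z \<le> d x y + d y z" if "x \<in> S" "y \<in> S" "z \<in> S" for x y z
  proof -
    have "s i \<le> s j * 2" if "s i \<le> s j" for i j using that s_nonneg[of j] by simp
    moreover have "s i \<le> s j * 2" if "s i \<le> s k" "\<not> s j \<le> s k" for i j k
      using that s_nonneg[of j] by simp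
    ultimately show ?thesis using s_nonneg
      by (cases x; cases y; cases z) (auto simp: max_def field_simps)
  qed
qed

lemma finite_mms: "finite_mms S d w"
proof -
  have "d x y \<le> 2" if "x \<in> S" "y \<in> S" for x y
  proof -
    have "s (hub_index x) \<le> 1" "s (hub_index y) \<le> 1"
      using that s_le s_0 by (auto simp: hub_points_def hub_index_def)
    then show ?thesis by (cases x; cases y) (auto simp: hub_index_def)
  qed
  then show ?thesis using metric w_pos by (auto simp: finite_mms_def hub_points_def)
qed

text \<open>Leaving a branch is at least as long as going to the center: every point other than x_i
  and z_i has distance at least s_i from x_i and at least s_i / 2 from z_i. A ball that misses the
  center therefore stays in its branch.\<close>

lemma ball_cases:
  assumes "y \<in> S" "0 < r"
  shows "a \<in> fball S d y r \<or> (\<exists>i\<in>{1..N}. fball S d y r \<subseteq> {h i, l i})"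
proof (cases y)
  case (Inl i)
  show ?thesis
  proof (cases "s i < r")
    case True
    then show ?thesis using Inl s_0 s_nonneg[of i] assms(2) by (auto simp: fball_def max_def)
  next
    case False
    then have "i \<in> {1..N}" using assms Inl s_0 by (auto simp: hub_points_def)
    moreover have "fball S d y r \<subseteq> {Inl i, Inr i}"
    proof
      fix q assume "q \<in> fball S d y r"
      then have "d (Inl i) q < r" using Inl by (simp add: fball_def)
      then show "q \<in> {Inl i, Inr i}"
        using False s_nonneg[of "hub_index q"]
        by (cases q) (auto simp: hub_index_def split: if_splits)
    qed
    moreover have "{Inl i, Inr i} = {h i, l i}" by (auto simp: hub_heavy_def hub_light_def)
    ultimately show ?thesis by auto
  qed
next
  case (Inr i)
  then have i: "i \<in> {1..N}" using assms by (auto simp: hub_points_def)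
  show ?thesis
  proof (cases "s i / 2 < r")
    case True
    then show ?thesis using Inr s_0 i by (auto simp: fball_def)
  next
    case False
    have "fball S d y r \<subseteq> {Inl i, Inr i}"
    proof
      fix q assume "q \<in> fball S d y r"
      then have "d (Inr i) q < r" using Inr by (simp add: fball_def)
      then show "q \<in> {Inl i, Inr i}"
        using False s_nonneg[of "hub_index q"]
        by (cases q) (auto simp: hub_index_def split: if_splits)
    qed
    moreover have "{Inl i, Inr i} = {h i, l i}" by (auto simp: hub_heavy_def hub_light_def)
    ultimately show ?thesis using i by auto
  qed
qed


lemma noncentered_cases:
  assumes "(B, B') \<in> noncentered_pairs S d k q" "1 \<le> k"
  obtains "q \<in> B" "B \<subseteq> B'" "B' \<subseteq> S" "a \<in> B"
    | i where "q \<in> B" "B \<subseteq> B'" "B' \<subseteq> S" "i \<in> {1..N}" "B \<subseteq> {h i, l i}"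
proof -
  obtain y r where y: "y \<in> S" "0 < r" "q \<in> fball S d y r"
      "B = fball S d y r" "B' = fball S d y (k * r)"
    using assms(1) by (auto simp: noncentered_pairs_def)
  moreover have "B \<subseteq> B'" using y(2,4,5) assms(2) by (simp add: fball_enlarge)
  ultimately show thesis using that ball_cases[OF y(1,2)] fball_subset[of S d] by metis
qed

lemma noncentered_sum_le:
  assumes "(B, B') \<in> noncentered_pairs S d k q" "1 \<le> k"
  shows "sum w B \<le> sum w B'" "B \<subseteq> S" "finite B" "finite B'"
proof -
  have "B \<subseteq> B'" "B' \<subseteq> S" using assms by (auto elim!: noncentered_cases)
  then show "B \<subseteq> S" "finite B" "finite B'" using finite_subset[OF _ finite_S] by blast+
  show "sum w B \<le> sum w B'"
    using \<open>B \<subseteq> B'\<close> \<open>B' \<subseteq> S\<close> \<open>finite B'\<close> w_nonneg by (intro sum_mono2) auto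
qed

lemma energy_nonneg: "0 \<le> (\<Sum>x\<in>A. w x * f x powr p)" if "A \<subseteq> S"
  using that w_nonneg by (intro sum_nonneg) auto

text \<open>The part of the maximal function governed by balls inside a pair \<open>{h i, l i}\<close>, by balls
  with a comparable share of the total mass, and by all balls around the center when evaluated
  off the heavy points.\<close>

lemma tame_part_le:
  assumes p: "1 \<le> p" and f: "\<And>x. x \<in> S \<Longrightarrow> 0 \<le> f x" and Q: "Q \<subseteq> S"
    and tame: "\<And>q. q \<in> Q \<Longrightarrow> 0 \<le> g q \<and> (\<exists>B V. B \<subseteq> S \<and> q \<in> B \<and> sum w B \<le> V \<and>
      g q * V \<le> (\<Sum>y\<in>B. w y * f y) \<and>
      ((\<exists>i\<in>{1..N}. B \<subseteq> {h i, l i}) \<or> a \<in> B \<and> q \<notin> h ` {1..N} \<or> sum w S \<le> 4 * V))"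
  shows "(\<Sum>q\<in>Q. w q * g q powr p) \<le> 8 * 2 powr p * (\<Sum>q\<in>S. w q * f q powr p)"
proof -
  define \<phi> where "\<phi> q = w q * f q powr p" for q
  define J where "J = sum \<phi> S"
  define W where "W = sum w S"
  define P where "P q = (if q = a then 0 else \<phi> (h (hub_index q)) + \<phi> (l (hub_index q)))" for q
  define L where "L q = (if q \<in> h ` {1..N} then 0 else w q)" for q
  have \<phi>: "0 \<le> \<phi> q" if "q \<in> S" for q using w_nonneg that by (simp add: \<phi>_def)
  have J: "0 \<le> J" using \<phi> by (simp add: J_def sum_nonneg)
  have W: "0 < W" unfolding W_def using w_pos by (intro sum_pos) (auto simp: S_eq)
  have L: "0 \<le> L q" if "q \<in> S" for q using w_nonneg that by (simp add: L_def)
  have P: "0 \<le> P q" if "q \<in> S" for q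
    using that by (cases rule: S_cases) (auto simp: P_def intro!: add_nonneg_nonneg \<phi>)
  \<comment> \<open>One summand for each alternative of the hypothesis. Summed over \<open>S\<close>
    they give at most 2 J (each branch is counted by its two points), 2 J (center and light points
    weigh at most 2) and 4 J; this is the factor 8.\<close>
  define R where "R q = 2 powr p * (P q + L q * J + 4 * w q / W * J)" for q
  have "w q * g q powr p \<le> R q" if q: "q \<in> Q" for q
  proof -
    have qS: "q \<in> S" using q Q by auto
    obtain B V where B: "0 \<le> g q" "B \<subseteq> S" "q \<in> B" "sum w B \<le> V"
        "g q * V \<le> (\<Sum>y\<in>B. w y * f y)"
        "(\<exists>i\<in>{1..N}. B \<subseteq> {h i, l i}) \<or> a \<in> B \<and> q \<notin> h ` {1..N} \<or> sum w S \<le> 4 * V"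
      using tame[OF q] by blast
    have finB: "finite B" using B(2) finite_subset[OF _ finite_S] by blast
    have V: "V * g q powr p \<le> 2 powr p * sum \<phi> B"
      unfolding \<phi>_def using p B f w_nonneg by (intro average_powr_le) auto
    have BJ: "sum \<phi> B \<le> J" unfolding J_def using B(2) \<phi> by (intro sum_mono2) auto
    have wV: "w x \<le> V" if "x \<in> B" for x
      using member_le_sum[of x B w] that B w_nonneg finB by force
    have rest: "0 \<le> P q" "0 \<le> L q * J" "0 \<le> 4 * w q / W * J"
      using P L J W qS w_nonneg by auto
    consider i where "i \<in> {1..N}" "B \<subseteq> {h i, l i}" | "a \<in> B" "q \<notin> h ` {1..N}" | "W \<le> 4 * V"
      using B(6) W_def by blast
    then have "\<exists>T. w q * g q powr p \<le> 2 powr p * T \<and> T \<le> P q + L q * J + 4 * w q / W * J"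
    proof cases
      case 1
      then have i: "q = h i \<or> q = l i" using B(3) by auto
      have "w q * g q powr p \<le> V * g q powr p" using wV[OF B(3)] by (intro mult_right_mono) auto
      also note V
      also have "sum \<phi> B \<le> sum \<phi> {h i, l i}"
        using 1 \<phi> by (intro sum_mono2) auto
      also have "\<dots> = P q" using 1 i by (auto simp: P_def h_neq_l)
      finally show ?thesis using rest by (intro exI[of _ "P q"]) auto
    next
      case 2
      \<comment> \<open>The center has mass 1, so V \<ge> 1 and the p-th power of the value is
        controlled by the whole energy. It then suffices that the weights of such points
        \<open>q\<close> are summable.\<close>
      have "1 * g q powr p \<le> V * g q powr p" using wV[OF 2(1)] by (intro mult_right_mono) auto
      also note V
      also note BJ
      finally have "w q * (1 * g q powr p) \<le> w q * (2 powr p * J)"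
        using w_nonneg[OF qS] by (intro mult_left_mono) auto
      moreover have "L q = w q" using 2 by (simp add: L_def)
      ultimately show ?thesis using rest by (intro exI[of _ "L q * J"]) (auto simp: mult_ac)
    next
      case 3
      have "W / 4 * g q powr p \<le> V * g q powr p" using 3 by (intro mult_right_mono) auto
      also note V
      also note BJ
      finally have "(4 * w q / W) * (W / 4 * g q powr p) \<le> (4 * w q / W) * (2 powr p * J)"
        using w_nonneg[OF qS] W by (intro mult_left_mono) auto
      then show ?thesis using rest W by (intro exI[of _ "4 * w q / W * J"]) (auto simp: mult_ac)
    qed
    then obtain T where T: "w q * g q powr p \<le> 2 powr p * T" "T \<le> P q + L q * J + 4 * w q / W * J"
      by blast
    have "2 powr p * T \<le> R q" unfolding R_def using T(2) by (intro mult_left_mono) auto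
    with T(1) show ?thesis by linarith
  qed
  then have "(\<Sum>q\<in>Q. w q * g q powr p) \<le> sum R Q" by (rule sum_mono)
  also have "\<dots> \<le> sum R S"
    using Q P L J W w_nonneg unfolding R_def by (intro sum_mono2) (auto intro!: add_nonneg_nonneg mult_nonneg_nonneg divide_nonneg_nonneg)
  also have "sum R S = 2 powr p * (sum P S + sum L S * J + 4 * J)"
  proof -
    have "(\<Sum>q\<in>S. 4 * w q / W * J) = 4 * J"
      using W by (simp add: W_def flip: sum_distrib_left sum_distrib_right sum_divide_distrib)
    then show ?thesis
      unfolding R_def by (simp add: sum.distrib flip: sum_distrib_left sum_distrib_right)
  qed
  also have "\<dots> \<le> 2 powr p * (2 * J + 2 * J + 4 * J)"
  proof -
    have "sum P S \<le> 2 * J"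
      unfolding J_def sum_S using \<phi>[of a] by (auto simp: P_def sum.distrib)
    moreover have "sum L S \<le> 2"
    proof -
      have "L a = 1" by (auto simp: L_def hub_heavy_def)
      moreover have "(\<Sum>i=1..N. L (h i)) = 0" by (simp add: L_def)
      moreover have "(\<Sum>i=1..N. L (l i)) = (\<Sum>i=1..N. (1 / 2) ^ i)"
        using h_neq_l by (intro sum.cong) (auto simp: L_def)
      ultimately show ?thesis unfolding sum_S using sum_light_le[of N] by simp
    qed
    ultimately show ?thesis using J by (intro mult_left_mono add_mono mult_right_mono) auto
  qed
  finally show ?thesis by (simp add: J_def \<phi>_def)
qed

end

context hub
begin

text \<open>The hypothesis of \<open>tame_part_le\<close> at a single point. It gets a name because
  the points that escape it have to be summed by a separate argument.\<close>

definition tame :: "(nat + nat \<Rightarrow> real) \<Rightarrow> nat + nat \<Rightarrow> real \<Rightarrow> bool" where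
  "tame f q g \<longleftrightarrow> 0 \<le> g \<and> (\<exists>B V. B \<subseteq> S \<and> q \<in> B \<and> sum w B \<le> V \<and>
      g * V \<le> (\<Sum>y\<in>B. w y * f y) \<and>
      ((\<exists>i\<in>{1..N}. B \<subseteq> {h i, l i}) \<or> a \<in> B \<and> q \<notin> h ` {1..N} \<or> sum w S \<le> 4 * V))"

text \<open>Leaves only the heavy points that are not tame. The weak-type proofs apply it with
  \<open>g\<close> constant, equal to the level.\<close>

lemma sum_le_tame_plus_heavy:
  assumes p: "1 \<le> p" and f: "\<And>x. x \<in> S \<Longrightarrow> 0 \<le> f x" and E: "E \<subseteq> S"
    and *: "\<And>q. q \<in> E \<Longrightarrow> tame f q (g q) \<or> q \<in> h ` {1..N}"
  shows "(\<Sum>q\<in>E. w q * g q powr p) \<le> 8 * 2 powr p * (\<Sum>q\<in>S. w q * f q powr p) +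
    (\<Sum>i | i \<in> {1..N} \<and> h i \<in> E \<and> \<not> tame f (h i) (g (h i)). m i * g (h i) powr p)"
proof -
  let ?R = "{i. i \<in> {1..N} \<and> h i \<in> E \<and> \<not> tame f (h i) (g (h i))}"
  let ?Q = "{q\<in>E. tame f q (g q)}"
  have fin: "finite E" using E finite_S finite_subset by blast
  have "q \<in> ?Q \<union> h ` ?R" if "q \<in> E" for q
    using *[OF that] that by (cases "tame f q (g q)") auto
  then have E_eq: "E = ?Q \<union> h ` ?R" by auto
  have "(\<Sum>q\<in>E. w q * g q powr p) = (\<Sum>q\<in>?Q. w q * g q powr p) + (\<Sum>q\<in>h ` ?R. w q * g q powr p)"
    using fin by (subst E_eq, intro sum.union_disjoint) auto
  also have "(\<Sum>q\<in>h ` ?R. w q * g q powr p) = (\<Sum>i\<in>?R. m i * g (h i) powr p)"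
    by (subst sum.reindex) (auto intro: inj_on_subset[OF inj_h])
  also have "(\<Sum>q\<in>?Q. w q * g q powr p) \<le> 8 * 2 powr p * (\<Sum>q\<in>S. w q * f q powr p)"
    using p f E by (intro tame_part_le) (auto simp: tame_def)
  finally show ?thesis by simp
qed

lemma noncentered_tameI:
  assumes B: "(B, B') \<in> noncentered_pairs S d k q" "1 \<le> k"
    and g: "0 \<le> g" "g * sum w B' \<le> (\<Sum>y\<in>B. w y * f y)"
    and "(\<exists>i\<in>{1..N}. B \<subseteq> {h i, l i}) \<or> a \<in> B \<and> q \<notin> h ` {1..N} \<or> sum w S \<le> 4 * sum w B'"
  shows "tame f q g"
proof -
  have "q \<in> B" using B by (auto elim!: noncentered_cases)
  then show ?thesis unfolding tame_def using noncentered_sum_le[OF B] g assms(5)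
    by (intro conjI exI[of _ B] exI[of _ "sum w B'"]) auto
qed

text \<open>Since \<open>h M\<close> lies in \<open>B\<close>, the denominator is at least
  \<open>m M\<close>, and dividing by \<open>m M\<close> separates the value at \<open>h M\<close>
  from the integral over the other points. In stars \<open>h M\<close> is the point of evaluation,
  in chains it is the heaviest point of the ball.\<close>

lemma heavy_value_le:
  assumes f: "\<And>x. x \<in> S \<Longrightarrow> 0 \<le> f x" and M: "M \<in> {1..N}" and A: "A \<subseteq> S" "h M \<notin> A"
    and B: "B \<subseteq> insert (h M) A" "h M \<in> B" "sum w B \<le> V"
    and g: "0 \<le> g" "g * V \<le> (\<Sum>y\<in>B. w y * f y)"
  shows "g \<le> f (h M) + (\<Sum>y\<in>A. w y * f y) / m M"
proof -
  have fin: "finite A" using A(1) finite_S by (rule finite_subset)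
  then have fin: "finite A" "finite B" using finite_subset[OF B(1)] by auto
  have "m M \<le> sum w B"
  proof -
    have "0 \<le> w x" if "x \<in> B" for x using that B(1) A(1) M by (intro w_nonneg) auto
    then show ?thesis using member_le_sum[of "h M" B w] B(2) fin(2) M by simp
  qed
  then have "g * m M \<le> g * V" using B(3) g(1) by (intro mult_left_mono) auto
  also have "\<dots> \<le> (\<Sum>y\<in>B. w y * f y)" by fact
  also have "\<dots> \<le> (\<Sum>y\<in>insert (h M) A. w y * f y)"
    using A B M f w_nonneg fin by (intro sum_mono2) auto
  also have "\<dots> = m M * f (h M) + (\<Sum>y\<in>A. w y * f y)"
    using A M fin by simp
  finally show ?thesis using m_pos[of M] M by (simp add: field_simps)
qed

lemma mass_average_powr_le:
  assumes p: "1 \<le> p" and f: "\<And>x. x \<in> S \<Longrightarrow> 0 \<le> f x" and A: "A \<subseteq> S" "sum w A \<le> V" "0 < V"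
  shows "V * ((\<Sum>y\<in>A. w y * f y) / V) powr p \<le> 2 powr p * (\<Sum>q\<in>S. w q * f q powr p)"
proof -
  have nn: "0 \<le> (\<Sum>y\<in>A. w y * f y)" using A f w_nonneg by (intro sum_nonneg) auto
  have "V * ((\<Sum>y\<in>A. w y * f y) / V) powr p \<le> 2 powr p * (\<Sum>y\<in>A. w y * f y powr p)"
    using p f A w_nonneg nn by (intro average_powr_le) auto
  also have "(\<Sum>y\<in>A. w y * f y powr p) \<le> (\<Sum>q\<in>S. w q * f q powr p)"
    using A w_nonneg by (intro sum_mono2) auto
  finally show ?thesis by simp
qed

lemma heavy_sum_le:
  assumes "I \<subseteq> {1..N}"
  shows "(\<Sum>i\<in>I. m i * f (h i) powr p) \<le> (\<Sum>q\<in>S. w q * f q powr p)"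
proof -
  have "(\<Sum>i\<in>I. m i * f (h i) powr p) = (\<Sum>q\<in>h ` I. w q * f q powr p)"
    using assms by (subst sum.reindex) (auto intro: inj_on_subset[OF inj_h] intro!: sum.cong)
  also have "\<dots> \<le> (\<Sum>q\<in>S. w q * f q powr p)"
    using assms w_nonneg by (intro sum_mono2) auto
  finally show ?thesis .
qed

text \<open>This set has mass at most 2 for every \<open>N\<close>, comparable to the center alone,
  so integrals over it behave like averages.\<close>

definition off_heavy :: "(nat + nat) set" where
  "off_heavy = insert a (l ` {1..N})"

lemma off_heavy: "off_heavy \<subseteq> S" "h i \<in> off_heavy \<longleftrightarrow> i = 0 \<and> \<not> b" "sum w off_heavy \<le> 2"
  "sum w S = sum w off_heavy + (\<Sum>i=1..N. m i)"
proof -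
  show "off_heavy \<subseteq> S" by (auto simp: off_heavy_def)
  show "h i \<in> off_heavy \<longleftrightarrow> i = 0 \<and> \<not> b"
    by (auto simp: off_heavy_def hub_heavy_def hub_light_def)
  have "sum w off_heavy = 1 + (\<Sum>q\<in>l ` {1..N}. w q)"
    unfolding off_heavy_def by (subst sum.insert) (auto simp: hub_light_def)
  also have "(\<Sum>q\<in>l ` {1..N}. w q) = (\<Sum>i=1..N. (1 / 2) ^ i)"
    by (subst sum.reindex) (auto intro: inj_on_subset[OF inj_l])
  finally have *: "sum w off_heavy = 1 + (\<Sum>i=1..N. (1 / 2) ^ i)" .
  show "sum w off_heavy \<le> 2" using sum_light_le[of N] * by simp
  show "sum w S = sum w off_heavy + (\<Sum>i=1..N. m i)" by (simp add: sum_S *)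
qed

lemma center_indicator_sum:
  assumes "B \<subseteq> S"
  shows "(\<Sum>y\<in>B. w y * (if y = a then 1 else 0)) = (if a \<in> B then 1 else 0)"
proof -
  have "finite B" using assms finite_subset[OF _ finite_S] by blast
  have "(\<Sum>y\<in>B. w y * (if y = a then 1 else 0)) = (\<Sum>y\<in>B. if y = a then 1 else 0)"
    by (intro sum.cong) auto
  with \<open>finite B\<close> show ?thesis by simp
qed

text \<open>Such a \<open>B\<close> can miss only light points, of total mass at most 1, which is no
  more than the center contributes.\<close>

lemma all_heavy_mass:
  assumes "a \<in> B" "h ` {1..N} \<subseteq> B" "B \<subseteq> S"
  shows "sum w S \<le> 4 * sum w B"
proof -
  have "sum w (insert a (h ` {1..N})) \<le> sum w B"
    using assms w_nonneg finite_subset[OF assms(3) finite_S] by (intro sum_mono2) auto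
  moreover have "sum w (insert a (h ` {1..N})) = 1 + (\<Sum>i=1..N. m i)"
  proof -
    have "sum w (h ` {1..N}) = (\<Sum>i=1..N. m i)"
      by (subst sum.reindex) (auto intro: inj_on_subset[OF inj_h])
    moreover have "a \<notin> h ` {1..N}" by (auto simp: hub_heavy_def)
    ultimately show ?thesis by simp
  qed
  moreover have "0 \<le> (\<Sum>i=1..N. m i)" using m_pos by (intro sum_nonneg) (auto intro: less_imp_le)
  ultimately show ?thesis using off_heavy(3,4) by simp
qed

text \<open>Testing on the indicator of the center.\<close>

lemma strong_const_imp_sum_le:
  assumes C: "strong_const S w \<B> p C"
    and heavy: "\<And>i. i \<in> {1..N} \<Longrightarrow> \<exists>(B, B')\<in>\<B> (h i). a \<in> B \<and> B \<subseteq> S \<and> sum w B' \<le> 4 * m i"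
    and ex: "\<And>q. q \<in> S \<Longrightarrow> \<exists>(B, B')\<in>\<B> q. B \<subseteq> S"
    and p: "1 \<le> p"
  shows "(\<Sum>i=1..N. m i powr (1 - p)) \<le> 4 powr p * C"
proof -
  define f :: "nat + nat \<Rightarrow> real" where "f q = (if q = a then 1 else 0)" for q
  \<comment> \<open>The guaranteed average: the numerator is 1, from the center, and the enlarged
    ball has mass at most 4 times that of the heavy point.\<close>
  define g where "g q = (if q \<in> h ` {1..N} then 1 / (4 * m (hub_index q)) else 0)" for q
  note f_sum = center_indicator_sum[folded f_def]
  have "0 \<le> g q \<and> (\<exists>(B, B')\<in>\<B> q. g q * sum w B' \<le> (\<Sum>y\<in>B. w y * f y))" if "q \<in> S" for q
  proof (cases "q \<in> h ` {1..N}")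
    case True
    then obtain i where i: "i \<in> {1..N}" "q = h i" by auto
    obtain B B' where B: "(B, B') \<in> \<B> q" "a \<in> B" "B \<subseteq> S" "sum w B' \<le> 4 * m i"
      using heavy[OF i(1)] i(2) by auto
    have "g q * sum w B' \<le> 1"
      using B(4) i m_pos[of i] by (simp add: g_def field_simps)
    moreover have "0 \<le> g q" using i m_pos[of i] by (simp add: g_def)
    ultimately show ?thesis using B f_sum[OF B(3)] by (intro conjI bexI[of _ "(B, B')"]) auto
  next
    case False
    then have "g q = 0" by (simp add: g_def)
    moreover obtain B B' where "(B, B') \<in> \<B> q" "B \<subseteq> S" using ex[OF \<open>q \<in> S\<close>] by auto
    ultimately show ?thesis
      using f_sum[of B] by (intro conjI bexI[of _ "(B, B')"]) auto
  qed
  moreover have "\<forall>q\<in>S. 0 \<le> f q" by (simp add: f_def)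
  ultimately have *: "(\<Sum>q\<in>S. w q * g q powr p) \<le> C * (\<Sum>q\<in>S. w q * f q powr p)"
    using C unfolding strong_const_def by blast
  have "(\<Sum>q\<in>S. w q * f q powr p) = (\<Sum>q\<in>S. w q * f q)"
    by (intro sum.cong) (auto simp: f_def)
  then have J: "(\<Sum>q\<in>S. w q * f q powr p) = 1" using f_sum[of S] by simp
  have "(\<Sum>i=1..N. m i powr (1 - p)) = (\<Sum>i=1..N. 4 powr p * (m i * g (h i) powr p))"
  proof (intro sum.cong refl)
    fix i assume i: "i \<in> {1..N}"
    then have "m i * g (h i) powr p = m i * (1 / (4 * m i)) powr p" by (simp add: g_def)
    also have "\<dots> = m i powr (1 - p) / 4 powr p"
      using m_pos[of i] i by (simp add: powr_divide powr_mult powr_diff)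
    finally show "m i powr (1 - p) = 4 powr p * (m i * g (h i) powr p)" by simp
  qed
  also have "\<dots> = 4 powr p * (\<Sum>i=1..N. m i * g (h i) powr p)" by (simp add: sum_distrib_left)
  also have "\<dots> \<le> 4 powr p * (\<Sum>q\<in>S. w q * g q powr p)"
    using heavy_sum_le[of "{1..N}" g p] by (intro mult_left_mono) auto
  also have "\<dots> \<le> 4 powr p * C" using * J by (intro mult_left_mono) auto
  finally show ?thesis .
qed

lemma weak_const_imp_sum_le:
  assumes C: "weak_const S w \<B> p C"
    and heavy: "\<And>i. i \<in> {1..N} \<Longrightarrow> \<exists>(B, B')\<in>\<B> (h i). a \<in> B \<and> B \<subseteq> S \<and> sum w B' \<le> 4 * m i"
    and T: "0 < T"
  shows "(\<Sum>i | i \<in> {1..N} \<and> m i \<le> T. m i) \<le> 8 powr p * C * T powr p"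
proof -
  define f :: "nat + nat \<Rightarrow> real" where "f q = (if q = a then 1 else 0)" for q
  define I where "I = {i. i \<in> {1..N} \<and> m i \<le> T}"
  note f_sum = center_indicator_sum[folded f_def]
  \<comment> \<open>The level 1 / (4 T) would match the mass bound exactly; 1 / (8 T) makes the
    inequality strict, as \<open>weak_const\<close> demands.\<close>
  have "\<exists>(B, B')\<in>\<B> q. 1 / (8 * T) * sum w B' < (\<Sum>y\<in>B. w y * f y)" if "q \<in> h ` I" for q
  proof -
    obtain i where i: "i \<in> {1..N}" "q = h i" "m i \<le> T" using \<open>q \<in> h ` I\<close> by (auto simp: I_def)
    obtain B B' where B: "(B, B') \<in> \<B> q" "a \<in> B" "B \<subseteq> S" "sum w B' \<le> 4 * m i"
      using heavy[OF i(1)] i(2) by auto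
    have "sum w B' < 8 * T" using B(4) i T by simp
    then have "1 / (8 * T) * sum w B' < 1" using T by (simp add: field_simps)
    with B f_sum[OF B(3)] show ?thesis by (intro bexI[of _ "(B, B')"]) auto
  qed
  moreover have "\<forall>q\<in>S. 0 \<le> f q" "h ` I \<subseteq> S" by (auto simp: f_def I_def)
  ultimately have *: "(1 / (8 * T)) powr p * sum w (h ` I) \<le> C * (\<Sum>q\<in>S. w q * f q powr p)"
    using C[unfolded weak_const_def, rule_format, of f "1 / (8 * T)" "h ` I"] T by simp
  have "(\<Sum>q\<in>S. w q * f q powr p) = (\<Sum>q\<in>S. w q * f q)"
    by (intro sum.cong) (auto simp: f_def)
  then have J: "(\<Sum>q\<in>S. w q * f q powr p) = 1" using f_sum[of S] by simp
  have "sum w (h ` I) = (\<Sum>i\<in>I. m i)"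
    by (subst sum.reindex) (auto intro: inj_on_subset[OF inj_h] simp: I_def intro!: sum.cong)
  then have "(\<Sum>i\<in>I. m i) / (8 * T) powr p \<le> C" using * J T by (simp add: powr_divide)
  then show ?thesis using T by (simp add: I_def powr_mult field_simps)
qed

end

section \<open>Stars: all branches have length 1\<close>

locale star = hub +
  assumes s_1: "\<And>i. 1 \<le> i \<Longrightarrow> s i = 1"
begin

text \<open>Seen from any point of the star, all heavy points lie at one common distance, except at
  most one that is nearer. A second heavy point in a ball therefore brings in all the
  others.\<close>

lemma star_ball_cases:
  assumes "y \<in> S" "0 < r" "a \<in> fball S d y r" "i \<in> {1..N}" "h i \<in> fball S d y r"
  shows "h ` {1..N} \<subseteq> fball S d y r \<or> fball S d y r \<subseteq> insert (h i) off_heavy"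
proof (rule disjCI)
  assume "\<not> fball S d y r \<subseteq> insert (h i) off_heavy"
  then obtain q where q: "q \<in> fball S d y r" "q \<noteq> h i" "q \<notin> off_heavy" by auto
  then have "q \<in> S" by (simp add: fball_def)
  then obtain j where j: "j \<in> {1..N}" "q = h j"
    using q(3) by (cases rule: S_cases) (auto simp: off_heavy_def)
  have "h n \<in> fball S d y r" if n: "n \<in> {1..N}" for n
  proof -
    have r: "d y a < r" "d y (h i) < r" "d y (h j) < r" "i \<noteq> j"
      using assms q j by (auto simp: fball_def)
    have s1: "s i = 1" "s j = 1" "s n = 1" using s_1 j(1) n assms(4) by auto
    have sy: "y = a \<or> (\<exists>u. y = Inl u \<and> s u = 1) \<or> (\<exists>u. y = Inr u \<and> s u = 1)"
      using assms(1) s_1 by (auto simp: hub_points_def)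
    have "d y (h n) < r"
    proof (cases b)
      case True
      then show ?thesis using r sy s1 s_0 by (auto simp: hub_heavy_def split: if_splits)
    next
      case False
      then show ?thesis using r sy s1 s_0 by (auto simp: hub_heavy_def split: if_splits)
    qed
    then show ?thesis using n by (simp add: fball_def)
  qed
  then show "h ` {1..N} \<subseteq> fball S d y r" by blast
qed

text \<open>A ball that is not tame contains the center and exactly one heavy point, the point of
  evaluation: two heavy points would bring in all of them, and the ball would carry a fixed share of
  the total mass.\<close>

lemma star_value_cases:
  assumes B: "(B, B') \<in> noncentered_pairs S d k q" "1 \<le> k" and q: "q \<in> S"
    and f: "\<And>x. x \<in> S \<Longrightarrow> 0 \<le> f x" and g: "0 \<le> g" "g * sum w B' \<le> (\<Sum>y\<in>B. w y * f y)"
  shows "tame f q g \<or>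
    (\<exists>i\<in>{1..N}. q = h i \<and> g \<le> f (h i) + (\<Sum>y\<in>off_heavy. w y * f y) / m i)"
proof -
  obtain y r where y: "y \<in> S" "0 < r" "q \<in> fball S d y r" "B = fball S d y r"
    using B(1) by (auto simp: noncentered_pairs_def)
  note le = noncentered_sum_le[OF B]
  note tameI = noncentered_tameI[OF B g]
  show ?thesis
  proof (cases "(\<exists>i\<in>{1..N}. B \<subseteq> {h i, l i}) \<or> a \<in> B \<and> q \<notin> h ` {1..N}")
    case False
    then have aB: "a \<in> B" using ball_cases[OF y(1,2)] y(4) by auto
    with False obtain i where i: "i \<in> {1..N}" "q = h i" by auto
    have "h ` {1..N} \<subseteq> B \<or> B \<subseteq> insert (h i) off_heavy"
      using star_ball_cases[OF y(1,2) _ i(1)] aB y i by auto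
    then show ?thesis
    proof
      assume "h ` {1..N} \<subseteq> B"
      then have "sum w S \<le> 4 * sum w B" using aB le(2) by (intro all_heavy_mass)
      then have "sum w S \<le> 4 * sum w B'" using le(1) by simp
      then show ?thesis using tameI by blast
    next
      assume "B \<subseteq> insert (h i) off_heavy"
      then have "g \<le> f (h i) + (\<Sum>y\<in>off_heavy. w y * f y) / m i"
        using i y le g f off_heavy(1,2) by (intro heavy_value_le[of f i off_heavy B "sum w B'"]) auto
      with i show ?thesis by blast
    qed
  qed (use tameI in auto)
qed

text \<open>The average bound for V = 2. One factor 2^p is the constant of that bound, the other
  comes from passing from the average to the integral.\<close>

lemma off_heavy_powr_le:
  assumes p: "1 \<le> p" and f: "\<And>x. x \<in> S \<Longrightarrow> 0 \<le> f x"
  shows "(\<Sum>y\<in>off_heavy. w y * f y) powr p \<le> 4 powr p * (\<Sum>q\<in>S. w q * f q powr p)"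
proof -
  let ?F = "\<Sum>y\<in>off_heavy. w y * f y"
  have F: "0 \<le> ?F" using off_heavy(1) f w_nonneg by (intro sum_nonneg) auto
  have "(?F / 2) powr p \<le> 2 * (?F / 2) powr p" by simp
  also have "\<dots> \<le> 2 powr p * (\<Sum>q\<in>S. w q * f q powr p)"
    by (rule mass_average_powr_le) (use p f off_heavy in auto)
  finally have "?F powr p \<le> 2 powr p * (2 powr p * (\<Sum>q\<in>S. w q * f q powr p))"
    using F by (simp add: powr_divide field_simps)
  also have "\<dots> = 4 powr p * (\<Sum>q\<in>S. w q * f q powr p)"
    by (simp flip: powr_mult mult.assoc)
  finally show ?thesis .
qed

text \<open>At a heavy point that is not tame the value is at most f (h i) + F / m i, where F is the
  integral off the heavy points. The first term costs 2^p energies; the second contributes F^p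
  m_i^(1-p), and 8^p = 2^p 4^p combines the constants of \<open>add_powr_le\<close> and
  \<open>off_heavy_powr_le\<close>.\<close>

lemma star_strong_const:
  assumes p: "1 \<le> p" and k: "1 \<le> k"
  shows "strong_const S w (noncentered_pairs S d k) p
    (8 * 2 powr p + (2 powr p + 8 powr p * (\<Sum>i=1..N. m i powr (1 - p))))"
  unfolding strong_const_def
proof (intro allI impI)
  fix f g :: "nat + nat \<Rightarrow> real"
  assume f: "\<forall>x\<in>S. 0 \<le> f x"
    and g: "\<forall>x\<in>S. 0 \<le> g x \<and>
      (\<exists>(B, B')\<in>noncentered_pairs S d k x. g x * sum w B' \<le> (\<Sum>y\<in>B. w y * f y))"
  define J where "J = (\<Sum>q\<in>S. w q * f q powr p)"
  define F where "F = (\<Sum>y\<in>off_heavy. w y * f y)"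
  have F: "0 \<le> F" using off_heavy(1) f w_nonneg by (auto simp: F_def intro!: sum_nonneg)
  have cases: "tame f q (g q) \<or> (\<exists>i\<in>{1..N}. q = h i \<and> g (h i) \<le> f (h i) + F / m i)"
    if q: "q \<in> S" for q
  proof -
    obtain B B' where B: "(B, B') \<in> noncentered_pairs S d k q"
      "g q * sum w B' \<le> (\<Sum>y\<in>B. w y * f y)" "0 \<le> g q"
      using g q by blast
    show ?thesis
      using star_value_cases[OF B(1) k q _ B(3) B(2)] f by (auto simp: F_def)
  qed
  define R where "R = {i. i \<in> {1..N} \<and> h i \<in> S \<and> \<not> tame f (h i) (g (h i))}"
  have "(\<Sum>q\<in>S. w q * g q powr p) \<le> 8 * 2 powr p * J + (\<Sum>i\<in>R. m i * g (h i) powr p)"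
    unfolding J_def R_def using p f cases by (intro sum_le_tame_plus_heavy) blast+
  also have "(\<Sum>i\<in>R. m i * g (h i) powr p) \<le>
      (\<Sum>i\<in>R. 2 powr p * (m i * f (h i) powr p) + 2 powr p * F powr p * m i powr (1 - p))"
  proof (rule sum_mono)
    fix i assume i: "i \<in> R"
    then have i': "i \<in> {1..N}" "0 < m i" using m_pos by (auto simp: R_def)
    have gi: "g (h i) \<le> f (h i) + F / m i" "0 \<le> g (h i)" "0 \<le> f (h i)"
      using i cases[of "h i"] f g by (auto simp: R_def)
    have "g (h i) powr p \<le> (f (h i) + F / m i) powr p" using gi p by (intro powr_mono2) auto
    also have "\<dots> \<le> 2 powr p * (f (h i) powr p + (F / m i) powr p)"
      using gi F i' p by (intro add_powr_le) auto
    finally have "m i * g (h i) powr p \<le> m i * (2 powr p * (f (h i) powr p + (F / m i) powr p))"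
      using i' by (intro mult_left_mono) auto
    also have "\<dots> = 2 powr p * (m i * f (h i) powr p) + 2 powr p * F powr p * m i powr (1 - p)"
      using i' F by (simp add: powr_divide powr_diff algebra_simps)
    finally show "m i * g (h i) powr p \<le> \<dots>" .
  qed
  also have "\<dots> = 2 powr p * (\<Sum>i\<in>R. m i * f (h i) powr p) +
      2 powr p * F powr p * (\<Sum>i\<in>R. m i powr (1 - p))"
    by (simp add: sum.distrib sum_distrib_left)
  also have "\<dots> \<le> 2 powr p * J + 2 powr p * (4 powr p * J) * (\<Sum>i=1..N. m i powr (1 - p))"
  proof (intro add_mono mult_left_mono mult_mono)
    show "(\<Sum>i\<in>R. m i * f (h i) powr p) \<le> J"
      unfolding J_def by (rule heavy_sum_le) (auto simp: R_def)
    show "F powr p \<le> 4 powr p * J"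
      unfolding J_def F_def using p f by (intro off_heavy_powr_le) auto
    then show "0 \<le> 2 powr p * (4 powr p * J)"
      by (smt (verit) mult_nonneg_nonneg powr_ge_zero)
    show "(\<Sum>i\<in>R. m i powr (1 - p)) \<le> (\<Sum>i=1..N. m i powr (1 - p))"
      by (rule sum_mono2) (auto simp: R_def)
  qed (auto intro: sum_nonneg)
  moreover have eight: "2 powr p * (4 powr p * x) = 8 powr p * x" for x :: real
    by (simp flip: powr_mult mult.assoc)
  ultimately show "(\<Sum>q\<in>S. w q * g q powr p) \<le> (8 * 2 powr p + (2 powr p +
      8 powr p * (\<Sum>i=1..N. m i powr (1 - p)))) * (\<Sum>q\<in>S. w q * f q powr p)"
    by (simp add: J_def algebra_simps)
qed

text \<open>If f (h i) + F / m i \<ge> t, then either f (h i) \<ge> t / 2, which is handled by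
  Chebyshev, or m i \<le> 2 F / t. The masses of the second kind are what the hypothesis counts,
  with T = 2 F / t.\<close>

lemma star_weak_const:
  assumes p: "1 \<le> p" and k: "1 \<le> k" and W0: "0 \<le> W"
    and W: "\<And>T. 0 < T \<Longrightarrow> (\<Sum>i | i \<in> {1..N} \<and> m i \<le> T. m i) \<le> W * T powr p"
  shows "weak_const S w (noncentered_pairs S d k) p (8 * 2 powr p + (2 powr p + 8 powr p * W))"
  unfolding weak_const_def
proof (intro allI impI)
  fix f :: "nat + nat \<Rightarrow> real" and t :: real and E
  assume f: "\<forall>x\<in>S. 0 \<le> f x" and t: "0 < t" and E: "E \<subseteq> S"
    and g: "\<forall>x\<in>E. \<exists>(B, B')\<in>noncentered_pairs S d k x. t * sum w B' < (\<Sum>y\<in>B. w y * f y)"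
  define J where "J = (\<Sum>q\<in>S. w q * f q powr p)"
  define F where "F = (\<Sum>y\<in>off_heavy. w y * f y)"
  have F: "0 \<le> F" using off_heavy(1) f w_nonneg by (auto simp: F_def intro!: sum_nonneg)
  have cases: "tame f q t \<or> (\<exists>i\<in>{1..N}. q = h i \<and> t \<le> f (h i) + F / m i)"
    if q: "q \<in> E" for q
  proof -
    obtain B B' where B: "(B, B') \<in> noncentered_pairs S d k q"
      "t * sum w B' < (\<Sum>y\<in>B. w y * f y)"
      using g q by blast
    show ?thesis
      using star_value_cases[OF B(1) k _ _ _ less_imp_le[OF B(2)]] f t q E by (auto simp: F_def)
  qed
  define R where "R = {i. i \<in> {1..N} \<and> h i \<in> E \<and> \<not> tame f (h i) t}"
  define R1 where "R1 = {i. i \<in> {1..N} \<and> t / 2 \<le> f (h i)}"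
  define R2 where "R2 = {i. i \<in> {1..N} \<and> m i \<le> 2 * F / t}"
  have fin: "finite R1" "finite R2" by (auto simp: R1_def R2_def)
  have "R \<subseteq> R1 \<union> R2"
  proof
    fix i assume i: "i \<in> R"
    then have "i \<in> {1..N}" "0 < m i" "t \<le> f (h i) + F / m i"
      using cases[of "h i"] m_pos by (auto simp: R_def)
    moreover from this have "m i \<le> 2 * F / t" if "\<not> t / 2 \<le> f (h i)"
    proof -
      have "t / 2 \<le> F / m i" using calculation that by linarith
      then show ?thesis using t calculation by (simp add: field_simps)
    qed
    ultimately show "i \<in> R1 \<union> R2" by (auto simp: R1_def R2_def)
  qed
  then have "(\<Sum>i\<in>R. m i) \<le> (\<Sum>i\<in>R1 \<union> R2. m i)"
    using fin m_pos by (intro sum_mono2) (auto simp: R1_def R2_def intro!: less_imp_le[of 0 "m _"])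
  also have "\<dots> \<le> (\<Sum>i\<in>R1. m i) + (\<Sum>i\<in>R2. m i)"
  proof -
    have "0 \<le> (\<Sum>i\<in>R1 \<inter> R2. m i)" by (intro sum_nonneg) (auto simp: R1_def intro!: less_imp_le[OF m_pos])
    then show ?thesis using sum.union_inter[OF fin, of m] by simp
  qed
  finally have R: "(\<Sum>i\<in>R. m i) \<le> (\<Sum>i\<in>R1. m i) + (\<Sum>i\<in>R2. m i)" .
  have R1: "t powr p * (\<Sum>i\<in>R1. m i) \<le> 2 powr p * J"
  proof -
    have "t powr p * (\<Sum>i\<in>R1. m i) = 2 powr p * (\<Sum>i\<in>R1. m i * (t / 2) powr p)"
      using t by (simp add: powr_divide mult.commute flip: sum_distrib_right sum_divide_distrib)
    also have "\<dots> \<le> 2 powr p * (\<Sum>i\<in>R1. m i * f (h i) powr p)"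
      using t p m_pos by (intro mult_left_mono sum_mono powr_mono2) (auto simp: R1_def intro!: less_imp_le[of 0 "m _"])
    also have "\<dots> \<le> 2 powr p * J"
      unfolding J_def by (intro mult_left_mono heavy_sum_le) (auto simp: R1_def)
    finally show ?thesis .
  qed
  have R2: "t powr p * (\<Sum>i\<in>R2. m i) \<le> 8 powr p * W * J"
  proof (cases "F = 0")
    case True
    \<comment> \<open>For F = 0 the threshold T is 0, which the hypothesis does not cover, but no
      mass lies below it.\<close>
    have "R2 = {}"
    proof -
      have False if "i \<in> R2" for i using that m_pos[of i] True by (auto simp: R2_def)
      then show ?thesis by blast
    qed
    moreover have "0 \<le> J" unfolding J_def by (rule energy_nonneg) simp
    ultimately show ?thesis using W0 by simp
  next
    case False
    then have "0 < 2 * F / t" using F t by simp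
    then have "t powr p * (\<Sum>i\<in>R2. m i) \<le> t powr p * (W * (2 * F / t) powr p)"
      unfolding R2_def by (intro mult_left_mono W) auto
    also have "\<dots> = 2 powr p * W * F powr p" using F t by (simp add: powr_divide powr_mult)
    also have "\<dots> \<le> 2 powr p * W * (4 powr p * J)"
      unfolding J_def F_def using p f W0 by (intro mult_left_mono off_heavy_powr_le) auto
    also have "\<dots> = (2 powr p * 4 powr p) * W * J" by simp
    also have "2 powr p * 4 powr p = (8 powr p :: real)" by (simp flip: powr_mult)
    finally show ?thesis .
  qed
  have "t powr p * sum w E = (\<Sum>q\<in>E. w q * t powr p)" by (simp add: sum_distrib_left mult.commute)
  also have "\<dots> \<le> 8 * 2 powr p * J + (\<Sum>i\<in>R. m i * t powr p)"
    unfolding J_def R_def using p f E cases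
    by (intro sum_le_tame_plus_heavy[where g = "\<lambda>_. t"]) blast+
  also have "(\<Sum>i\<in>R. m i * t powr p) = t powr p * (\<Sum>i\<in>R. m i)"
    by (simp add: mult.commute flip: sum_distrib_right)
  also have "\<dots> \<le> t powr p * ((\<Sum>i\<in>R1. m i) + (\<Sum>i\<in>R2. m i))"
    using R by (intro mult_left_mono) auto
  also have "\<dots> \<le> 2 powr p * J + 8 powr p * W * J" using R1 R2 by (simp add: algebra_simps)
  finally show "t powr p * sum w E \<le>
      (8 * 2 powr p + (2 powr p + 8 powr p * W)) * (\<Sum>q\<in>S. w q * f q powr p)"
    by (simp add: J_def algebra_simps)
qed

end

context hub
begin

lemma in_off_heavy: "a \<in> off_heavy" "i \<in> {1..N} \<Longrightarrow> l i \<in> off_heavy"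
  by (auto simp: off_heavy_def)

lemma finite_off_heavy: "finite off_heavy"
  by (simp add: off_heavy_def)

lemma single_heavy_mass_le:
  assumes B: "B \<subseteq> insert (h i) off_heavy" and i: "i \<in> {1..N}"
  shows "sum w B \<le> 4 * m i"
proof -
  have "0 \<le> w q" if "q \<in> insert (h i) off_heavy" for q
    using that off_heavy(1) i by (intro w_nonneg) auto
  then have "sum w B \<le> sum w (insert (h i) off_heavy)"
    using B finite_off_heavy by (intro sum_mono2) auto
  also have "\<dots> = m i + sum w off_heavy"
    using off_heavy(2) i finite_off_heavy by simp
  also have "\<dots> \<le> 4 * m i" using off_heavy(3) m_ge[of i] i by simp
  finally show ?thesis .
qed

end

context star
begin

text \<open>From the heavy point z_i the center is at distance 1/2 and the other heavy points are at
  distance 1. The radius 1 / k exceeds 1/2 because k < 2, and the enlarged open ball of radius 1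
  just misses the other heavy points.\<close>

lemma centered_star_pair:
  assumes b: b and k: "1 \<le> k" "k < 2" and i: "i \<in> {1..N}"
  shows "\<exists>(B, B')\<in>centered_pairs S d k (h i). a \<in> B \<and> B \<subseteq> S \<and> sum w B' \<le> 4 * m i"
proof -
  have si: "s i = 1" using s_1 i by simp
  have a: "a \<in> fball S d (h i) (1 / k)"
    using b k i si s_0 by (simp add: fball_def hub_heavy_def)
  have "fball S d (h i) (k * (1 / k)) \<subseteq> insert (h i) off_heavy"
  proof
    fix q assume q: "q \<in> fball S d (h i) (k * (1 / k))"
    then have "q \<in> S" "d (h i) q < 1" using k by (auto simp: fball_def)
    then show "q \<in> insert (h i) off_heavy"
    proof (cases rule: S_cases)
      case (heavy j)
      then have "j = i" using b s_1 i \<open>d (h i) q < 1\<close> by (auto simp: hub_heavy_def split: if_splits)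
      then show ?thesis using heavy by simp
    qed (auto simp: in_off_heavy)
  qed
  then have "sum w (fball S d (h i) (k * (1 / k))) \<le> 4 * m i" using i by (rule single_heavy_mass_le)
  moreover have "(fball S d (h i) (1 / k), fball S d (h i) (k * (1 / k))) \<in> centered_pairs S d k (h i)"
    unfolding centered_pairs_def using k by force
  ultimately show ?thesis using a fball_subset[of S d] by blast
qed

text \<open>The light midpoint z_i has both the center and x_i at distance 1/2, and every other
  heavy point at distance 3/2. The radius is chosen so that its enlargement is exactly 3/2; it
  exceeds 1/2 because k < 3.\<close>

lemma noncentered_star_pair:
  assumes b: "\<not> b" and k: "1 \<le> k" "k < 3" and i: "i \<in> {1..N}"
  shows "\<exists>(B, B')\<in>noncentered_pairs S d k (h i). a \<in> B \<and> B \<subseteq> S \<and> sum w B' \<le> 4 * m i"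
proof -
  define r where "r = 3 / (2 * k)"
  have r: "1 / 2 < r" "k * r = 3 / 2" using k by (auto simp: r_def field_simps)
  have si: "s i = 1" using s_1 i by simp
  have a: "a \<in> fball S d (l i) r" "h i \<in> fball S d (l i) r"
    using b i si s_0 r by (auto simp: fball_def hub_light_def hub_heavy_def hub_points_def)
  have "fball S d (l i) (k * r) \<subseteq> insert (h i) off_heavy"
  proof
    fix q assume q: "q \<in> fball S d (l i) (k * r)"
    then have "q \<in> S" "d (l i) q < 3 / 2" using r by (auto simp: fball_def)
    then show "q \<in> insert (h i) off_heavy"
    proof (cases rule: S_cases)
      case (heavy j)
      then have "j = i" using b s_1 i \<open>d (l i) q < 3 / 2\<close>
        by (auto simp: hub_heavy_def hub_light_def split: if_splits)
      then show ?thesis using heavy by simp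
    qed (auto simp: in_off_heavy)
  qed
  then have "sum w (fball S d (l i) (k * r)) \<le> 4 * m i" using i by (rule single_heavy_mass_le)
  moreover have "(fball S d (l i) r, fball S d (l i) (k * r)) \<in> noncentered_pairs S d k (h i)"
    unfolding noncentered_pairs_def using r a i by force
  ultimately show ?thesis using a fball_subset[of S d] by blast
qed

text \<open>The points x_i use the maximum metric, so they are as far from each other as from the
  center. A ball around x_i that reaches the center thus contains all heavy points, and every value
  is tame, whatever the masses are.\<close>

lemma centered_star_strong_const:
  assumes b: "\<not> b" and p: "1 \<le> p" and k: "1 \<le> k"
  shows "strong_const S w (centered_pairs S d k) p (8 * 2 powr p)"
  unfolding strong_const_def
proof (intro allI impI)
  fix f g :: "nat + nat \<Rightarrow> real"
  assume f: "\<forall>x\<in>S. 0 \<le> f x"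
    and g: "\<forall>x\<in>S. 0 \<le> g x \<and>
      (\<exists>(B, B')\<in>centered_pairs S d k x. g x * sum w B' \<le> (\<Sum>y\<in>B. w y * f y))"
  have tame: "tame f q (g q)" if q: "q \<in> S" for q
  proof -
    obtain r where r: "0 < r" "0 \<le> g q"
      "g q * sum w (fball S d q (k * r)) \<le> (\<Sum>y\<in>fball S d q r. w y * f y)"
      using g q by (auto simp: centered_pairs_def)
    let ?B = "fball S d q r" and ?B' = "fball S d q (k * r)"
    have qB: "q \<in> ?B" using q r metric by (simp add: fball_def Metric_space.mdist_zero)
    have nc: "(?B, ?B') \<in> noncentered_pairs S d k q"
      unfolding noncentered_pairs_def using q r qB by blast
    note le = noncentered_sum_le[OF nc k]
    have "(\<exists>i\<in>{1..N}. ?B \<subseteq> {h i, l i}) \<or> a \<in> ?B \<and> q \<notin> h ` {1..N} \<or> sum w S \<le> 4 * sum w ?B'"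
    proof (rule ccontr)
      assume *: "\<not> ?thesis"
      then have aB: "a \<in> ?B" using ball_cases[OF q r(1)] by auto
      with * obtain i where i: "i \<in> {1..N}" "q = h i" by auto
      have "1 < r" using aB i b s_1 s_0 by (auto simp: fball_def hub_heavy_def)
      then have "h ` {1..N} \<subseteq> ?B"
        using i b s_1 s_0 by (auto simp: fball_def hub_heavy_def hub_points_def)
      then have "sum w S \<le> 4 * sum w ?B" using aB le(2) by (intro all_heavy_mass)
      then have "sum w S \<le> 4 * sum w ?B'" using le(1) by simp
      with * show False by blast
    qed
    then show ?thesis using nc k r(2,3) by (intro noncentered_tameI)
  qed
  have "(\<Sum>q\<in>S. w q * g q powr p) \<le> 8 * 2 powr p * (\<Sum>q\<in>S. w q * f q powr p) +
      (\<Sum>i | i \<in> {1..N} \<and> h i \<in> S \<and> \<not> tame f (h i) (g (h i)). m i * g (h i) powr p)"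
    using p f tame by (intro sum_le_tame_plus_heavy) auto
  also have "{i. i \<in> {1..N} \<and> h i \<in> S \<and> \<not> tame f (h i) (g (h i))} = {}" using tame by auto
  finally show "(\<Sum>q\<in>S. w q * g q powr p) \<le> 8 * 2 powr p * (\<Sum>q\<in>S. w q * f q powr p)" by simp
qed

end

section \<open>Chains\<close>

lemma sum_tails_swap:
  fixes u c :: "nat \<Rightarrow> real"
  shows "(\<Sum>i=1..N. u i * (\<Sum>M=i..N. c M)) = (\<Sum>M=1..N. (\<Sum>i=1..M. u i) * c M)"
proof (induction N)
  case (Suc N)
  have "(\<Sum>i=1..N. u i * (\<Sum>M=i..Suc N. c M)) = (\<Sum>i=1..N. u i * (\<Sum>M=i..N. c M) + u i * c (Suc N))"
    by (intro sum.cong) (auto simp: algebra_simps)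
  also have "\<dots> = (\<Sum>i=1..N. u i * (\<Sum>M=i..N. c M)) + (\<Sum>i=1..N. u i) * c (Suc N)"
    by (simp only: sum.distrib sum_distrib_right)
  finally show ?case using Suc by (simp add: algebra_simps)
qed simp

lemma sum_geometric_le:
  fixes r :: real
  assumes "0 \<le> r" "r < 1"
  shows "(\<Sum>j<n. r ^ j) \<le> 1 / (1 - r)"
  using assms by (simp add: sum_gp_strict divide_right_mono)

text \<open>The ratio of consecutive masses is 4 * 16^j. Its geometric growth is used twice: for p >
  1 it turns the contributions of the lighter points into a geometric series, and it makes a ball
  that also catches the next heavy point harmless even at p = 1.\<close>

locale chain = hub +
  assumes m_eq: "\<And>i. m i = 4 ^ (i * i)"
begin

definition below :: "nat \<Rightarrow> (nat + nat) set" where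
  "below M = off_heavy \<union> h ` {1..<M}"

definition below_sum :: "(nat + nat \<Rightarrow> real) \<Rightarrow> nat \<Rightarrow> real" where
  "below_sum f M = (\<Sum>y\<in>below M. w y * f y)"

lemma m_0: "m 0 = 1" and m_Suc: "m (Suc j) = 16 ^ j * (4 * m j)"
proof -
  show "m 0 = 1" by (simp add: m_eq)
  have "(4::real) ^ (j + j) = 16 ^ j" by (simp add: power_add flip: power_mult_distrib)
  then show "m (Suc j) = 16 ^ j * (4 * m j)" by (simp add: m_eq power_add)
qed

lemma m_gt_0: "0 < m j"
  by (simp add: m_eq)

lemma m_mono: "i \<le> j \<Longrightarrow> m i \<le> m j"
  by (simp add: m_eq mult_le_mono)

lemma sum_m_le: "(\<Sum>i=1..n. m i) \<le> 2 * m n"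
proof (induction n)
  case (Suc n)
  have "1 * (4 * m n) \<le> 16 ^ n * (4 * m n)" using m_gt_0[of n] by (intro mult_right_mono) auto
  then have "4 * m n \<le> m (Suc n)" by (simp add: m_Suc)
  then show ?case using Suc m_gt_0[of n] by simp
qed (simp add: m_0)

lemma below_subset: "M \<le> Suc N \<Longrightarrow> below M \<subseteq> S"
  using off_heavy(1) by (auto simp: below_def)

lemma sum_below: "sum w (below (Suc j)) \<le> 4 * m j" if "j \<le> N"
proof -
  have "h i \<notin> off_heavy" if "i \<in> {1..<Suc j}" for i using off_heavy(2)[of i] that by simp
  then have "off_heavy \<inter> h ` {1..<Suc j} = {}" by blast
  then have "sum w (below (Suc j)) = sum w off_heavy + sum w (h ` {1..<Suc j})"
    unfolding below_def using finite_off_heavy by (intro sum.union_disjoint) simp_all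
  also have "sum w (h ` {1..<Suc j}) = (\<Sum>i=1..<Suc j. m i)"
    by (subst sum.reindex) (auto intro: inj_on_subset[OF inj_h])
  also have "\<dots> = (\<Sum>i=1..j. m i)" by (simp add: atLeastLessThanSuc_atLeastAtMost)
  finally have eq: "sum w (below (Suc j)) = sum w off_heavy + (\<Sum>i=1..j. m i)" .
  show ?thesis
  proof (cases "j = 0")
    case False
    then have "1 \<le> m j" using m_ge[of j] by simp
    then show ?thesis using eq off_heavy(3) sum_m_le[of j] by simp
  qed (use eq off_heavy(3) m_0 in simp)
qed

lemma below_sum_nonneg: "(\<And>x. x \<in> S \<Longrightarrow> 0 \<le> f x) \<Longrightarrow> M \<le> Suc N \<Longrightarrow> 0 \<le> below_sum f M"
  unfolding below_sum_def using below_subset[of M] w_nonneg by (intro sum_nonneg) auto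

text \<open>The points below index j + 1 have mass at most V = 4 m_j, while m_(j+1) = 16^j V.
  Dividing by the larger mass instead of V gains the factor (16^j)^(1-p) over the plain average
  bound.\<close>

lemma below_sum_powr_le:
  assumes p: "1 \<le> p" and f: "\<And>x. x \<in> S \<Longrightarrow> 0 \<le> f x" and j: "j \<le> N"
  shows "m (Suc j) * (below_sum f (Suc j) / m (Suc j)) powr p \<le>
    2 powr p * (\<Sum>q\<in>S. w q * f q powr p) * (16 powr (1 - p)) ^ j"
proof -
  define V where "V = 4 * m j"
  define x :: real where "x = 16 ^ j"
  have V: "0 < V" using m_gt_0[of j] by (simp add: V_def)
  have x: "0 < x" by (simp add: x_def)
  have F: "0 \<le> below_sum f (Suc j)" using below_sum_nonneg f j by simp
  have *: "V * (below_sum f (Suc j) / V) powr p \<le> 2 powr p * (\<Sum>q\<in>S. w q * f q powr p)"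
    unfolding below_sum_def
    using p f j V sum_below below_subset[of "Suc j"] by (intro mass_average_powr_le) (auto simp: V_def)
  have "m (Suc j) * (below_sum f (Suc j) / m (Suc j)) powr p =
      x powr (1 - p) * (V * (below_sum f (Suc j) / V) powr p)"
    using F V x by (simp add: m_Suc V_def[symmetric] x_def[symmetric] powr_divide powr_mult powr_diff)
  also have "\<dots> \<le> x powr (1 - p) * (2 powr p * (\<Sum>q\<in>S. w q * f q powr p))"
    using * by (intro mult_left_mono) auto
  also have "x powr (1 - p) = (16 powr (1 - p)) ^ j"
    by (simp add: x_def powr_realpow[symmetric] powr_powr mult.commute)
  finally show ?thesis by (simp add: mult_ac)
qed

text \<open>The value at \<open>i\<close> is charged to some later index \<open>M\<close>, and the
  unknown choice of \<open>M\<close> is replaced by the sum over all of them. After interchanging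
  the sums, the masses up to \<open>M\<close> add up to at most 2 m_M.\<close>

lemma heavy_tail_le:
  assumes R: "R \<subseteq> {1..N}" and c: "\<And>M. M \<in> {1..N} \<Longrightarrow> 0 \<le> c M"
    and G: "\<And>i. i \<in> R \<Longrightarrow> \<exists>M\<in>{i..N}. G i \<le> c M"
  shows "(\<Sum>i\<in>R. m i * G i) \<le> 2 * (\<Sum>M=1..N. m M * c M)"
proof -
  have "(\<Sum>i\<in>R. m i * G i) \<le> (\<Sum>i\<in>R. m i * (\<Sum>M=i..N. c M))"
  proof (intro sum_mono mult_left_mono)
    fix i assume i: "i \<in> R"
    then obtain M where M: "M \<in> {i..N}" "G i \<le> c M" using G by blast
    have "c M \<le> (\<Sum>M=i..N. c M)" using M i R c by (intro member_le_sum) auto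
    with M show "G i \<le> (\<Sum>M=i..N. c M)" by simp
  qed (use m_gt_0 in \<open>auto intro: less_imp_le\<close>)
  also have "\<dots> \<le> (\<Sum>i=1..N. m i * (\<Sum>M=i..N. c M))"
    using R c m_gt_0 by (intro sum_mono2 mult_nonneg_nonneg sum_nonneg) (auto intro: less_imp_le)
  also have "\<dots> = (\<Sum>M=1..N. (\<Sum>i=1..M. m i) * c M)" by (rule sum_tails_swap)
  also have "\<dots> \<le> (\<Sum>M=1..N. 2 * m M * c M)"
    using c sum_m_le by (intro sum_mono mult_right_mono) auto
  finally show ?thesis by (simp add: sum_distrib_left mult_ac)
qed

text \<open>Masses increase with the index, so \<open>h M\<close> is the heaviest point of the ball
  and everything else in it lies below \<open>M\<close>.\<close>

lemma max_heavy:
  assumes "B \<subseteq> S" "h i \<in> B" "i \<in> {1..N}"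
  obtains M where "M \<in> {i..N}" "h M \<in> B" "B \<subseteq> insert (h M) (below M)" "B \<subseteq> below (Suc M)"
proof -
  define M where "M = Max {j \<in> {1..N}. h j \<in> B}"
  have M: "M \<in> {j \<in> {1..N}. h j \<in> B}" unfolding M_def using assms by (intro Max_in) auto
  have le: "j \<le> M" if "j \<in> {1..N}" "h j \<in> B" for j unfolding M_def using that by (intro Max_ge) auto
  have "q \<in> insert (h M) (below M) \<and> q \<in> below (Suc M)" if "q \<in> B" for q
  proof -
    from that assms(1) have "q \<in> S" by auto
    then show ?thesis
    proof (cases rule: S_cases)
      case (heavy j)
      then have "j \<le> M" using le that by auto
      then show ?thesis using heavy by (cases "j = M") (auto simp: below_def)
    qed (auto simp: below_def off_heavy_def)
  qed
  then show thesis using that[of M] M le[of i] assms by auto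
qed

text \<open>As for stars, but a ball may now contain several heavy points without containing all;
  its heaviest point takes over the role of the point of evaluation.\<close>

lemma chain_value_cases:
  assumes B: "(B, B') \<in> noncentered_pairs S d k q" "1 \<le> k" and q: "q \<in> S"
    and f: "\<And>x. x \<in> S \<Longrightarrow> 0 \<le> f x" and g: "0 \<le> g" "g * sum w B' \<le> (\<Sum>y\<in>B. w y * f y)"
  shows "tame f q g \<or>
    (\<exists>i\<in>{1..N}. q = h i \<and> (\<exists>M\<in>{i..N}. g \<le> f (h M) + below_sum f M / m M))"
proof -
  obtain y r where y: "y \<in> S" "0 < r" "q \<in> fball S d y r" "B = fball S d y r"
    using B(1) by (auto simp: noncentered_pairs_def)
  note le = noncentered_sum_le[OF B]
  show ?thesis
  proof (cases "(\<exists>i\<in>{1..N}. B \<subseteq> {h i, l i}) \<or> a \<in> B \<and> q \<notin> h ` {1..N}")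
    case False
    then have aB: "a \<in> B" using ball_cases[OF y(1,2)] y(4) by auto
    with False obtain i where i: "i \<in> {1..N}" "q = h i" by auto
    obtain M where M: "M \<in> {i..N}" "h M \<in> B" "B \<subseteq> insert (h M) (below M)"
      using max_heavy[OF le(2)] i y by metis
    have "h M \<notin> below M" using M(1) i by (auto simp: below_def off_heavy)
    then have "g \<le> f (h M) + below_sum f M / m M"
      unfolding below_sum_def using i M le g f below_subset[of M]
      by (intro heavy_value_le[of f M "below M" B "sum w B'"]) auto
    with i M show ?thesis by blast
  next
    case True
    then have "tame f q g" using B g by (intro noncentered_tameI) auto
    then show ?thesis ..
  qed
qed

text \<open>Each term of the bound f (h M) + below_sum f M / m M is summed over \<open>M\<close> by
  \<open>heavy_tail_le\<close>. The second needs the geometric series with ratio 16^(1-p), which is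
  where p > 1 enters.\<close>

lemma chain_strong_const:
  assumes p: "1 < p" and k: "1 \<le> k"
  shows "strong_const S w (noncentered_pairs S d k) p
    (8 * 2 powr p + 2 * (2 powr p * (1 + 2 powr p * (1 / (1 - 16 powr (1 - p))))))"
  unfolding strong_const_def
proof (intro allI impI)
  fix f g :: "nat + nat \<Rightarrow> real"
  assume f: "\<forall>x\<in>S. 0 \<le> f x"
    and g: "\<forall>x\<in>S. 0 \<le> g x \<and>
      (\<exists>(B, B')\<in>noncentered_pairs S d k x. g x * sum w B' \<le> (\<Sum>y\<in>B. w y * f y))"
  define J where "J = (\<Sum>q\<in>S. w q * f q powr p)"
  define r where "r = 16 powr (1 - p)"
  have r: "0 \<le> r" "r < 1" using p by (auto simp: r_def powr_less_one)
  have J: "0 \<le> J" unfolding J_def by (rule energy_nonneg) simp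
  have cases: "tame f q (g q) \<or> (\<exists>i\<in>{1..N}. q = h i \<and> (\<exists>M\<in>{i..N}. g (h i) \<le> f (h M) + below_sum f M / m M))"
    if q: "q \<in> S" for q
  proof -
    obtain B B' where B: "(B, B') \<in> noncentered_pairs S d k q"
      "g q * sum w B' \<le> (\<Sum>y\<in>B. w y * f y)" "0 \<le> g q"
      using g q by blast
    show ?thesis
      using chain_value_cases[OF B(1) k q _ B(3) B(2)] f by auto
  qed
  define R where "R = {i. i \<in> {1..N} \<and> h i \<in> S \<and> \<not> tame f (h i) (g (h i))}"
  define c where "c M = 2 powr p * (f (h M) powr p + (below_sum f M / m M) powr p)" for M
  have "(\<Sum>q\<in>S. w q * g q powr p) \<le> 8 * 2 powr p * J + (\<Sum>i\<in>R. m i * g (h i) powr p)"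
    unfolding J_def R_def using p f cases by (intro sum_le_tame_plus_heavy) (force|blast)+
  also have "(\<Sum>i\<in>R. m i * g (h i) powr p) \<le> 2 * (\<Sum>M=1..N. m M * c M)"
  proof (rule heavy_tail_le)
    fix i assume i: "i \<in> R"
    then obtain M where M: "M \<in> {i..N}" "g (h i) \<le> f (h M) + below_sum f M / m M"
      using cases[of "h i"] by (auto simp: R_def)
    have nn: "0 \<le> f (h M)" "0 \<le> below_sum f M / m M" "0 \<le> g (h i)"
      using M i f g below_sum_nonneg[of f M] m_gt_0[of M] by (auto simp: R_def)
    have "g (h i) powr p \<le> (f (h M) + below_sum f M / m M) powr p"
      using M nn p by (intro powr_mono2) auto
    also have "\<dots> \<le> c M" unfolding c_def using nn p by (intro add_powr_le) auto
    finally show "\<exists>M\<in>{i..N}. g (h i) powr p \<le> c M" using M by blast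
  qed (auto simp: R_def c_def)
  also have "(\<Sum>M=1..N. m M * c M) =
      2 powr p * ((\<Sum>M=1..N. m M * f (h M) powr p) + (\<Sum>M=1..N. m M * (below_sum f M / m M) powr p))"
    by (simp add: c_def sum_distrib_left algebra_simps sum.distrib)
  also have "\<dots> \<le> 2 powr p * (J + 2 powr p * J * (1 / (1 - r)))"
  proof (intro mult_left_mono add_mono)
    show "(\<Sum>M=1..N. m M * f (h M) powr p) \<le> J" unfolding J_def by (rule heavy_sum_le) simp
    have "(\<Sum>M=1..N. m M * (below_sum f M / m M) powr p) =
        (\<Sum>j<N. m (Suc j) * (below_sum f (Suc j) / m (Suc j)) powr p)"
      by (rule sum.reindex_bij_witness[of _ Suc "\<lambda>M. M - 1"]) auto
    also have "\<dots> \<le> (\<Sum>j<N. 2 powr p * J * r ^ j)"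
      unfolding J_def r_def using p f by (intro sum_mono below_sum_powr_le) auto
    also have "\<dots> = 2 powr p * J * (\<Sum>j<N. r ^ j)" by (simp add: sum_distrib_left)
    also have "\<dots> \<le> 2 powr p * J * (1 / (1 - r))"
      using r J by (intro mult_left_mono sum_geometric_le) auto
    finally show "(\<Sum>M=1..N. m M * (below_sum f M / m M) powr p) \<le> \<dots>" .
  qed auto
  finally show "(\<Sum>q\<in>S. w q * g q powr p) \<le> (8 * 2 powr p + 2 * (2 powr p * (1 + 2 powr p *
      (1 / (1 - 16 powr (1 - p)))))) * (\<Sum>q\<in>S. w q * f q powr p)"
    by (simp add: J_def r_def algebra_simps)
qed

text \<open>On the exceptional set either some later heavy point has f \<ge> t / 2, and
  \<open>heavy_tail_le\<close> gives 4 J, or m_i t \<le> 2 J. The masses of the second kind are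
  dominated by twice the largest of them, again 4 J. With the 16 J of the tame points this makes
  24.\<close>

lemma chain_weak_const:
  assumes k: "1 \<le> k"
  shows "weak_const S w (noncentered_pairs S d k) 1 24"
  unfolding weak_const_def
proof (intro allI impI)
  fix f :: "nat + nat \<Rightarrow> real" and t :: real and E
  assume f: "\<forall>x\<in>S. 0 \<le> f x" and t: "0 < t" and E: "E \<subseteq> S"
    and g: "\<forall>x\<in>E. \<exists>(B, B')\<in>noncentered_pairs S d k x. t * sum w B' < (\<Sum>y\<in>B. w y * f y)"
  define J where "J = (\<Sum>q\<in>S. w q * f q)"
  have J_powr: "(\<Sum>q\<in>S. w q * f q powr 1) = J" unfolding J_def using f by (intro sum.cong) auto
  have J: "0 \<le> J" unfolding J_def using f w_nonneg by (intro sum_nonneg) auto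
  have cases: "tame f q t \<or> (\<exists>i\<in>{1..N}. q = h i \<and> (\<exists>M\<in>{i..N}. t \<le> f (h M) + below_sum f M / m M))"
    if q: "q \<in> E" for q
  proof -
    obtain B B' where B: "(B, B') \<in> noncentered_pairs S d k q"
      "t * sum w B' < (\<Sum>y\<in>B. w y * f y)"
      using g q by blast
    show ?thesis
      using chain_value_cases[OF B(1) k _ _ _ less_imp_le[OF B(2)]] f t q E by auto
  qed
  define R where "R = {i. i \<in> {1..N} \<and> h i \<in> E \<and> \<not> tame f (h i) t}"
  define R1 where "R1 = {i. i \<in> {1..N} \<and> (\<exists>M\<in>{i..N}. t \<le> 2 * f (h M))}"
  define R2 where "R2 = {i. i \<in> {1..N} \<and> m i * t \<le> 2 * J}"
  have fin: "finite R1" "finite R2" by (auto simp: R1_def R2_def)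
  have "R \<subseteq> R1 \<union> R2"
  proof
    fix i assume i: "i \<in> R"
    then obtain M where M: "M \<in> {i..N}" "t \<le> f (h M) + below_sum f M / m M"
      using cases[of "h i"] by (auto simp: R_def)
    have "m i * t \<le> 2 * J" if "\<not> t \<le> 2 * f (h M)"
    proof -
      have "t \<le> 2 * (below_sum f M / m M)" using M(2) that by linarith
      also have "below_sum f M \<le> J"
        unfolding J_def below_sum_def using M f w_nonneg below_subset[of M] by (intro sum_mono2) auto
      then have "2 * (below_sum f M / m M) \<le> 2 * (J / m M)"
        using m_gt_0[of M] by (simp add: divide_right_mono)
      finally have "m M * t \<le> 2 * J" using m_gt_0[of M] by (simp add: field_simps)
      moreover have "m i * t \<le> m M * t" using M t m_mono[of i M] by (intro mult_right_mono) auto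
      ultimately show ?thesis by simp
    qed
    then have "(\<exists>M\<in>{i..N}. t \<le> 2 * f (h M)) \<or> m i * t \<le> 2 * J" using M(1) by blast
    moreover have "i \<in> {1..N}" using i by (simp add: R_def)
    ultimately show "i \<in> R1 \<union> R2" by (auto simp: R1_def R2_def)
  qed
  then have "(\<Sum>i\<in>R. m i * t) \<le> (\<Sum>i\<in>R1 \<union> R2. m i * t)"
    using fin m_gt_0 t by (intro sum_mono2) (auto intro: less_imp_le)
  also have "\<dots> \<le> (\<Sum>i\<in>R1. m i * t) + (\<Sum>i\<in>R2. m i * t)"
  proof -
    have "0 \<le> (\<Sum>i\<in>R1 \<inter> R2. m i * t)" using m_gt_0 t by (intro sum_nonneg) (auto intro: less_imp_le)
    then show ?thesis using sum.union_inter[OF fin, of "\<lambda>i. m i * t"] by simp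
  qed
  also have "(\<Sum>i\<in>R1. m i * t) \<le> 2 * (\<Sum>M=1..N. m M * (2 * f (h M)))"
    using f by (intro heavy_tail_le) (auto simp: R1_def)
  also have "\<dots> = 4 * (\<Sum>M=1..N. m M * f (h M))"
    by (simp add: sum_distrib_left mult_ac)
  also have "(\<Sum>M=1..N. m M * f (h M)) = (\<Sum>M=1..N. m M * f (h M) powr 1)"
    using f by (intro sum.cong) auto
  also have "\<dots> \<le> J" using heavy_sum_le[of "{1..N}" f 1] J_powr by simp
  also have "(\<Sum>i\<in>R2. m i * t) \<le> 4 * J"
  proof (cases "R2 = {}")
    case False
    define M where "M = Max R2"
    have M: "M \<in> R2" unfolding M_def using fin False by (intro Max_in) auto
    have "R2 \<subseteq> {1..M}" unfolding M_def using fin by (auto simp: R2_def)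
    then have "(\<Sum>i\<in>R2. m i * t) \<le> (\<Sum>i=1..M. m i * t)"
      using m_gt_0 t by (intro sum_mono2) (auto intro: less_imp_le)
    also have "\<dots> = (\<Sum>i=1..M. m i) * t" by (simp add: sum_distrib_right)
    also have "\<dots> \<le> 2 * m M * t" using sum_m_le[of M] t by (intro mult_right_mono) auto
    finally show ?thesis using M by (simp add: R2_def)
  qed (use J in simp)
  finally have heavy: "(\<Sum>i\<in>R. m i * t) \<le> 8 * J" by simp
  have "t * sum w E = (\<Sum>q\<in>E. w q * t powr 1)" using t by (simp add: sum_distrib_left mult.commute)
  also have "\<dots> \<le> 8 * 2 powr 1 * (\<Sum>q\<in>S. w q * f q powr 1) + (\<Sum>i\<in>R. m i * t powr 1)"
    unfolding R_def using f E cases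
    by (intro sum_le_tame_plus_heavy[where g = "\<lambda>_. t"]) (force|blast)+
  also have "\<dots> \<le> 24 * J" using heavy t unfolding J_powr by simp
  finally show "t powr 1 * sum w E \<le> 24 * (\<Sum>q\<in>S. w q * f q powr 1)"
    using t unfolding J_powr by simp
qed

text \<open>The enlarged ball reaches the next heavy point whenever the original one contains
  both the center and a heavy point.\<close>

lemma centered_chain_strong_const:
  assumes b: "\<not> b" and p: "1 \<le> p" and k: "1 \<le> k"
    and s_Suc: "\<And>i. 1 \<le> i \<Longrightarrow> i < N \<Longrightarrow> s (Suc i) \<le> k * s i"
  shows "strong_const S w (centered_pairs S d k) p (10 * 2 powr p)"
  unfolding strong_const_def
proof (intro allI impI)
  fix f g :: "nat + nat \<Rightarrow> real"
  assume f: "\<forall>x\<in>S. 0 \<le> f x"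
    and g: "\<forall>x\<in>S. 0 \<le> g x \<and>
      (\<exists>(B, B')\<in>centered_pairs S d k x. g x * sum w B' \<le> (\<Sum>y\<in>B. w y * f y))"
  define J where "J = (\<Sum>q\<in>S. w q * f q powr p)"
  have J: "0 \<le> J" unfolding J_def by (rule energy_nonneg) simp
  have cases: "tame f q (g q) \<or>
      (\<exists>i\<in>{1..N}. q = h i \<and> (\<exists>M\<in>{i..<N}. g (h i) \<le> below_sum f (Suc M) / m (Suc M)))"
    if q: "q \<in> S" for q
  proof -
    obtain r where r: "0 < r" "0 \<le> g q"
      "g q * sum w (fball S d q (k * r)) \<le> (\<Sum>y\<in>fball S d q r. w y * f y)"
      using g q by (auto simp: centered_pairs_def)
    let ?B = "fball S d q r" and ?B' = "fball S d q (k * r)"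
    have qB: "q \<in> ?B" using q r metric by (simp add: fball_def Metric_space.mdist_zero)
    have nc: "(?B, ?B') \<in> noncentered_pairs S d k q"
      unfolding noncentered_pairs_def using q r qB by blast
    note le = noncentered_sum_le[OF nc k]
    note tameI = noncentered_tameI[OF nc k r(2,3)]
    show ?thesis
    proof (cases "(\<exists>i\<in>{1..N}. ?B \<subseteq> {h i, l i}) \<or> a \<in> ?B \<and> q \<notin> h ` {1..N}")
      case False
      then have aB: "a \<in> ?B" using ball_cases[OF q r(1)] by auto
      with False obtain i where i: "i \<in> {1..N}" "q = h i" by auto
      obtain M where M: "M \<in> {i..N}" "h M \<in> ?B" "?B \<subseteq> below (Suc M)"
        using max_heavy[OF le(2)] i qB by metis
      have si: "s i < r" using aB i b s_0 s_nonneg[of i] by (auto simp: fball_def hub_heavy_def)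
      have sM: "s M < r" using M(2) i b si by (auto simp: fball_def hub_heavy_def split: if_splits)
      have mass: "m j \<le> sum w ?B'" if "h j \<in> ?B'" "1 \<le> j" for j
      proof -
        have "0 \<le> w x" if "x \<in> ?B'" for x using that fball_subset[of S d] by (intro w_nonneg) blast
        then show ?thesis using member_le_sum[of "h j" ?B' w] that le(4) by simp
      qed
      show ?thesis
      proof (cases "M = N")
        case True
        \<comment> \<open>There is no next heavy point, but \<open>h N\<close> alone carries at
          least a quarter of the total mass, so the value is tame.\<close>
        have "h N \<in> ?B'" using True M(2) fball_enlarge[OF k r(1), of S d q] by auto
        then have "m N \<le> sum w ?B'" using i by (intro mass) auto
        moreover have "sum w S \<le> 4 * m N"
          using off_heavy(3,4) sum_m_le[of N] m_ge[of N] i by simp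
        ultimately show ?thesis using tameI by auto
      next
        case False
        then have MN: "M < N" using M(1) by simp
        have "s (Suc M) \<le> k * s M" using s_Suc[of M] M(1) i MN by auto
        also have "\<dots> < k * r" using sM k by simp
        finally have "s (Suc M) < k * r" .
        moreover have "1 * r \<le> k * r" using k r(1) by (intro mult_right_mono) auto
        then have "s i < k * r" using si by simp
        ultimately have "h (Suc M) \<in> ?B'"
          using i M(1) MN b by (auto simp: fball_def hub_heavy_def hub_points_def)
        then have "g q * m (Suc M) \<le> g q * sum w ?B'"
          using mass[of "Suc M"] r(2) by (intro mult_left_mono) auto
        also note r(3)
        also have "(\<Sum>y\<in>?B. w y * f y) \<le> below_sum f (Suc M)"
          unfolding below_sum_def using M(3) MN below_subset[of "Suc M"] f w_nonneg
          by (intro sum_mono2) (auto intro: finite_subset[OF _ finite_S])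
        finally have "g q \<le> below_sum f (Suc M) / m (Suc M)"
          using m_gt_0[of "Suc M"] by (simp add: field_simps)
        with i M(1) MN show ?thesis by auto
      qed
    qed (use tameI in auto)
  qed
  define R where "R = {i. i \<in> {1..N} \<and> h i \<in> S \<and> \<not> tame f (h i) (g (h i))}"
  \<comment> \<open>The denominator is the mass of the next heavy point, whence the index shift.
    Values with M = N were tame and do not occur here.\<close>
  define c where "c M = (if M < N then (below_sum f (Suc M) / m (Suc M)) powr p else 0)" for M
  have "(\<Sum>q\<in>S. w q * g q powr p) \<le> 8 * 2 powr p * J + (\<Sum>i\<in>R. m i * g (h i) powr p)"
    unfolding J_def R_def using p f cases by (intro sum_le_tame_plus_heavy) (force|blast)+
  also have "(\<Sum>i\<in>R. m i * g (h i) powr p) \<le> 2 * (\<Sum>M=1..N. m M * c M)"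
  proof (rule heavy_tail_le)
    fix i assume i: "i \<in> R"
    then obtain M where M: "M \<in> {i..<N}" "g (h i) \<le> below_sum f (Suc M) / m (Suc M)"
      using cases[of "h i"] by (auto simp: R_def)
    have "g (h i) powr p \<le> c M"
      using M i g p by (auto simp: c_def R_def intro!: powr_mono2)
    then show "\<exists>M\<in>{i..N}. g (h i) powr p \<le> c M" using M by auto
  qed (auto simp: R_def c_def)
  also have "(\<Sum>M=1..N. m M * c M) \<le> (\<Sum>M=1..N. (1 / 2) ^ M * (2 powr p * J))"
  proof (rule sum_mono)
    fix M assume M: "M \<in> {1..N}"
    show "m M * c M \<le> (1 / 2) ^ M * (2 powr p * J)"
    proof (cases "M < N")
      case True
      let ?x = "(below_sum f (Suc M) / m (Suc M)) powr p"
      have "16 powr (1 - p) \<le> (1::real)" using powr_mono[of "1 - p" 0 16] p by simp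
      then have "2 powr p * J * (16 powr (1 - p)) ^ M \<le> 2 powr p * J * 1"
        using J by (intro mult_left_mono power_le_one) auto
      moreover have "m (Suc M) * ?x \<le> 2 powr p * J * (16 powr (1 - p)) ^ M"
        unfolding J_def using p f True by (intro below_sum_powr_le) auto
      ultimately have *: "m (Suc M) * ?x \<le> 2 powr p * J" by linarith
      \<comment> \<open>The next mass exceeds m_M by a factor of at least 2^M, so the sum over
        \<open>M\<close> converges even at p = 1, where the factor 16^(1-p) gives no decay.\<close>
      have "(2::real) ^ M \<le> 16 ^ M * 4"
        using power_mono[of 2 "16::real" M] by (smt (verit) zero_le_power)
      then have "2 ^ M * m M \<le> m (Suc M)"
        using m_gt_0[of M] by (simp add: m_Suc mult.assoc[symmetric])
      then have "2 ^ M * m M * ?x \<le> m (Suc M) * ?x" by (intro mult_right_mono) auto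
      also note *
      finally show ?thesis using True by (simp add: c_def field_simps power_divide)
    qed (use J in \<open>simp add: c_def\<close>)
  qed
  also have "\<dots> = (\<Sum>M=1..N. (1 / 2) ^ M) * (2 powr p * J)" by (simp add: sum_distrib_right)
  also have "\<dots> \<le> 1 * (2 powr p * J)" using J sum_light_le by (intro mult_right_mono) auto
  finally show "(\<Sum>q\<in>S. w q * g q powr p) \<le> 10 * 2 powr p * (\<Sum>q\<in>S. w q * f q powr p)"
    by (simp add: J_def algebra_simps)
qed

lemma initial_mass_le:
  assumes "B \<subseteq> below (Suc i)" "i \<in> {1..N}"
  shows "sum w B \<le> 4 * m i"
proof -
  have "sum w B \<le> sum w (below (Suc i))"
    using assms below_subset[of "Suc i"] w_nonneg
    by (intro sum_mono2) (auto intro: finite_subset[OF _ finite_S])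
  also have "\<dots> \<le> 4 * m i" using assms by (intro sum_below) auto
  finally show ?thesis .
qed

text \<open>From the midpoint z_i the center and x_i are at distance s_i / 2, and all later heavy
  points at distance at least s_i / 2 + \<sigma> s_i. The enlarged radius is set equal to the
  latter; since k \<le> \<sigma>, dividing it by k leaves more than s_i / 2.\<close>

lemma noncentered_chain_pair:
  assumes b: "\<not> b" and k: "1 \<le> k" "k \<le> \<sigma>" and i: "i \<in> {1..N}"
    and s_later: "\<And>j. i < j \<Longrightarrow> j \<le> N \<Longrightarrow> \<sigma> * s i \<le> s j"
  shows "\<exists>(B, B')\<in>noncentered_pairs S d k (h i). a \<in> B \<and> B \<subseteq> S \<and> sum w B' \<le> 4 * m i"
proof -
  define r where "r = s i * (1 / 2 + \<sigma>) / k"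
  have si: "0 < s i" using i s_pos by simp
  have kr: "k * r = s i / 2 + \<sigma> * s i" using k by (simp add: r_def field_simps)
  have "k * s i \<le> \<sigma> * s i" using k si by (intro mult_right_mono) auto
  moreover have "0 < k * s i" using k si by simp
  ultimately have "k * (s i / 2) < k * r" using si unfolding kr by linarith
  then have r: "s i / 2 < r" using k by simp
  then have "0 < r" using si by simp
  have a: "a \<in> fball S d (l i) r" "h i \<in> fball S d (l i) r"
    using b i s_0 r by (auto simp: fball_def hub_light_def hub_heavy_def hub_points_def)
  have "fball S d (l i) (k * r) \<subseteq> below (Suc i)"
  proof
    fix q assume q: "q \<in> fball S d (l i) (k * r)"
    then have "q \<in> S" "d (l i) q < s i / 2 + \<sigma> * s i" using kr by (auto simp: fball_def)
    then show "q \<in> below (Suc i)"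
    proof (cases rule: S_cases)
      case (heavy j)
      have "j \<le> i"
      proof (rule ccontr)
        assume "\<not> j \<le> i"
        then show False using s_later[of j] heavy b \<open>d (l i) q < _\<close>
          by (auto simp: hub_light_def hub_heavy_def)
      qed
      then show ?thesis using heavy by (auto simp: below_def)
    qed (auto simp: below_def off_heavy_def)
  qed
  then have "sum w (fball S d (l i) (k * r)) \<le> 4 * m i" using i by (rule initial_mass_le)
  moreover have "(fball S d (l i) r, fball S d (l i) (k * r)) \<in> noncentered_pairs S d k (h i)"
    unfolding noncentered_pairs_def using \<open>0 < r\<close> a i by force
  ultimately show ?thesis using a fball_subset[of S d] by blast
qed

lemma centered_chain_pair:
  assumes b: "\<not> b" and k: "1 \<le> k" and i: "i \<in> {1..N}"
    and s_later: "\<And>j. i < j \<Longrightarrow> j \<le> N \<Longrightarrow> 2 * k * s i \<le> s j"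
  shows "\<exists>(B, B')\<in>centered_pairs S d k (h i). a \<in> B \<and> B \<subseteq> S \<and> sum w B' \<le> 4 * m i"
proof -
  \<comment> \<open>The center is at distance s_i, so this ball contains it, while the enlarged
    radius 2 k s_i does not reach the later heavy points.\<close>
  define r where "r = 2 * s i"
  have si: "0 < s i" using i s_pos by simp
  have a: "a \<in> fball S d (h i) r"
    using b si s_0 i by (auto simp: fball_def hub_heavy_def r_def)
  have "fball S d (h i) (k * r) \<subseteq> below (Suc i)"
  proof
    fix q assume q: "q \<in> fball S d (h i) (k * r)"
    then have "q \<in> S" "d (h i) q < 2 * k * s i" by (auto simp: fball_def r_def)
    then show "q \<in> below (Suc i)"
    proof (cases rule: S_cases)
      case (heavy j)
      have "j \<le> i"
      proof (rule ccontr)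
        assume "\<not> j \<le> i"
        then show False using s_later[of j] heavy b \<open>d (h i) q < _\<close>
          by (auto simp: hub_heavy_def)
      qed
      then show ?thesis using heavy by (auto simp: below_def)
    qed (auto simp: below_def off_heavy_def)
  qed
  then have "sum w (fball S d (h i) (k * r)) \<le> 4 * m i" using i by (rule initial_mass_le)
  moreover have "(fball S d (h i) r, fball S d (h i) (k * r)) \<in> centered_pairs S d k (h i)"
    unfolding centered_pairs_def using si by (force simp: r_def)
  ultimately show ?thesis using a fball_subset[of S d] by blast
qed

end

section \<open>Gluing finite spaces\<close>

lemma ennreal_powr_ennreal [simp]: "0 \<le> x \<Longrightarrow> ennreal_powr (ennreal x) a = ennreal (x powr a)"
  by (simp add: ennreal_powr_def)

lemma ennreal_powr_top [simp]: "ennreal_powr top a = top"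
  by (simp add: ennreal_powr_def)

lemma ennreal_powr_mono: "x \<le> y \<Longrightarrow> 0 \<le> a \<Longrightarrow> ennreal_powr x a \<le> ennreal_powr y a"
  by (cases x; cases y) (auto simp: top_unique intro!: powr_mono2)

lemma ennreal_powr_mult:
  assumes "0 < c"
  shows "ennreal_powr (ennreal c * x) a = ennreal (c powr a) * ennreal_powr x a"
  using assms by (cases x) (auto simp: powr_mult ennreal_mult_top simp flip: ennreal_mult)

lemma ennreal_powr_inverse:
  assumes "0 < a"
  shows "ennreal_powr (ennreal_powr x a) (1 / a) = x" "ennreal_powr (ennreal_powr x (1 / a)) a = x"
  using assms by (cases x; simp add: powr_powr)+

lemma ennreal_powr_le_iff:
  assumes "0 < a"
  shows "ennreal_powr x (1 / a) \<le> ennreal_powr y (1 / a) \<longleftrightarrow> x \<le> y"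
proof
  assume "ennreal_powr x (1 / a) \<le> ennreal_powr y (1 / a)"
  then have "ennreal_powr (ennreal_powr x (1 / a)) a \<le> ennreal_powr (ennreal_powr y (1 / a)) a"
    using assms by - (rule ennreal_powr_mono, auto)
  then show "x \<le> y" by (simp only: ennreal_powr_inverse(2)[OF assms])
qed (use assms in \<open>auto intro: ennreal_powr_mono\<close>)

lemma Lp_norm_le_iff:
  assumes p: "1 \<le> p" and C: "0 < C"
  shows "Lp_norm M (ereal p) g \<le> ennreal C * Lp_norm M (ereal p) h \<longleftrightarrow>
    (\<integral>\<^sup>+x. ennreal_powr (g x) p \<partial>M) \<le> ennreal (C powr p) * (\<integral>\<^sup>+x. ennreal_powr (h x) p \<partial>M)"
proof -
  have "ennreal C * ennreal_powr I (1 / p) = ennreal_powr (ennreal (C powr p) * I) (1 / p)" for I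
    using p C by (subst ennreal_powr_mult) (auto simp: powr_powr)
  then show ?thesis using p by (simp add: Lp_norm_def ennreal_powr_le_iff)
qed

lemma weak_Lp_norm_le_iff:
  assumes p: "1 \<le> p" and C: "0 < C"
  shows "weak_Lp_norm M (ereal p) g \<le> ennreal C * Lp_norm M (ereal p) h \<longleftrightarrow>
    (\<forall>t>0. ennreal (t powr p) * emeasure M {x \<in> space M. ennreal t < g x} \<le>
       ennreal (C powr p) * (\<integral>\<^sup>+x. ennreal_powr (h x) p \<partial>M))"
proof -
  have *: "ennreal C * ennreal_powr I (1 / p) = ennreal_powr (ennreal (C powr p) * I) (1 / p)"
    if "0 < C" for I and C :: real
    using p that by (subst ennreal_powr_mult) (auto simp: powr_powr)
  show ?thesis using p C by (auto simp: weak_Lp_norm_def Lp_norm_def SUP_le_iff * ennreal_powr_le_iff)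
qed

lemma strong_type_iff:
  assumes p: "1 \<le> p"
  shows "strong_type M (ereal p) T \<longleftrightarrow> (\<exists>K>0. \<forall>f\<in>Lp_functions M (ereal p).
    (\<integral>\<^sup>+x. ennreal_powr (T f x) p \<partial>M) \<le> ennreal K * (\<integral>\<^sup>+x. ennreal (\<bar>f x\<bar> powr p) \<partial>M))"
proof
  assume "strong_type M (ereal p) T"
  then obtain C where C: "\<And>f. f \<in> Lp_functions M (ereal p) \<Longrightarrow>
      Lp_norm M (ereal p) (T f) \<le> ennreal C * Lp_norm M (ereal p) (\<lambda>x. ennreal \<bar>f x\<bar>)"
    by (auto simp: strong_type_def)
  \<comment> \<open>The constant in \<open>strong_type\<close> may be zero or negative;
    \<open>Lp_norm_le_iff\<close> wants a positive one.\<close>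
  have "Lp_norm M (ereal p) (T f) \<le> ennreal (max 1 C) * Lp_norm M (ereal p) (\<lambda>x. ennreal \<bar>f x\<bar>)"
    if "f \<in> Lp_functions M (ereal p)" for f
    using C[OF that] by (rule order_trans) (auto intro!: mult_right_mono ennreal_leI)
  then show "\<exists>K>0. \<forall>f\<in>Lp_functions M (ereal p).
    (\<integral>\<^sup>+x. ennreal_powr (T f x) p \<partial>M) \<le> ennreal K * (\<integral>\<^sup>+x. ennreal (\<bar>f x\<bar> powr p) \<partial>M)"
    using p by (intro exI[of _ "max 1 C powr p"]) (auto simp: Lp_norm_le_iff)
next
  assume "\<exists>K>0. \<forall>f\<in>Lp_functions M (ereal p).
    (\<integral>\<^sup>+x. ennreal_powr (T f x) p \<partial>M) \<le> ennreal K * (\<integral>\<^sup>+x. ennreal (\<bar>f x\<bar> powr p) \<partial>M)"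
  then obtain K where "0 < K" and K: "\<And>f. f \<in> Lp_functions M (ereal p) \<Longrightarrow>
    (\<integral>\<^sup>+x. ennreal_powr (T f x) p \<partial>M) \<le> ennreal K * (\<integral>\<^sup>+x. ennreal (\<bar>f x\<bar> powr p) \<partial>M)"
    by blast
  have "Lp_norm M (ereal p) (T f) \<le> ennreal (K powr (1 / p)) * Lp_norm M (ereal p) (\<lambda>x. ennreal \<bar>f x\<bar>)"
    if "f \<in> Lp_functions M (ereal p)" for f
    using K[OF that] p \<open>0 < K\<close> by (subst Lp_norm_le_iff) (auto simp: powr_powr)
  then show "strong_type M (ereal p) T" unfolding strong_type_def by blast
qed

lemma weak_type_iff:
  assumes p: "1 \<le> p"
  shows "weak_type M (ereal p) T \<longleftrightarrow> (\<exists>K>0. \<forall>f\<in>Lp_functions M (ereal p). \<forall>t>0.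
    ennreal (t powr p) * emeasure M {x \<in> space M. ennreal t < T f x} \<le>
      ennreal K * (\<integral>\<^sup>+x. ennreal (\<bar>f x\<bar> powr p) \<partial>M))"
proof
  assume "weak_type M (ereal p) T"
  then obtain C where C: "\<And>f. f \<in> Lp_functions M (ereal p) \<Longrightarrow>
      weak_Lp_norm M (ereal p) (T f) \<le> ennreal C * Lp_norm M (ereal p) (\<lambda>x. ennreal \<bar>f x\<bar>)"
    by (auto simp: weak_type_def)
  have "weak_Lp_norm M (ereal p) (T f) \<le> ennreal (max 1 C) * Lp_norm M (ereal p) (\<lambda>x. ennreal \<bar>f x\<bar>)"
    if "f \<in> Lp_functions M (ereal p)" for f
    using C[OF that] by (rule order_trans) (auto intro!: mult_right_mono ennreal_leI)
  then show "\<exists>K>0. \<forall>f\<in>Lp_functions M (ereal p). \<forall>t>0.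
    ennreal (t powr p) * emeasure M {x \<in> space M. ennreal t < T f x} \<le>
      ennreal K * (\<integral>\<^sup>+x. ennreal (\<bar>f x\<bar> powr p) \<partial>M)"
    using p by (intro exI[of _ "max 1 C powr p"]) (auto simp: weak_Lp_norm_le_iff)
next
  assume "\<exists>K>0. \<forall>f\<in>Lp_functions M (ereal p). \<forall>t>0.
    ennreal (t powr p) * emeasure M {x \<in> space M. ennreal t < T f x} \<le>
      ennreal K * (\<integral>\<^sup>+x. ennreal (\<bar>f x\<bar> powr p) \<partial>M)"
  then obtain K where "0 < K" and K: "\<And>f t. f \<in> Lp_functions M (ereal p) \<Longrightarrow> 0 < t \<Longrightarrow>
    ennreal (t powr p) * emeasure M {x \<in> space M. ennreal t < T f x} \<le>
      ennreal K * (\<integral>\<^sup>+x. ennreal (\<bar>f x\<bar> powr p) \<partial>M)"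
    by blast
  have "weak_Lp_norm M (ereal p) (T f) \<le> ennreal (K powr (1 / p)) * Lp_norm M (ereal p) (\<lambda>x. ennreal \<bar>f x\<bar>)"
    if "f \<in> Lp_functions M (ereal p)" for f
    using K[OF that] p \<open>0 < K\<close> by (subst weak_Lp_norm_le_iff) (auto simp: powr_powr)
  then show "weak_type M (ereal p) T" unfolding weak_type_def by blast
qed

lemma ennreal_divide_left_mono:
  fixes a b c :: ennreal
  assumes "b \<le> c"
  shows "a / c \<le> a / b"
proof -
  have "inverse c \<le> inverse b"
  proof (cases "b = 0")
    case False
    then show ?thesis using assms
      by (cases b; cases c) (auto simp: inverse_ennreal le_imp_inverse_le top_unique)
  qed simp
  then show ?thesis by (simp add: divide_ennreal_def mult_left_mono)
qed

section \<open>The glued metric measure space\<close>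

locale glued =
  fixes S :: "nat \<Rightarrow> 'a::countable set" and D :: "nat \<Rightarrow> 'a \<Rightarrow> 'a \<Rightarrow> real"
    and W :: "nat \<Rightarrow> 'a \<Rightarrow> real" and k :: real
  assumes k: "1 \<le> k" and finite_mms: "\<And>n. finite_mms (S n) (D n) (W n)"
begin

text \<open>The carrier has to consist of reals, so a point q of component n is coded by the natural
  number of the pair (n, q).\<close>

definition pt :: "nat \<Rightarrow> 'a \<Rightarrow> real" where "pt n q = real (to_nat (n, q))"
definition comp :: "real \<Rightarrow> nat" where "comp x = fst (from_nat (nat \<lfloor>x\<rfloor>) :: nat \<times> 'a)"
definition loc :: "real \<Rightarrow> 'a" where "loc x = snd (from_nat (nat \<lfloor>x\<rfloor>) :: nat \<times> 'a)"
definition X :: "real set" where "X = (\<Union>n. pt n ` S n)"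
text \<open>A radius up to 3 can be enlarged by k without leaving the component, and since
  components have diameter at most 2, such radii already produce all of its balls.\<close>

definition dst :: "real \<Rightarrow> real \<Rightarrow> real" where
  "dst x y = (if comp x = comp y then D (comp x) (loc x) (loc y) else 3 * k)"
text \<open>Gives component n the mass 2^-n, hence total mass 2. The factor cancels in every average
  taken inside one component, so the weights \<open>W n\<close> themselves may be unbounded.\<close>

definition \<kappa> :: "nat \<Rightarrow> real" where "\<kappa> n = (1 / 2) ^ n / sum (W n) (S n)"
definition \<mu> :: "real measure" where
  "\<mu> = point_measure X (\<lambda>x. ennreal (\<kappa> (comp x) * W (comp x) (loc x)))"

lemma comp_pt [simp]: "comp (pt n q) = n" and loc_pt [simp]: "loc (pt n q) = q"
  by (simp_all add: pt_def comp_def loc_def)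

lemma pt_eq_iff [simp]: "pt n q = pt n' q' \<longleftrightarrow> n = n' \<and> q = q'"
  by (metis comp_pt loc_pt)

lemma inj_pt: "inj_on (pt n) A"
  by (auto simp: inj_on_def)

lemma finite_S [simp]: "finite (S n)" and S_ne: "S n \<noteq> {}" and metric_D: "Metric_space (S n) (D n)"
  and W_pos: "q \<in> S n \<Longrightarrow> 0 < W n q" and D_le: "q \<in> S n \<Longrightarrow> q' \<in> S n \<Longrightarrow> D n q q' \<le> 2"
  using finite_mms[of n] by (auto simp: finite_mms_def)

lemma W_nonneg: "q \<in> S n \<Longrightarrow> 0 \<le> W n q"
  by (simp add: W_pos less_imp_le)

lemma sum_W_pos: "A \<subseteq> S n \<Longrightarrow> A \<noteq> {} \<Longrightarrow> 0 < sum (W n) A"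
  using W_pos finite_subset[OF _ finite_S] by (intro sum_pos) auto

lemma \<kappa>_pos: "0 < \<kappa> n"
  using sum_W_pos[of "S n" n] S_ne by (simp add: \<kappa>_def)

lemma pt_in_X [simp]: "pt n q \<in> X \<longleftrightarrow> q \<in> S n"
  by (auto simp: X_def)

lemma X_cases: assumes "x \<in> X" obtains n q where "x = pt n q" "q \<in> S n"
  using assms by (auto simp: X_def)

lemma dst_pt [simp]: "dst (pt n q) (pt n' q') = (if n = n' then D n q q' else 3 * k)"
  by (simp add: dst_def)

lemma space_\<mu> [simp]: "space \<mu> = X" and sets_\<mu> [simp]: "sets \<mu> = Pow X"
  by (simp_all add: \<mu>_def space_point_measure sets_point_measure)

lemma measurable_\<mu> [simp]: "f \<in> measurable \<mu> M \<longleftrightarrow> f \<in> X \<rightarrow> space M"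
  by (simp add: \<mu>_def)

lemma emeasure_pt: "q \<in> S n \<Longrightarrow> emeasure \<mu> {pt n q} = ennreal (\<kappa> n * W n q)"
proof -
  assume q: "q \<in> S n"
  then have pos: "0 < \<kappa> n * W n q" using \<kappa>_pos W_pos by simp
  let ?w = "\<lambda>x. ennreal (\<kappa> (comp x) * W (comp x) (loc x))"
  have eq: "{a. a \<in> {pt n q} \<and> 0 < ?w a} = {pt n q}" using pos by auto
  have "emeasure \<mu> {pt n q} = (\<Sum>a|a \<in> {pt n q} \<and> 0 < ?w a. ?w a)"
    unfolding \<mu>_def using q by (intro emeasure_point_measure) auto
  then show ?thesis unfolding eq by simp
qed

lemma nn_integral_pts:
  assumes "A \<subseteq> S n"
  shows "(\<integral>\<^sup>+x. g x * indicator (pt n ` A) x \<partial>\<mu>) = (\<Sum>q\<in>A. ennreal (\<kappa> n * W n q) * g (pt n q))"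
proof -
  have "finite A" using assms finite_S by (rule finite_subset)
  then have "(\<integral>\<^sup>+x. g x * indicator (pt n ` A) x \<partial>\<mu>) = (\<Sum>x\<in>pt n ` A. g x * emeasure \<mu> {x})"
    using assms by (intro nn_integral_indicator_finite) auto
  also have "\<dots> = (\<Sum>q\<in>A. g (pt n q) * emeasure \<mu> {pt n q})"
    by (subst sum.reindex) (auto simp: inj_pt)
  also have "\<dots> = (\<Sum>q\<in>A. ennreal (\<kappa> n * W n q) * g (pt n q))"
    using assms by (intro sum.cong) (auto simp: emeasure_pt mult.commute)
  finally show ?thesis .
qed

lemma nn_integral_pts_real:
  assumes "A \<subseteq> S n" "\<And>q. q \<in> A \<Longrightarrow> 0 \<le> g (pt n q)"
  shows "(\<integral>\<^sup>+x. ennreal (g x) * indicator (pt n ` A) x \<partial>\<mu>) = ennreal (\<kappa> n * (\<Sum>q\<in>A. W n q * g (pt n q)))"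
proof -
  have nn: "0 \<le> \<kappa> n * W n q" if "q \<in> A" for q
    using that assms(1) W_pos[of q n] \<kappa>_pos[of n] by (auto intro!: mult_nonneg_nonneg)
  have "(\<integral>\<^sup>+x. ennreal (g x) * indicator (pt n ` A) x \<partial>\<mu>) =
      (\<Sum>q\<in>A. ennreal (\<kappa> n * W n q) * ennreal (g (pt n q)))"
    using assms(1) by (rule nn_integral_pts)
  also have "\<dots> = (\<Sum>q\<in>A. ennreal (\<kappa> n * W n q * g (pt n q)))"
    using nn assms(2) by (intro sum.cong) (auto simp: ennreal_mult)
  also have "\<dots> = ennreal (\<Sum>q\<in>A. \<kappa> n * W n q * g (pt n q))"
    using nn assms(2) by (intro sum_ennreal) auto
  finally show ?thesis by (simp add: sum_distrib_left mult.assoc)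
qed

lemma emeasure_pts:
  assumes "A \<subseteq> S n"
  shows "emeasure \<mu> (pt n ` A) = ennreal (\<kappa> n * sum (W n) A)"
proof -
  have "emeasure \<mu> (pt n ` A) = (\<integral>\<^sup>+x. ennreal 1 * indicator (pt n ` A) x \<partial>\<mu>)"
    using assms by (subst ennreal_1, subst mult_1, intro nn_integral_indicator[symmetric]) auto
  also have "\<dots> = ennreal (\<kappa> n * sum (W n) A)" using nn_integral_pts_real[OF assms, of "\<lambda>_. 1"] by simp
  finally show ?thesis .
qed

lemma nn_integral_suminf:
  "(\<integral>\<^sup>+x. g x \<partial>\<mu>) = (\<Sum>n. \<integral>\<^sup>+x. g x * indicator (pt n ` S n) x \<partial>\<mu>)"
proof -
  have "(\<integral>\<^sup>+x. g x \<partial>\<mu>) = (\<integral>\<^sup>+x. g x * indicator (\<Union>n. pt n ` S n) x \<partial>\<mu>)"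
    by (intro nn_integral_cong) (auto simp: X_def)
  also have "\<dots> = (\<Sum>n. \<integral>\<^sup>+x. g x * indicator (pt n ` S n) x \<partial>\<mu>)"
    by (intro nn_integral_disjoint_family) (auto simp: disjoint_family_on_def X_def)
  finally show ?thesis .
qed

lemma emeasure_X: "emeasure \<mu> X = 2"
proof -
  have "emeasure \<mu> X = (\<integral>\<^sup>+x. 1 \<partial>\<mu>)" by simp
  also have "\<dots> = (\<Sum>n. emeasure \<mu> (pt n ` S n))"
    by (subst nn_integral_suminf) (simp add: image_subset_iff)
  also have "\<dots> = (\<Sum>n. ennreal ((1 / 2) ^ n))"
  proof (rule suminf_cong)
    fix n
    have "0 < sum (W n) (S n)" using S_ne by (intro sum_W_pos) auto
    then show "emeasure \<mu> (pt n ` S n) = ennreal ((1 / 2) ^ n)" by (simp add: emeasure_pts \<kappa>_def)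
  qed
  also have "\<dots> = ennreal (\<Sum>n. (1 / 2) ^ n)"
    by (intro suminf_ennreal2) (auto intro: summable_geometric)
  also have "(\<Sum>n. (1 / 2 :: real) ^ n) = 2" by (subst suminf_geometric) auto
  finally show ?thesis by simp
qed

lemma Metric_space_X: "Metric_space X dst"
proof
  have nonneg: "0 \<le> D n x y" for n x y
    using Metric_space.nonneg[OF metric_D] .
  show "0 \<le> dst x y" for x y using k nonneg by (simp add: dst_def)
  show "dst x y = dst y x" for x y
    using Metric_space.commute[OF metric_D] by (simp add: dst_def)
  show "dst x y = 0 \<longleftrightarrow> x = y" if "x \<in> X" "y \<in> X" for x y
  proof -
    obtain n q where x: "x = pt n q" "q \<in> S n" using \<open>x \<in> X\<close> by (rule X_cases)
    obtain n' q' where y: "y = pt n' q'" "q' \<in> S n'" using \<open>y \<in> X\<close> by (rule X_cases)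
    from x y show ?thesis using k Metric_space.zero[OF metric_D[of n], of q q'] by auto
  qed
  show "dst x z \<le> dst x y + dst y z" if "x \<in> X" "y \<in> X" "z \<in> X" for x y z
  proof -
    obtain n q where x: "x = pt n q" "q \<in> S n" using \<open>x \<in> X\<close> by (rule X_cases)
    obtain n' q' where y: "y = pt n' q'" "q' \<in> S n'" using \<open>y \<in> X\<close> by (rule X_cases)
    obtain n'' q'' where z: "z = pt n'' q''" "q'' \<in> S n''" using \<open>z \<in> X\<close> by (rule X_cases)
    note * = x y z
    show ?thesis
    proof (cases "n = n''")
      case True
      have "D n q q'' \<le> 3 * k + 3 * k" using D_le[of q n q''] * True k by simp
      then show ?thesis using * True Metric_space.triangle[OF metric_D[of n], of q q' q''] by auto
    next
      case False
      then show ?thesis using * nonneg[of n q q'] nonneg[of n' q' q''] k by auto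
    qed
  qed
qed

sublocale M: Metric_space X dst by (rule Metric_space_X)

lemma mball_pt:
  assumes "q \<in> S n" "0 < r"
  shows "M.mball (pt n q) r = (if r \<le> 3 * k then pt n ` fball (S n) (D n) q r else X)"
proof -
  define R where "R = (if r \<le> 3 * k then pt n ` fball (S n) (D n) q r else X)"
  have "y \<in> M.mball (pt n q) r \<longleftrightarrow> y \<in> R" if y: "y \<in> X" for y
  proof -
    obtain n' q' where *: "y = pt n' q'" "q' \<in> S n'" using y by (rule X_cases)
    have "D n q q' < r" if "n' = n" "3 * k < r" using D_le[of q n q'] that * k assms by simp
    then show ?thesis using * assms by (auto simp: R_def fball_def)
  qed
  moreover have "M.mball (pt n q) r \<subseteq> X" by (rule M.mball_subset_mspace)
  moreover have "R \<subseteq> X" by (auto simp: R_def fball_def)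
  ultimately have "M.mball (pt n q) r = R" by blast
  then show ?thesis by (simp add: R_def)
qed

text \<open>The topology is discrete, so the Borel sets are all subsets of \<open>X\<close>, which
  are the measurable sets of \<open>point_measure\<close>.\<close>

lemma openin_singleton: assumes "x \<in> X" shows "openin M.mtopology {x}"
proof -
  obtain n q where x: "x = pt n q" "q \<in> S n" using assms by (rule X_cases)
  \<comment> \<open>The additional 1 makes the minimum meaningful in one-point components and keeps
    the ball inside the component.\<close>
  define \<delta> where "\<delta> = Min (insert 1 (D n q ` (S n - {q})))"
  have pos: "0 < D n q q'" if "q' \<in> S n - {q}" for q'
    using Metric_space.mdist_pos_less[OF metric_D, of q q' n] that x by auto
  have \<delta>: "0 < \<delta>" unfolding \<delta>_def using pos by (subst Min_gr_iff) auto
  have \<delta>_le: "\<delta> \<le> D n q q'" if "q' \<in> S n - {q}" for q'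
    unfolding \<delta>_def using that by (intro Min_le) auto
  have "\<delta> \<le> 1" unfolding \<delta>_def by (intro Min_le) auto
  then have "M.mball x \<delta> = pt n ` fball (S n) (D n) q \<delta>"
    using mball_pt[of q n \<delta>] x \<delta> k by simp
  also have "\<dots> \<subseteq> {x}" using \<delta>_le x by (fastforce simp: fball_def)
  finally show ?thesis using \<delta> assms by (auto simp: M.openin_mtopology)
qed

lemma openin_all: "U \<subseteq> X \<Longrightarrow> openin M.mtopology U"
  using openin_singleton openin_Union[of "(\<lambda>x. {x}) ` U" M.mtopology] by auto

lemma countable_X: "countable X"
  by (auto simp: X_def intro!: countable_UN countable_finite)

sublocale metric_measure_space X dst \<mu>
proof unfold_locales
  show "X \<noteq> {}" using S_ne by (auto simp: X_def)
  show "space \<mu> = X" by simp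
  have "{U. openin M.mtopology U} = Pow X"
    using openin_all openin_subset[of M.mtopology] by auto
  then show "sets \<mu> = sigma_sets X {U. openin M.mtopology U}"
    by (auto intro: sigma_sets.Basic dest: sigma_sets_into_sp[OF order_refl])
  show "M.mbounded X"
  proof -
    obtain n q where q: "q \<in> S n" using S_ne by blast
    have "X \<subseteq> M.mball (pt n q) (3 * k + 1)" using mball_pt[OF q, of "3 * k + 1"] k by simp
    then show ?thesis using M.mbounded_subset M.mbounded_mball by blast
  qed
  show "separable_space M.mtopology"
    unfolding separable_space_def using countable_X closure_of_topspace[of M.mtopology]
    by (intro exI[of _ X]) simp
  show "emeasure \<mu> (M.mball x r) < \<infinity>" if "x \<in> X" "0 < r" for x r
  proof -
    have "emeasure \<mu> (M.mball x r) \<le> emeasure \<mu> X" by (intro emeasure_mono) auto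
    also have "\<dots> < \<infinity>" by (simp add: emeasure_X)
    finally show ?thesis .
  qed
  show "0 < emeasure \<mu> (M.mball x r)" if "x \<in> X" "0 < r" for x r
  proof -
    obtain n q where x: "x = pt n q" "q \<in> S n" using \<open>x \<in> X\<close> by (rule X_cases)
    have "0 < emeasure \<mu> {x}" using x \<kappa>_pos W_pos by (simp add: emeasure_pt)
    also have "\<dots> \<le> emeasure \<mu> (M.mball x r)" using that by (intro emeasure_mono) auto
    finally show ?thesis .
  qed
qed

text \<open>The bound 2 r \<le> 3 keeps both balls inside one component, where the scaling factor
  cancels.\<close>

lemma not_doubling:
  assumes "\<And>K. \<exists>n. \<exists>q\<in>S n. \<exists>r. 0 < r \<and> 2 * r \<le> 3 \<and>
    K * sum (W n) (fball (S n) (D n) q r) < sum (W n) (fball (S n) (D n) q (2 * r))"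
  shows "\<not> doubling"
proof
  assume doubling
  then obtain C where C: "\<And>x r. x \<in> X \<Longrightarrow> 0 < r \<Longrightarrow>
      emeasure \<mu> (M.mball x (2 * r)) \<le> ennreal C * emeasure \<mu> (M.mball x r)"
    by (auto simp: doubling_def)
  obtain n q r where *: "q \<in> S n" "0 < r" "2 * r \<le> 3"
    "max 0 C * sum (W n) (fball (S n) (D n) q r) < sum (W n) (fball (S n) (D n) q (2 * r))"
    using assms by blast
  have "ennreal (\<kappa> n * sum (W n) (fball (S n) (D n) q (2 * r))) \<le>
      ennreal (max 0 C) * ennreal (\<kappa> n * sum (W n) (fball (S n) (D n) q r))"
    using C[of "pt n q" r] * k by (simp add: mball_pt emeasure_pts fball_subset ennreal_max_0)
  also have "\<dots> = ennreal (\<kappa> n * (max 0 C * sum (W n) (fball (S n) (D n) q r)))"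
    using \<kappa>_pos[of n] W_nonneg fball_subset
    by (subst ennreal_mult[symmetric]) (auto simp: mult_ac intro!: mult_nonneg_nonneg sum_nonneg dest!: subsetD[OF fball_subset])
  finally have "\<kappa> n * sum (W n) (fball (S n) (D n) q (2 * r)) \<le>
      \<kappa> n * (max 0 C * sum (W n) (fball (S n) (D n) q r))"
    using \<kappa>_pos[of n] W_nonneg
    by (subst (asm) ennreal_le_iff) (auto intro!: mult_nonneg_nonneg sum_nonneg dest!: subsetD[OF fball_subset])
  then show False using * \<kappa>_pos[of n] by simp
qed

section \<open>Averages over balls of the glued space in terms of the components\<close>

definition avg :: "(real \<Rightarrow> real) \<Rightarrow> ennreal" where
  "avg f = (\<integral>\<^sup>+x. ennreal \<bar>f x\<bar> \<partial>\<mu>) / emeasure \<mu> X"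

definition val :: "nat \<Rightarrow> (real \<Rightarrow> real) \<Rightarrow> 'a set \<times> 'a set \<Rightarrow> real" where
  "val n f = (\<lambda>(A, B). (\<Sum>q\<in>A. W n q * \<bar>f (pt n q)\<bar>) / sum (W n) B)"

text \<open>\<open>T\<close> is, at each point, the supremum of the averages over the pairs \<open>\<B>\<close> of the component,
  up to the average over the whole space.\<close>

definition represents ::
    "(nat \<Rightarrow> 'a \<Rightarrow> ('a set \<times> 'a set) set) \<Rightarrow> ((real \<Rightarrow> real) \<Rightarrow> real \<Rightarrow> ennreal) \<Rightarrow> bool" where
  "represents \<B> T \<longleftrightarrow> (\<forall>n. \<forall>q\<in>S n.
     \<B> n q \<noteq> {} \<and> (\<forall>(A, B)\<in>\<B> n q. A \<noteq> {} \<and> A \<subseteq> B \<and> B \<subseteq> S n) \<and>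
     (\<forall>f. (\<forall>P\<in>\<B> n q. ennreal (val n f P) \<le> T f (pt n q)) \<and>
       (\<forall>c. avg f \<le> c \<and> (\<forall>P\<in>\<B> n q. ennreal (val n f P) \<le> c) \<longrightarrow> T f (pt n q) \<le> c)))"

lemma ratio_pts:
  assumes "A \<subseteq> B" "B \<subseteq> S n" "A \<noteq> {}"
  shows "(\<integral>\<^sup>+x\<in>pt n ` A. ennreal \<bar>f x\<bar> \<partial>\<mu>) / emeasure \<mu> (pt n ` B) = ennreal (val n f (A, B))"
proof -
  have pos: "0 < sum (W n) B" using assms by (intro sum_W_pos) auto
  have A: "A \<subseteq> S n" using assms by auto
  have nn: "0 \<le> (\<Sum>q\<in>A. W n q * \<bar>f (pt n q)\<bar>)"
    using A W_nonneg by (intro sum_nonneg) auto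
  have "(\<integral>\<^sup>+x\<in>pt n ` A. ennreal \<bar>f x\<bar> \<partial>\<mu>) = ennreal (\<kappa> n * (\<Sum>q\<in>A. W n q * \<bar>f (pt n q)\<bar>))"
    using nn_integral_pts_real[OF A, of "\<lambda>x. \<bar>f x\<bar>"] by simp
  then show ?thesis using pos nn \<kappa>_pos[of n] assms(2)
    by (simp add: emeasure_pts divide_ennreal val_def)
qed

text \<open>For r \<le> 3 k the enlarged ball contains the enlarged ball of the component; if it has
  become all of \<open>X\<close>, this only lowers the ratio. For larger r both balls are
  \<open>X\<close>.\<close>

lemma ball_ratio_le:
  assumes q: "q \<in> S n" and r: "0 < r" and c: "avg f \<le> c"
    "ennreal (val n f (fball (S n) (D n) q r, fball (S n) (D n) q (k * r))) \<le> c"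
  shows "(\<integral>\<^sup>+y\<in>M.mball (pt n q) r. ennreal \<bar>f y\<bar> \<partial>\<mu>) / emeasure \<mu> (M.mball (pt n q) (k * r)) \<le> c"
proof -
  have kr: "0 < k * r" "r \<le> k * r" using k r by auto
  let ?A = "fball (S n) (D n) q r" and ?B = "fball (S n) (D n) q (k * r)"
  have qA: "q \<in> ?A" using q r Metric_space.mdist_zero[OF metric_D, of q n] by (simp add: fball_def)
  show ?thesis
  proof (cases "r \<le> 3 * k")
    case True
    have sub: "pt n ` ?B \<subseteq> M.mball (pt n q) (k * r)"
      using mball_pt[OF q kr(1)] by (auto simp: fball_def)
    have "(\<integral>\<^sup>+y\<in>M.mball (pt n q) r. ennreal \<bar>f y\<bar> \<partial>\<mu>) / emeasure \<mu> (M.mball (pt n q) (k * r)) \<le>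
        (\<integral>\<^sup>+y\<in>pt n ` ?A. ennreal \<bar>f y\<bar> \<partial>\<mu>) / emeasure \<mu> (pt n ` ?B)"
      using True sub unfolding mball_pt[OF q r]
      by (simp, intro ennreal_divide_left_mono emeasure_mono) auto
    also have "\<dots> = ennreal (val n f (?A, ?B))"
      using qA by (intro ratio_pts fball_subset fball_enlarge[OF k r]) auto
    finally show ?thesis using c(2) by simp
  next
    case False
    then have "M.mball (pt n q) r = X" "M.mball (pt n q) (k * r) = X"
      using kr q r by (auto simp: mball_pt)
    moreover have "(\<integral>\<^sup>+y\<in>X. ennreal \<bar>f y\<bar> \<partial>\<mu>) = (\<integral>\<^sup>+y. ennreal \<bar>f y\<bar> \<partial>\<mu>)"
      by (intro nn_integral_cong) auto
    ultimately show ?thesis using c(1) by (simp add: avg_def)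
  qed
qed

lemma val_le_ball_ratio:
  assumes q: "q \<in> S n" and r: "0 < r"
  shows "\<exists>r'>0. fball (S n) (D n) q r' = fball (S n) (D n) q r \<and>
    ennreal (val n f (fball (S n) (D n) q r, fball (S n) (D n) q (k * r))) \<le>
      (\<integral>\<^sup>+y\<in>M.mball (pt n q) r'. ennreal \<bar>f y\<bar> \<partial>\<mu>) / emeasure \<mu> (M.mball (pt n q) (k * r'))"
proof -
  \<comment> \<open>Beyond radius 3 the component is exhausted, so cutting there changes neither of
    its balls, and k r' \<le> 3 k keeps the enlargement inside the component.\<close>
  define r' where "r' = min r 3"
  have r': "0 < r'" "r' \<le> 3" using r by (auto simp: r'_def)
  have all: "fball (S n) (D n) q \<rho> = S n" if "3 \<le> \<rho>" for \<rho>
    using that D_le[OF q] by (force simp: fball_def)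
  have le: "3 * 1 \<le> 3 * k" "1 * r \<le> k * r" using k r by (auto intro!: mult_right_mono)
  have eq: "fball (S n) (D n) q r' = fball (S n) (D n) q r"
    "fball (S n) (D n) q (k * r') = fball (S n) (D n) q (k * r)"
    using all le by (auto simp: r'_def min_def mult.commute)
  have kr': "0 < k * r'" "k * r' \<le> 3 * k" using r' k by auto
  have "q \<in> fball (S n) (D n) q r'"
    using q r' Metric_space.mdist_zero[OF metric_D, of q n] by (simp add: fball_def)
  then have "ennreal (val n f (fball (S n) (D n) q r', fball (S n) (D n) q (k * r'))) =
      (\<integral>\<^sup>+y\<in>M.mball (pt n q) r'. ennreal \<bar>f y\<bar> \<partial>\<mu>) / emeasure \<mu> (M.mball (pt n q) (k * r'))"
    using q r' kr' le fball_enlarge[OF k r'(1), of "S n" "D n" q] fball_subset[of "S n" "D n"]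
    by (subst ratio_pts[symmetric]) (auto simp: mball_pt)
  then show ?thesis using r'(1) eq by (intro exI[of _ r']) auto
qed

lemma represents_centered:
  "represents (\<lambda>n. centered_pairs (S n) (D n) k) (centered_maximal k)"
  unfolding represents_def
proof (intro allI ballI conjI impI)
  fix n q assume q: "q \<in> S n"
  show "centered_pairs (S n) (D n) k q \<noteq> {}"
    unfolding centered_pairs_def using zero_less_one by blast
  have "q \<in> fball (S n) (D n) q r" if "0 < r" for r
    using q that Metric_space.mdist_zero[OF metric_D, of q n] by (simp add: fball_def)
  then show "case P of (A, B) \<Rightarrow> A \<noteq> {} \<and> A \<subseteq> B \<and> B \<subseteq> S n"
    if "P \<in> centered_pairs (S n) (D n) k q" for P
    using that fball_enlarge[OF k] fball_subset[of "S n" "D n"] by (fastforce simp: centered_pairs_def)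
  fix f
  show "ennreal (val n f P) \<le> centered_maximal k f (pt n q)"
    if P: "P \<in> centered_pairs (S n) (D n) k q" for P
  proof -
    obtain r where r: "0 < r" "P = (fball (S n) (D n) q r, fball (S n) (D n) q (k * r))"
      using P by (auto simp: centered_pairs_def)
    obtain r' where "0 < r'" "ennreal (val n f P) \<le>
        (\<integral>\<^sup>+y\<in>M.mball (pt n q) r'. ennreal \<bar>f y\<bar> \<partial>\<mu>) / emeasure \<mu> (M.mball (pt n q) (k * r'))"
      using val_le_ball_ratio[OF q r(1), of f] r(2) by blast
    then show ?thesis unfolding centered_maximal_def by (intro SUP_upper2[of r']) auto
  qed
  show "centered_maximal k f (pt n q) \<le> c"
    if c: "avg f \<le> c \<and> (\<forall>P\<in>centered_pairs (S n) (D n) k q. ennreal (val n f P) \<le> c)" for c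
    unfolding centered_maximal_def
  proof (rule SUP_least)
    fix r :: real assume r: "r \<in> {0<..}"
    then have "(fball (S n) (D n) q r, fball (S n) (D n) q (k * r)) \<in> centered_pairs (S n) (D n) k q"
      by (auto simp: centered_pairs_def)
    then show "(\<integral>\<^sup>+y\<in>M.mball (pt n q) r. ennreal \<bar>f y\<bar> \<partial>\<mu>) / emeasure \<mu> (M.mball (pt n q) (k * r)) \<le> c"
      using q r c by (intro ball_ratio_le) auto
  qed
qed

lemma represents_noncentered:
  "represents (\<lambda>n. noncentered_pairs (S n) (D n) k) (noncentered_maximal k)"
  unfolding represents_def
proof (intro allI ballI conjI impI)
  fix n q assume q: "q \<in> S n"
  have "q \<in> fball (S n) (D n) q 1"
    using q Metric_space.mdist_zero[OF metric_D, of q n] by (simp add: fball_def)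
  then show "noncentered_pairs (S n) (D n) k q \<noteq> {}"
    unfolding noncentered_pairs_def using q zero_less_one by blast
  show "case P of (A, B) \<Rightarrow> A \<noteq> {} \<and> A \<subseteq> B \<and> B \<subseteq> S n"
    if "P \<in> noncentered_pairs (S n) (D n) k q" for P
    using that fball_enlarge[OF k] fball_subset[of "S n" "D n"] by (fastforce simp: noncentered_pairs_def)
  fix f
  show "ennreal (val n f P) \<le> noncentered_maximal k f (pt n q)"
    if P: "P \<in> noncentered_pairs (S n) (D n) k q" for P
  proof -
    obtain y r where r: "0 < r" "P = (fball (S n) (D n) y r, fball (S n) (D n) y (k * r))"
      "y \<in> S n" "q \<in> fball (S n) (D n) y r"
      using P by (auto simp: noncentered_pairs_def)
    obtain r' where r': "0 < r'" "fball (S n) (D n) y r' = fball (S n) (D n) y r" "ennreal (val n f P) \<le>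
        (\<integral>\<^sup>+x\<in>M.mball (pt n y) r'. ennreal \<bar>f x\<bar> \<partial>\<mu>) / emeasure \<mu> (M.mball (pt n y) (k * r'))"
      using val_le_ball_ratio[OF r(3,1), of f] r(2) by blast
    have "q \<in> fball (S n) (D n) y r'" using r r' by simp
    then have "pt n q \<in> M.mball (pt n y) r'" using q r by (auto simp: fball_def)
    then show ?thesis unfolding noncentered_maximal_def using r r'
      by (intro SUP_upper2[of "(pt n y, r')"]) auto
  qed
  show "noncentered_maximal k f (pt n q) \<le> c"
    if c: "avg f \<le> c \<and> (\<forall>P\<in>noncentered_pairs (S n) (D n) k q. ennreal (val n f P) \<le> c)" for c
    unfolding noncentered_maximal_def
  proof (rule SUP_least, clarify)
    fix x r assume x: "x \<in> X" "0 < (r :: real)" "pt n q \<in> M.mball x r"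
    obtain n' y where y: "x = pt n' y" "y \<in> S n'" using x(1) by (rule X_cases)
    show "(\<integral>\<^sup>+z\<in>M.mball x r. ennreal \<bar>f z\<bar> \<partial>\<mu>) / emeasure \<mu> (M.mball x (k * r)) \<le> c"
    proof (cases "n' = n")
      case True
      then have "q \<in> fball (S n) (D n) y r" using x y q by (auto simp: fball_def)
      then have "(fball (S n) (D n) y r, fball (S n) (D n) y (k * r)) \<in> noncentered_pairs (S n) (D n) k q"
        using x y True by (auto simp: noncentered_pairs_def)
      then show ?thesis using y x c True by (auto intro!: ball_ratio_le)
    next
      case False
      \<comment> \<open>A ball that reaches over from another component is already the whole
        space.\<close>
      then have "3 * k < r" using x y by auto
      moreover have "1 * r \<le> k * r" using k x(2) by (intro mult_right_mono) auto
      ultimately have "M.mball x r = X" "M.mball x (k * r) = X"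
        using y x(2) by (auto simp: mball_pt)
      moreover have "(\<integral>\<^sup>+y\<in>X. ennreal \<bar>f y\<bar> \<partial>\<mu>) = (\<integral>\<^sup>+y. ennreal \<bar>f y\<bar> \<partial>\<mu>)"
        by (intro nn_integral_cong) auto
      ultimately show ?thesis using c by (simp add: avg_def)
    qed
  qed
qed

end

section \<open>Transfer of strong and weak type between the glued space and its components\<close>

context glued
begin

text \<open>The splitting behind \<open>average_powr_le\<close> once more, now for integrals over
  the whole space, of mass 2.\<close>

lemma avg_powr_le:
  assumes p: "1 \<le> p"
  shows "ennreal_powr (avg f) p * 2 \<le> ennreal (2 powr p) * (\<integral>\<^sup>+x. ennreal (\<bar>f x\<bar> powr p) \<partial>\<mu>)"
proof (cases "\<integral>\<^sup>+x. ennreal (\<bar>f x\<bar> powr p) \<partial>\<mu>")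
  case (real J)
  have split: "(\<integral>\<^sup>+x. ennreal \<bar>f x\<bar> \<partial>\<mu>) \<le> ennreal (c * 2 + c powr (1 - p) * J)" if c: "0 < c" for c
  proof -
    have "(\<integral>\<^sup>+x. ennreal \<bar>f x\<bar> \<partial>\<mu>) \<le>
        (\<integral>\<^sup>+x. ennreal c + ennreal (c powr (1 - p)) * ennreal (\<bar>f x\<bar> powr p) \<partial>\<mu>)"
    proof (rule nn_integral_mono)
      fix x
      have "\<bar>f x\<bar> \<le> c + \<bar>f x\<bar> powr p * c powr (1 - p)" using c p by (intro le_add_powr) auto
      then show "ennreal \<bar>f x\<bar> \<le> ennreal c + ennreal (c powr (1 - p)) * ennreal (\<bar>f x\<bar> powr p)"
        using c by (simp add: ennreal_leI mult.commute flip: ennreal_mult ennreal_plus)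
    qed
    also have "\<dots> = ennreal c * 2 + ennreal (c powr (1 - p)) * ennreal J"
      using real by (simp add: nn_integral_add nn_integral_cmult emeasure_X)
    also have "\<dots> = ennreal (c * 2 + c powr (1 - p) * J)"
      using c real(1) by (simp add: ennreal_mult ennreal_plus)
    finally show ?thesis .
  qed
  have "(\<integral>\<^sup>+x. ennreal \<bar>f x\<bar> \<partial>\<mu>) < \<infinity>"
    using split[of 1] by (simp add: order_le_less_trans)
  then obtain b where b: "0 \<le> b" "(\<integral>\<^sup>+x. ennreal \<bar>f x\<bar> \<partial>\<mu>) = ennreal b"
    by (cases "\<integral>\<^sup>+x. ennreal \<bar>f x\<bar> \<partial>\<mu>") auto
  define g where "g = b / 2"
  have avg: "avg f = ennreal g"
  proof -
    have "avg f = ennreal b / ennreal 2" by (simp add: avg_def b emeasure_X)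
    also have "\<dots> = ennreal g" unfolding g_def using b by (subst divide_ennreal) auto
    finally show ?thesis .
  qed
  have "2 * g powr p \<le> 2 powr p * J"
  proof (cases "g = 0")
    case False
    then have g: "0 < g" using b by (simp add: g_def)
    then have "ennreal b \<le> ennreal (g / 2 * 2 + (g / 2) powr (1 - p) * J)"
      using split[of "g / 2"] unfolding b(2) half_gt_zero_iff by blast
    then have "g * 2 \<le> g / 2 * 2 + (g / 2) powr (1 - p) * J"
      using g real(1) by (subst (asm) ennreal_le_iff) (auto simp: g_def)
    then show ?thesis using g by (intro powr_le_of_split)
  qed (use real in simp)
  then have "ennreal (g powr p * 2) \<le> ennreal (2 powr p * J)" by (intro ennreal_leI) simp
  then show ?thesis using b real by (simp add: avg g_def ennreal_mult)
qed (simp add: ennreal_mult_top)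

text \<open>A component has only finitely many pairs of balls, so the supremum is attained and can
  be used as the linearising function \<open>g\<close> of \<open>strong_const\<close>.\<close>

definition top_val :: "(nat \<Rightarrow> 'a \<Rightarrow> ('a set \<times> 'a set) set) \<Rightarrow> (real \<Rightarrow> real) \<Rightarrow> nat \<Rightarrow> 'a \<Rightarrow> real" where
  "top_val \<B> f n q = Max (val n f ` \<B> n q)"

context
  fixes \<B> T
  assumes rep: "represents \<B> T"
begin

lemma pairs_subset: "q \<in> S n \<Longrightarrow> (A, B) \<in> \<B> n q \<Longrightarrow> A \<noteq> {} \<and> A \<subseteq> B \<and> A \<subseteq> S n \<and> B \<subseteq> S n"
  using rep unfolding represents_def by blast

lemma val_le_T: "q \<in> S n \<Longrightarrow> P \<in> \<B> n q \<Longrightarrow> ennreal (val n f P) \<le> T f (pt n q)"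
  using rep unfolding represents_def by blast

lemma T_le: "q \<in> S n \<Longrightarrow> avg f \<le> c \<Longrightarrow> (\<And>P. P \<in> \<B> n q \<Longrightarrow> ennreal (val n f P) \<le> c) \<Longrightarrow> T f (pt n q) \<le> c"
  using rep unfolding represents_def by blast

lemma finite_pairs: assumes "q \<in> S n" shows "finite (\<B> n q)"
proof (rule finite_subset)
  show "\<B> n q \<subseteq> Pow (S n) \<times> Pow (S n)"
  proof (rule subrelI)
    show "(A, B) \<in> Pow (S n) \<times> Pow (S n)" if "(A, B) \<in> \<B> n q" for A B
      using pairs_subset[OF assms that] by simp
  qed
qed simp

lemma pairs_ne: "q \<in> S n \<Longrightarrow> \<B> n q \<noteq> {}"
  using rep unfolding represents_def by blast

lemma top_val:
  assumes "q \<in> S n"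
  shows "\<exists>(A, B)\<in>\<B> n q. top_val \<B> f n q * sum (W n) B = (\<Sum>q\<in>A. W n q * \<bar>f (pt n q)\<bar>)"
    "P \<in> \<B> n q \<Longrightarrow> val n f P \<le> top_val \<B> f n q" "0 \<le> top_val \<B> f n q"
proof -
  have "top_val \<B> f n q \<in> val n f ` \<B> n q"
    unfolding top_val_def using finite_pairs pairs_ne assms by (intro Max_in) auto
  then obtain A B where AB: "(A, B) \<in> \<B> n q" "top_val \<B> f n q = val n f (A, B)" by auto
  have B: "0 < sum (W n) B" "A \<subseteq> S n"
    using pairs_subset[OF assms AB(1)] by (auto intro!: sum_W_pos)
  show "\<exists>(A, B)\<in>\<B> n q. top_val \<B> f n q * sum (W n) B = (\<Sum>q\<in>A. W n q * \<bar>f (pt n q)\<bar>)"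
    using AB B by (intro bexI[of _ "(A, B)"]) (auto simp: val_def)
  show "0 \<le> top_val \<B> f n q"
    using AB B W_nonneg by (auto simp: val_def intro!: divide_nonneg_pos sum_nonneg mult_nonneg_nonneg)
  show "P \<in> \<B> n q \<Longrightarrow> val n f P \<le> top_val \<B> f n q"
    unfolding top_val_def using finite_pairs assms by (intro Max_ge) auto
qed

lemma T_le_max: "q \<in> S n \<Longrightarrow> T f (pt n q) \<le> max (avg f) (ennreal (top_val \<B> f n q))"
  by (rule T_le) (auto simp: le_max_iff_disj intro!: ennreal_leI top_val)

text \<open>Test functions living in one component: the factor \<kappa> n then appears on both sides
  of the inequality, and the constant of the glued space passes to every component.\<close>

definition extend :: "nat \<Rightarrow> ('a \<Rightarrow> real) \<Rightarrow> real \<Rightarrow> real" where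
  "extend n f x = (if x \<in> pt n ` S n then f (loc x) else 0)"

lemma extend_pt: "q \<in> S n \<Longrightarrow> extend n f (pt n q) = f q"
  by (simp add: extend_def)

lemma nn_integral_extend:
  assumes "\<And>q. q \<in> S n \<Longrightarrow> 0 \<le> f q"
  shows "(\<integral>\<^sup>+x. ennreal (\<bar>extend n f x\<bar> powr p) \<partial>\<mu>) = ennreal (\<kappa> n * (\<Sum>q\<in>S n. W n q * f q powr p))"
proof -
  have "(\<integral>\<^sup>+x. ennreal (\<bar>extend n f x\<bar> powr p) \<partial>\<mu>) =
      (\<integral>\<^sup>+x. ennreal (\<bar>extend n f x\<bar> powr p) * indicator (pt n ` S n) x \<partial>\<mu>)"
    by (intro nn_integral_cong) (auto simp: extend_def indicator_def)
  also have "\<dots> = ennreal (\<kappa> n * (\<Sum>q\<in>S n. W n q * \<bar>extend n f (pt n q)\<bar> powr p))"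
    by (rule nn_integral_pts_real) auto
  also have "(\<Sum>q\<in>S n. W n q * \<bar>extend n f (pt n q)\<bar> powr p) = (\<Sum>q\<in>S n. W n q * f q powr p)"
    using assms by (intro sum.cong) (auto simp: extend_pt)
  finally show ?thesis .
qed

lemma extend_in_Lp:
  assumes "\<And>q. q \<in> S n \<Longrightarrow> 0 \<le> f q" "1 \<le> p"
  shows "extend n f \<in> Lp_functions \<mu> (ereal p)"
proof -
  have "0 \<le> \<kappa> n * (\<Sum>q\<in>S n. W n q * f q powr p)"
    using \<kappa>_pos[of n] W_nonneg by (auto intro!: mult_nonneg_nonneg sum_nonneg)
  then show ?thesis
    using nn_integral_extend[of n f p] assms by (simp add: Lp_functions_def Lp_norm_def)
qed

lemma val_extend:
  assumes "\<And>q. q \<in> S n \<Longrightarrow> 0 \<le> f q" "A \<subseteq> S n"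
  shows "val n (extend n f) (A, B) = (\<Sum>q\<in>A. W n q * f q) / sum (W n) B"
proof -
  have "(\<Sum>q\<in>A. W n q * \<bar>extend n f (pt n q)\<bar>) = (\<Sum>q\<in>A. W n q * f q)"
    using assms by (intro sum.cong) (auto simp: extend_pt subset_iff)
  then show ?thesis by (simp add: val_def)
qed

text \<open>By \<open>T_le_max\<close> the maximal function is at most the larger of the global
  average and the value inside the component. The first costs 2^p; for the second, the inequalities
  of the components are multiplied by \<kappa> n and added.\<close>

lemma strong_type_if:
  assumes p: "1 \<le> p" and C: "\<And>n. strong_const (S n) (W n) (\<B> n) p C"
  shows "strong_type \<mu> (ereal p) T"
proof -
  define C' where "C' = max 0 C"
  have C': "strong_const (S n) (W n) (\<B> n) p C'" for n
    using C[of n] by (rule strong_const_mono[rotated 2]) (auto simp: C'_def W_pos)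
  have "(\<integral>\<^sup>+x. ennreal_powr (T f x) p \<partial>\<mu>) \<le>
      ennreal (2 powr p + C') * (\<integral>\<^sup>+x. ennreal (\<bar>f x\<bar> powr p) \<partial>\<mu>)" for f
  proof -
    define G where "G x = ennreal (top_val \<B> f (comp x) (loc x) powr p)" for x
    define I where "I = (\<integral>\<^sup>+x. ennreal (\<bar>f x\<bar> powr p) \<partial>\<mu>)"
    have "(\<integral>\<^sup>+x. ennreal_powr (T f x) p \<partial>\<mu>) \<le> (\<integral>\<^sup>+x. ennreal_powr (avg f) p + G x \<partial>\<mu>)"
    proof (rule nn_integral_mono)
      fix x assume "x \<in> space \<mu>"
      then obtain n q where x: "x = pt n q" "q \<in> S n" by (auto elim: X_cases)
      have "ennreal_powr (T f x) p \<le> ennreal_powr (max (avg f) (ennreal (top_val \<B> f n q))) p"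
        using T_le_max[OF x(2)] x(1) p by (intro ennreal_powr_mono) auto
      also have "\<dots> \<le> ennreal_powr (avg f) p + G x"
        using top_val(3)[OF x(2)] x(1) by (auto simp: G_def max_def)
      finally show "ennreal_powr (T f x) p \<le> ennreal_powr (avg f) p + G x" .
    qed
    also have "\<dots> = ennreal_powr (avg f) p * 2 + (\<integral>\<^sup>+x. G x \<partial>\<mu>)"
      by (simp add: nn_integral_add emeasure_X)
    also have "(\<integral>\<^sup>+x. G x \<partial>\<mu>) \<le> ennreal C' * I"
    proof -
      have "(\<integral>\<^sup>+x. G x * indicator (pt n ` S n) x \<partial>\<mu>) \<le>
          ennreal C' * (\<integral>\<^sup>+x. ennreal (\<bar>f x\<bar> powr p) * indicator (pt n ` S n) x \<partial>\<mu>)" for n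
      proof -
        have "(\<Sum>q\<in>S n. W n q * top_val \<B> f n q powr p) \<le> C' * (\<Sum>q\<in>S n. W n q * \<bar>f (pt n q)\<bar> powr p)"
        proof (rule C'[unfolded strong_const_def, rule_format])
          fix q assume q: "q \<in> S n"
          obtain A B where AB: "(A, B) \<in> \<B> n q"
            "top_val \<B> f n q * sum (W n) B = (\<Sum>q\<in>A. W n q * \<bar>f (pt n q)\<bar>)"
            using top_val(1)[OF q, of f] by auto
          then show "0 \<le> top_val \<B> f n q \<and> (\<exists>(A, B)\<in>\<B> n q.
              top_val \<B> f n q * sum (W n) B \<le> (\<Sum>y\<in>A. W n y * \<bar>f (pt n y)\<bar>))"
            using top_val(3)[OF q] by (intro conjI bexI[of _ "(A, B)"]) auto
        qed simp
        then have "\<kappa> n * (\<Sum>q\<in>S n. W n q * top_val \<B> f n q powr p) \<le>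
            C' * (\<kappa> n * (\<Sum>q\<in>S n. W n q * \<bar>f (pt n q)\<bar> powr p))"
          using \<kappa>_pos[of n] by (simp add: mult.left_commute)
        moreover have "0 \<le> \<kappa> n * (\<Sum>q\<in>S n. W n q * \<bar>f (pt n q)\<bar> powr p)"
          using \<kappa>_pos[of n] W_nonneg by (auto intro!: mult_nonneg_nonneg sum_nonneg)
        moreover have "(\<integral>\<^sup>+x. G x * indicator (pt n ` S n) x \<partial>\<mu>) =
            ennreal (\<kappa> n * (\<Sum>q\<in>S n. W n q * top_val \<B> f n q powr p))"
          unfolding G_def by (subst nn_integral_pts_real) auto
        ultimately show ?thesis
          by (subst nn_integral_pts_real) (auto simp: C'_def simp flip: ennreal_mult intro: ennreal_leI)
      qed
      then show ?thesis
        unfolding I_def nn_integral_suminf[of G] nn_integral_suminf[of "\<lambda>x. ennreal (\<bar>f x\<bar> powr p)"]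
        by (subst ennreal_suminf_cmult[symmetric]) (intro suminf_le, auto)
    qed
    finally have "(\<integral>\<^sup>+x. ennreal_powr (T f x) p \<partial>\<mu>) \<le> ennreal_powr (avg f) p * 2 + ennreal C' * I"
      by (simp add: add_left_mono)
    also have "\<dots> \<le> ennreal (2 powr p) * I + ennreal C' * I"
      unfolding I_def using avg_powr_le[OF p] by (intro add_right_mono)
    also have "\<dots> = ennreal (2 powr p + C') * I"
      by (simp add: C'_def distrib_right ennreal_plus)
    finally show ?thesis by (simp add: I_def)
  qed
  moreover have "0 < 2 powr p + C'" by (simp add: C'_def add_pos_nonneg)
  ultimately show ?thesis using p unfolding strong_type_iff[OF p] by blast
qed

lemma strong_type_imp:
  assumes p: "1 \<le> p" and "strong_type \<mu> (ereal p) T"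
  shows "\<exists>C. \<forall>n. strong_const (S n) (W n) (\<B> n) p C"
proof -
  obtain K where K: "0 < K" "\<And>f. f \<in> Lp_functions \<mu> (ereal p) \<Longrightarrow>
      (\<integral>\<^sup>+x. ennreal_powr (T f x) p \<partial>\<mu>) \<le> ennreal K * (\<integral>\<^sup>+x. ennreal (\<bar>f x\<bar> powr p) \<partial>\<mu>)"
    using assms(2) unfolding strong_type_iff[OF p] by blast
  have "strong_const (S n) (W n) (\<B> n) p K" for n
    unfolding strong_const_def
  proof (intro allI impI)
    fix f g :: "'a \<Rightarrow> real"
    assume f: "\<forall>x\<in>S n. 0 \<le> f x"
      and g: "\<forall>x\<in>S n. 0 \<le> g x \<and> (\<exists>(B, B')\<in>\<B> n x. g x * sum (W n) B' \<le> (\<Sum>y\<in>B. W n y * f y))"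
    let ?F = "extend n f"
    have T: "ennreal (g q powr p) \<le> ennreal_powr (T ?F (pt n q)) p" if q: "q \<in> S n" for q
    proof -
      obtain A B where AB: "(A, B) \<in> \<B> n q" "g q * sum (W n) B \<le> (\<Sum>y\<in>A. W n y * f y)" "0 \<le> g q"
        using g q by blast
      have sub: "A \<subseteq> S n" "0 < sum (W n) B"
        using pairs_subset[OF q AB(1)] by (auto intro!: sum_W_pos)
      have "g q \<le> val n ?F (A, B)"
        using AB(2) f sub by (subst val_extend) (auto simp: field_simps)
      then have "ennreal (g q) \<le> T ?F (pt n q)"
        using val_le_T[OF q AB(1), of ?F] by (meson ennreal_leI order_trans)
      then have "ennreal_powr (ennreal (g q)) p \<le> ennreal_powr (T ?F (pt n q)) p"
        using p by (intro ennreal_powr_mono) auto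
      then show ?thesis using AB by simp
    qed
    have "ennreal (\<kappa> n * (\<Sum>q\<in>S n. W n q * g q powr p)) =
        (\<integral>\<^sup>+x. ennreal (g (loc x) powr p) * indicator (pt n ` S n) x \<partial>\<mu>)"
      by (subst nn_integral_pts_real) auto
    also have "\<dots> \<le> (\<integral>\<^sup>+x. ennreal_powr (T ?F x) p \<partial>\<mu>)"
      using T by (intro nn_integral_mono) (auto simp: indicator_def)
    also have "\<dots> \<le> ennreal K * ennreal (\<kappa> n * (\<Sum>q\<in>S n. W n q * f q powr p))"
      using K(2)[OF extend_in_Lp[of n f p]] f p by (simp add: nn_integral_extend)
    also have "\<dots> = ennreal (K * (\<kappa> n * (\<Sum>q\<in>S n. W n q * f q powr p)))"
      using K(1) \<kappa>_pos[of n] W_nonneg by (subst ennreal_mult) (auto intro!: mult_nonneg_nonneg sum_nonneg)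
    finally have "\<kappa> n * (\<Sum>q\<in>S n. W n q * g q powr p) \<le> K * (\<kappa> n * (\<Sum>q\<in>S n. W n q * f q powr p))"
      using K(1) \<kappa>_pos[of n] W_nonneg by (subst (asm) ennreal_le_iff) (auto intro!: mult_nonneg_nonneg sum_nonneg)
    then show "(\<Sum>q\<in>S n. W n q * g q powr p) \<le> K * (\<Sum>q\<in>S n. W n q * f q powr p)"
      using \<kappa>_pos[of n] by (simp add: mult.left_commute)
  qed
  then show ?thesis by blast
qed

text \<open>For levels below the global average, the mass of the whole space is already controlled
  by \<open>avg_powr_le\<close>. At higher levels a point can exceed the level only through its own
  component.\<close>

lemma weak_type_if:
  assumes p: "1 \<le> p" and C: "\<And>n. weak_const (S n) (W n) (\<B> n) p C"
  shows "weak_type \<mu> (ereal p) T"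
proof -
  define C' where "C' = max 0 C"
  have C': "weak_const (S n) (W n) (\<B> n) p C'" for n
    using C[of n] by (rule weak_const_mono[rotated 2]) (auto simp: C'_def W_pos)
  have "ennreal (t powr p) * emeasure \<mu> {x \<in> space \<mu>. ennreal t < T f x} \<le>
      ennreal (2 powr p + C') * (\<integral>\<^sup>+x. ennreal (\<bar>f x\<bar> powr p) \<partial>\<mu>)" if t: "0 < t" for f t
  proof -
    define I where "I = (\<integral>\<^sup>+x. ennreal (\<bar>f x\<bar> powr p) \<partial>\<mu>)"
    have le: "ennreal (2 powr p) * I \<le> ennreal (2 powr p + C') * I"
      "ennreal C' * I \<le> ennreal (2 powr p + C') * I"
      by (auto intro!: mult_right_mono ennreal_leI simp: C'_def)
    show ?thesis
    proof (cases "ennreal t < avg f")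
      case True
      have "ennreal (t powr p) * emeasure \<mu> {x \<in> space \<mu>. ennreal t < T f x} \<le>
          ennreal (t powr p) * emeasure \<mu> X"
        by (intro mult_left_mono emeasure_mono) auto
      also have "\<dots> = ennreal_powr (ennreal t) p * 2" using t by (simp add: emeasure_X)
      also have "\<dots> \<le> ennreal_powr (avg f) p * 2"
        using True p by (intro mult_right_mono ennreal_powr_mono) auto
      also have "\<dots> \<le> ennreal (2 powr p) * I" unfolding I_def using p by (rule avg_powr_le)
      finally show ?thesis using le(1) unfolding I_def by (rule order_trans)
    next
      case False
      define E where "E n = {q \<in> S n. t < top_val \<B> f n q}" for n
      have "{x \<in> space \<mu>. ennreal t < T f x} \<subseteq> (\<Union>n. pt n ` E n)"
      proof
        fix x assume x: "x \<in> {x \<in> space \<mu>. ennreal t < T f x}"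
        then obtain n q where q: "x = pt n q" "q \<in> S n" by (auto elim: X_cases)
        have "ennreal t < max (avg f) (ennreal (top_val \<B> f n q))"
          using x q T_le_max[OF q(2), of f] by auto
        then have "ennreal t < ennreal (top_val \<B> f n q)" using False by (auto simp: less_max_iff_disj)
        then have "t < top_val \<B> f n q" using t by (simp add: ennreal_less_iff)
        then show "x \<in> (\<Union>n. pt n ` E n)" using q by (auto simp: E_def)
      qed
      then have "emeasure \<mu> {x \<in> space \<mu>. ennreal t < T f x} \<le> emeasure \<mu> (\<Union>n. pt n ` E n)"
        by (intro emeasure_mono) (auto simp: E_def)
      also have "\<dots> \<le> (\<Sum>n. emeasure \<mu> (pt n ` E n))"
        by (intro emeasure_subadditive_countably) (auto simp: E_def)
      finally have "ennreal (t powr p) * emeasure \<mu> {x \<in> space \<mu>. ennreal t < T f x} \<le>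
          ennreal (t powr p) * (\<Sum>n. emeasure \<mu> (pt n ` E n))" by (intro mult_left_mono) auto
      also have "\<dots> = (\<Sum>n. ennreal (t powr p) * emeasure \<mu> (pt n ` E n))" by simp
      also have "\<dots> \<le> (\<Sum>n. ennreal C' * (\<integral>\<^sup>+x. ennreal (\<bar>f x\<bar> powr p) * indicator (pt n ` S n) x \<partial>\<mu>))"
      proof (intro suminf_le)
        fix n
        have ES: "E n \<subseteq> S n" by (auto simp: E_def)
        have "\<exists>(A, B)\<in>\<B> n q. t * sum (W n) B < (\<Sum>y\<in>A. W n y * \<bar>f (pt n y)\<bar>)" if q: "q \<in> E n" for q
        proof -
          have qS: "q \<in> S n" using q by (simp add: E_def)
          obtain A B where AB: "(A, B) \<in> \<B> n q"
            "top_val \<B> f n q * sum (W n) B = (\<Sum>q\<in>A. W n q * \<bar>f (pt n q)\<bar>)"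
            using top_val(1)[OF qS, of f] by auto
          have "0 < sum (W n) B" using pairs_subset[OF qS AB(1)] by (intro sum_W_pos) auto
          then have "t * sum (W n) B < top_val \<B> f n q * sum (W n) B"
            using q by (simp add: E_def)
          then show ?thesis using AB by auto
        qed
        then have "t powr p * sum (W n) (E n) \<le> C' * (\<Sum>q\<in>S n. W n q * \<bar>f (pt n q)\<bar> powr p)"
          using C'[unfolded weak_const_def, rule_format, of n "\<lambda>q. \<bar>f (pt n q)\<bar>" t "E n"] t ES by simp
        then have "t powr p * (\<kappa> n * sum (W n) (E n)) \<le>
            C' * (\<kappa> n * (\<Sum>q\<in>S n. W n q * \<bar>f (pt n q)\<bar> powr p))"
          using \<kappa>_pos[of n] by (simp add: mult.left_commute)
        moreover have "0 \<le> \<kappa> n * (\<Sum>q\<in>S n. W n q * \<bar>f (pt n q)\<bar> powr p)"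
          using \<kappa>_pos[of n] W_nonneg by (auto intro!: mult_nonneg_nonneg sum_nonneg)
        moreover have "0 \<le> \<kappa> n * sum (W n) (E n)"
          using \<kappa>_pos[of n] W_nonneg ES by (auto intro!: mult_nonneg_nonneg sum_nonneg)
        ultimately show "ennreal (t powr p) * emeasure \<mu> (pt n ` E n) \<le>
            ennreal C' * (\<integral>\<^sup>+x. ennreal (\<bar>f x\<bar> powr p) * indicator (pt n ` S n) x \<partial>\<mu>)"
          by (subst nn_integral_pts_real)
            (auto simp: C'_def emeasure_pts[OF ES] simp flip: ennreal_mult intro: ennreal_leI)
      qed auto
      also have "\<dots> = ennreal C' * I"
        unfolding I_def nn_integral_suminf[of "\<lambda>x. ennreal (\<bar>f x\<bar> powr p)"] by simp
      finally show ?thesis using le(2) unfolding I_def by (rule order_trans)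
    qed
  qed
  moreover have "0 < 2 powr p + C'" by (simp add: C'_def add_pos_nonneg)
  ultimately show ?thesis unfolding weak_type_iff[OF p] by blast
qed

lemma weak_type_imp:
  assumes p: "1 \<le> p" and "weak_type \<mu> (ereal p) T"
  shows "\<exists>C. \<forall>n. weak_const (S n) (W n) (\<B> n) p C"
proof -
  obtain K where K: "0 < K" "\<And>f t. f \<in> Lp_functions \<mu> (ereal p) \<Longrightarrow> 0 < t \<Longrightarrow>
      ennreal (t powr p) * emeasure \<mu> {x \<in> space \<mu>. ennreal t < T f x} \<le>
      ennreal K * (\<integral>\<^sup>+x. ennreal (\<bar>f x\<bar> powr p) \<partial>\<mu>)"
    using assms(2) unfolding weak_type_iff[OF p] by blast
  have "weak_const (S n) (W n) (\<B> n) p K" for n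
    unfolding weak_const_def
  proof (intro allI impI)
    fix f :: "'a \<Rightarrow> real" and t :: real and E
    assume f: "\<forall>x\<in>S n. 0 \<le> f x" and t: "0 < t" and E: "E \<subseteq> S n"
      and g: "\<forall>x\<in>E. \<exists>(B, B')\<in>\<B> n x. t * sum (W n) B' < (\<Sum>y\<in>B. W n y * f y)"
    let ?F = "extend n f"
    have T: "ennreal t < T ?F (pt n q)" if qE: "q \<in> E" for q
    proof -
      have q: "q \<in> S n" using qE E by auto
      obtain A B where AB: "(A, B) \<in> \<B> n q" "t * sum (W n) B < (\<Sum>y\<in>A. W n y * f y)"
        using g qE by blast
      have sub: "A \<subseteq> S n" "0 < sum (W n) B"
        using pairs_subset[OF q AB(1)] by (auto intro!: sum_W_pos)
      have "t < val n ?F (A, B)"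
        using AB(2) f sub by (subst val_extend) (auto simp: field_simps)
      then have "ennreal t < ennreal (val n ?F (A, B))" using t by (simp add: ennreal_less_iff)
      also have "\<dots> \<le> T ?F (pt n q)" using val_le_T[OF q AB(1)] .
      finally show ?thesis .
    qed
    have "ennreal (t powr p * (\<kappa> n * sum (W n) E)) = ennreal (t powr p) * emeasure \<mu> (pt n ` E)"
      using \<kappa>_pos[of n] W_nonneg E
      by (subst emeasure_pts[OF E], subst ennreal_mult) (auto intro!: mult_nonneg_nonneg sum_nonneg)
    also have "\<dots> \<le> ennreal (t powr p) * emeasure \<mu> {x \<in> space \<mu>. ennreal t < T ?F x}"
      using T E by (intro mult_left_mono emeasure_mono) auto
    also have "\<dots> \<le> ennreal K * ennreal (\<kappa> n * (\<Sum>q\<in>S n. W n q * f q powr p))"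
      using K(2)[OF extend_in_Lp[of n f p] t] f p by (simp add: nn_integral_extend)
    also have "\<dots> = ennreal (K * (\<kappa> n * (\<Sum>q\<in>S n. W n q * f q powr p)))"
      using K(1) \<kappa>_pos[of n] W_nonneg by (subst ennreal_mult) (auto intro!: mult_nonneg_nonneg sum_nonneg)
    finally have "t powr p * (\<kappa> n * sum (W n) E) \<le> K * (\<kappa> n * (\<Sum>q\<in>S n. W n q * f q powr p))"
      using K(1) \<kappa>_pos[of n] W_nonneg by (subst (asm) ennreal_le_iff) (auto intro!: mult_nonneg_nonneg sum_nonneg)
    then show "t powr p * sum (W n) E \<le> K * (\<Sum>q\<in>S n. W n q * f q powr p)"
      using \<kappa>_pos[of n] by (simp add: mult.left_commute)
  qed
  then show ?thesis by blast
qed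

lemma T_le_esssup:
  assumes "x \<in> X"
  shows "T f x \<le> esssup \<mu> (\<lambda>x. ennreal \<bar>f x\<bar>)"
proof -
  define c where "c = esssup \<mu> (\<lambda>x. ennreal \<bar>f x\<bar>)"
  have "AE x in \<mu>. ennreal \<bar>f x\<bar> \<le> c" unfolding c_def by (rule esssup_AE)
  then have ae: "AE x in count_space X. 0 < ennreal (\<kappa> (comp x) * W (comp x) (loc x)) \<longrightarrow> ennreal \<bar>f x\<bar> \<le> c"
    unfolding \<mu>_def point_measure_def by (subst (asm) AE_density) auto
  \<comment> \<open>Every point has positive mass, so an essential bound holds at every
    point.\<close>
  have le: "ennreal \<bar>f (pt n q)\<bar> \<le> c" if "q \<in> S n" for n q
    using ae that \<kappa>_pos[of n] W_pos[of q n] by (auto simp: AE_count_space)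
  obtain n q where x: "x = pt n q" "q \<in> S n" using assms by (rule X_cases)
  have "T f (pt n q) \<le> c"
  proof (rule T_le[OF x(2)])
    have "(\<integral>\<^sup>+x. ennreal \<bar>f x\<bar> \<partial>\<mu>) \<le> (\<integral>\<^sup>+x. c \<partial>\<mu>)"
      using le by (intro nn_integral_mono) (auto elim!: X_cases)
    then have "avg f \<le> c * 2 / 2" unfolding avg_def by (simp add: emeasure_X divide_right_mono_ennreal)
    then show "avg f \<le> c" by (simp add: ennreal_times_divide[symmetric] ennreal_divide_self)
    fix P assume P: "P \<in> \<B> n q"
    obtain A B where AB: "P = (A, B)" by (cases P)
    have sub: "A \<subseteq> S n" "A \<subseteq> B" "B \<subseteq> S n" "0 < sum (W n) B"
      using pairs_subset[OF x(2), of A B] P AB by (auto intro!: sum_W_pos)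
    show "ennreal (val n f P) \<le> c"
    proof (cases c)
      case (real c')
      have "\<bar>f (pt n q)\<bar> \<le> c'" if "q \<in> S n" for q
        using le[OF that] real by (simp add: ennreal_le_iff)
      then have "(\<Sum>q\<in>A. W n q * \<bar>f (pt n q)\<bar>) \<le> (\<Sum>q\<in>A. W n q * c')"
        using sub W_nonneg by (intro sum_mono mult_left_mono) auto
      also have "\<dots> \<le> (\<Sum>q\<in>B. W n q * c')"
        using sub W_nonneg real(1) finite_subset[OF sub(3)] by (intro sum_mono2) auto
      also have "\<dots> = c' * sum (W n) B" by (simp add: sum_distrib_left mult.commute)
      finally have "val n f P \<le> c'" using sub(4) by (simp add: AB val_def pos_divide_le_eq)
      then show ?thesis using real by (simp add: ennreal_leI)
    qed simp
  qed
  then show ?thesis using x by (simp add: c_def)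
qed

lemma strong_type_infinity: "strong_type \<mu> \<infinity> T"
  and weak_type_infinity: "weak_type \<mu> \<infinity> T"
proof -
  have "esssup \<mu> (T f) \<le> ennreal 1 * esssup \<mu> (\<lambda>x. ennreal \<bar>f x\<bar>)" for f
    using T_le_esssup[of _ f] by (auto intro!: esssup_I AE_I2)
  then show "strong_type \<mu> \<infinity> T" "weak_type \<mu> \<infinity> T"
    unfolding strong_type_def weak_type_def by (auto simp: Lp_norm_def weak_Lp_norm_def intro!: exI[of _ 1])
qed

end

end

section \<open>Families realizing prescribed exponents\<close>

type_synonym 'a weighted_space = "'a set \<times> ('a \<Rightarrow> 'a \<Rightarrow> real) \<times> ('a \<Rightarrow> real)"

definition strong_pc :: "real \<Rightarrow> real \<Rightarrow> 'a weighted_space \<Rightarrow> real \<Rightarrow> bool" where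
  "strong_pc k p = (\<lambda>(S, d, w). strong_const S w (centered_pairs S d k) p)"
definition strong_p :: "real \<Rightarrow> real \<Rightarrow> 'a weighted_space \<Rightarrow> real \<Rightarrow> bool" where
  "strong_p k p = (\<lambda>(S, d, w). strong_const S w (noncentered_pairs S d k) p)"
definition weak_pc :: "real \<Rightarrow> real \<Rightarrow> 'a weighted_space \<Rightarrow> real \<Rightarrow> bool" where
  "weak_pc k p = (\<lambda>(S, d, w). weak_const S w (centered_pairs S d k) p)"
definition weak_p :: "real \<Rightarrow> real \<Rightarrow> 'a weighted_space \<Rightarrow> real \<Rightarrow> bool" where
  "weak_p k p = (\<lambda>(S, d, w). weak_const S w (noncentered_pairs S d k) p)"

text \<open>Only finite exponents are tested: at \<open>\<infinity>\<close> both types hold on every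
  glued space, by \<open>strong_type_infinity\<close> and \<open>weak_type_infinity\<close>.\<close>

definition realizes ::
    "real \<Rightarrow> (nat \<Rightarrow> 'a weighted_space) \<Rightarrow> ereal set \<Rightarrow> ereal set \<Rightarrow> ereal set \<Rightarrow> ereal set \<Rightarrow> bool" where
  "realizes k F P_s_c P_s P_w_c P_w \<longleftrightarrow>
     (\<forall>n. case F n of (S, d, w) \<Rightarrow> finite_mms S d w) \<and>
     (\<forall>p\<ge>1.
       ((\<exists>C. \<forall>n. strong_pc k p (F n) C) \<longleftrightarrow> ereal p \<in> P_s_c) \<and>
       ((\<exists>C. \<forall>n. strong_p k p (F n) C) \<longleftrightarrow> ereal p \<in> P_s) \<and>
       ((\<exists>C. \<forall>n. weak_pc k p (F n) C) \<longleftrightarrow> ereal p \<in> P_w_c) \<and>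
       ((\<exists>C. \<forall>n. weak_p k p (F n) C) \<longleftrightarrow> ereal p \<in> P_w))"

definition interleave :: "(nat \<Rightarrow> 'b) \<Rightarrow> (nat \<Rightarrow> 'b) \<Rightarrow> nat \<Rightarrow> 'b" where
  "interleave F G n = (if even n then F (n div 2) else G (n div 2))"

lemma interleave_all: "(\<forall>n. P (interleave F G n)) \<longleftrightarrow> (\<forall>n. P (F n)) \<and> (\<forall>n. P (G n))"
proof (intro iffI conjI allI)
  assume *: "\<forall>n. P (interleave F G n)"
  show "P (F n)" for n using *[rule_format, of "2 * n"] by (simp add: interleave_def)
  show "P (G n)" for n using *[rule_format, of "2 * n + 1"] by (simp add: interleave_def)
qed (auto simp: interleave_def)

lemma interleave_ex_bound:
  fixes P :: "'b \<Rightarrow> real \<Rightarrow> bool"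
  assumes "\<And>n C C'. P (F n) C \<Longrightarrow> C \<le> C' \<Longrightarrow> P (F n) C'"
    and "\<And>n C C'. P (G n) C \<Longrightarrow> C \<le> C' \<Longrightarrow> P (G n) C'"
  shows "(\<exists>C. \<forall>n. P (interleave F G n) C) \<longleftrightarrow> (\<exists>C. \<forall>n. P (F n) C) \<and> (\<exists>C. \<forall>n. P (G n) C)"
proof
  assume "(\<exists>C. \<forall>n. P (F n) C) \<and> (\<exists>C. \<forall>n. P (G n) C)"
  then obtain C C' where *: "\<And>n. P (F n) C" "\<And>n. P (G n) C'" by blast
  have "P (F n) (max C C')" "P (G n) (max C C')" for n
    using assms(1)[OF *(1)] assms(2)[OF *(2)] by (metis max.cobounded1 max.cobounded2)+
  then show "\<exists>C. \<forall>n. P (interleave F G n) C"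
    unfolding interleave_all[of "\<lambda>x. P x _"] by blast
qed (auto simp: interleave_all[of "\<lambda>x. P x _"])

lemma realizes_interleave:
  assumes F: "realizes k F P_s_c P_s P_w_c P_w" and G: "realizes k G Q_s_c Q_s Q_w_c Q_w"
  shows "realizes k (interleave F G) (P_s_c \<inter> Q_s_c) (P_s \<inter> Q_s) (P_w_c \<inter> Q_w_c) (P_w \<inter> Q_w)"
proof -
  have mono: "strong_pc k p (H n) C \<Longrightarrow> C \<le> C' \<Longrightarrow> strong_pc k p (H n) C'"
    "strong_p k p (H n) C \<Longrightarrow> C \<le> C' \<Longrightarrow> strong_p k p (H n) C'"
    "weak_pc k p (H n) C \<Longrightarrow> C \<le> C' \<Longrightarrow> weak_pc k p (H n) C'"
    "weak_p k p (H n) C \<Longrightarrow> C \<le> C' \<Longrightarrow> weak_p k p (H n) C'"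
    if "realizes k H R1 R2 R3 R4" for H :: "nat \<Rightarrow> 'a weighted_space" and R1 R2 R3 R4 n p C C'
  proof -
    obtain S d w where H: "H n = (S, d, w)" by (cases "H n") auto
    have "case H n of (S, d, w) \<Rightarrow> finite_mms S d w" using that by (simp add: realizes_def)
    then have "\<And>x. x \<in> S \<Longrightarrow> 0 < w x" using H by (simp add: finite_mms_def)
    then show "strong_pc k p (H n) C \<Longrightarrow> C \<le> C' \<Longrightarrow> strong_pc k p (H n) C'"
      "strong_p k p (H n) C \<Longrightarrow> C \<le> C' \<Longrightarrow> strong_p k p (H n) C'"
      "weak_pc k p (H n) C \<Longrightarrow> C \<le> C' \<Longrightarrow> weak_pc k p (H n) C'"
      "weak_p k p (H n) C \<Longrightarrow> C \<le> C' \<Longrightarrow> weak_p k p (H n) C'"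
      using H by (auto simp: strong_pc_def strong_p_def weak_pc_def weak_p_def
          intro: strong_const_mono weak_const_mono)
  qed
  have bounds:
    "(\<exists>C. \<forall>n. strong_pc k p (interleave F G n) C) \<longleftrightarrow>
      (\<exists>C. \<forall>n. strong_pc k p (F n) C) \<and> (\<exists>C. \<forall>n. strong_pc k p (G n) C)"
    "(\<exists>C. \<forall>n. strong_p k p (interleave F G n) C) \<longleftrightarrow>
      (\<exists>C. \<forall>n. strong_p k p (F n) C) \<and> (\<exists>C. \<forall>n. strong_p k p (G n) C)"
    "(\<exists>C. \<forall>n. weak_pc k p (interleave F G n) C) \<longleftrightarrow>
      (\<exists>C. \<forall>n. weak_pc k p (F n) C) \<and> (\<exists>C. \<forall>n. weak_pc k p (G n) C)"
    "(\<exists>C. \<forall>n. weak_p k p (interleave F G n) C) \<longleftrightarrow>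
      (\<exists>C. \<forall>n. weak_p k p (F n) C) \<and> (\<exists>C. \<forall>n. weak_p k p (G n) C)"
    for p
    by (rule interleave_ex_bound; erule mono[OF F] mono[OF G], assumption)+
  show ?thesis
    using F G unfolding realizes_def bounds Int_iff
    by (simp add: interleave_all[of "case_prod (\<lambda>S. case_prod (finite_mms S))"])
qed

lemma realizesI:
  fixes F :: "nat \<Rightarrow> 'a weighted_space"
  assumes mms: "\<And>n. case F n of (S, d, w) \<Rightarrow> finite_mms S d w"
    and "\<And>p. 1 \<le> p \<Longrightarrow> ereal p \<in> P_s_c \<Longrightarrow> \<exists>C. \<forall>n. strong_pc k p (F n) C"
    and "\<And>p C. 1 \<le> p \<Longrightarrow> (\<And>n. strong_pc k p (F n) C) \<Longrightarrow> ereal p \<in> P_s_c"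
    and "\<And>p. 1 \<le> p \<Longrightarrow> ereal p \<in> P_s \<Longrightarrow> \<exists>C. \<forall>n. strong_p k p (F n) C"
    and "\<And>p C. 1 \<le> p \<Longrightarrow> (\<And>n. strong_p k p (F n) C) \<Longrightarrow> ereal p \<in> P_s"
    and "\<And>p. 1 \<le> p \<Longrightarrow> ereal p \<in> P_w_c \<Longrightarrow> \<exists>C. \<forall>n. weak_pc k p (F n) C"
    and "\<And>p C. 1 \<le> p \<Longrightarrow> (\<And>n. weak_pc k p (F n) C) \<Longrightarrow> ereal p \<in> P_w_c"
    and "\<And>p. 1 \<le> p \<Longrightarrow> ereal p \<in> P_w \<Longrightarrow> \<exists>C. \<forall>n. weak_p k p (F n) C"
    and "\<And>p C. 1 \<le> p \<Longrightarrow> (\<And>n. weak_p k p (F n) C) \<Longrightarrow> ereal p \<in> P_w"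
  shows "realizes k F P_s_c P_s P_w_c P_w"
  unfolding realizes_def using assms by blast

lemma finite_mms_implications:
  fixes F :: "'a weighted_space"
  assumes "case F of (S, d, w) \<Rightarrow> finite_mms S d w"
  shows "strong_p k p F C \<Longrightarrow> strong_pc k p F C" "weak_p k p F C \<Longrightarrow> weak_pc k p F C"
    "strong_p k p F C \<Longrightarrow> weak_p k p F C" "strong_pc k p F C \<Longrightarrow> weak_pc k p F C"
proof -
  obtain S d w where F: "F = (S, d, w)" by (cases F) auto
  have mms: "finite_mms S d w" using assms F by simp
  then have M: "Metric_space S d" by (simp add: finite_mms_def)
  have sub: "centered_pairs S d k x \<subseteq> noncentered_pairs S d k x" if "x \<in> S" for x
    using M that by (rule centered_subset_noncentered)
  show "strong_p k p F C \<Longrightarrow> strong_pc k p F C"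
    unfolding F strong_p_def strong_pc_def split by (erule strong_const_subset[OF _ sub])
  show "weak_p k p F C \<Longrightarrow> weak_pc k p F C"
    unfolding F weak_p_def weak_pc_def split by (erule weak_const_subset[OF _ sub])
  show "strong_p k p F C \<Longrightarrow> weak_p k p F C" "strong_pc k p F C \<Longrightarrow> weak_pc k p F C"
    unfolding F strong_p_def strong_pc_def weak_p_def weak_pc_def split
    using mms centered_pairs_ex noncentered_pairs_ex[OF M] by (auto simp: finite_mms_def intro!: strong_const_imp_weak_const)
qed

lemma uniform_implications:
  fixes F :: "nat \<Rightarrow> 'a weighted_space"
  assumes mms: "\<And>n. case F n of (S, d, w) \<Rightarrow> finite_mms S d w"
  shows "(\<exists>C. \<forall>n. strong_p k p (F n) C) \<Longrightarrow> \<exists>C. \<forall>n. strong_pc k p (F n) C"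
    and "(\<exists>C. \<forall>n. weak_p k p (F n) C) \<Longrightarrow> \<exists>C. \<forall>n. weak_pc k p (F n) C"
    and "(\<exists>C. \<forall>n. strong_p k p (F n) C) \<Longrightarrow> \<exists>C. \<forall>n. weak_p k p (F n) C"
    and "(\<exists>C. \<forall>n. strong_pc k p (F n) C) \<Longrightarrow> \<exists>C. \<forall>n. weak_pc k p (F n) C"
  by (elim exE, intro exI allI, rule finite_mms_implications[OF mms], erule spec)+

text \<open>For star spaces the maximal inequalities come down to these two conditions on the masses.\<close>

definition mass_exponents :: "(nat \<Rightarrow> nat) \<Rightarrow> (nat \<Rightarrow> nat \<Rightarrow> real) \<Rightarrow> ereal set \<Rightarrow> ereal set \<Rightarrow> bool" where
  "mass_exponents N m P_s P_w \<longleftrightarrow> (\<forall>n i. 1 \<le> m n i) \<and> (\<forall>p\<ge>1.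
     ((\<exists>C. \<forall>n. (\<Sum>i=1..N n. m n i powr (1 - p)) \<le> C) \<longleftrightarrow> ereal p \<in> P_s) \<and>
     ((\<exists>C. \<forall>n. \<forall>T>0. (\<Sum>i | i \<in> {1..N n} \<and> m n i \<le> T. m n i) \<le> C * T powr p) \<longleftrightarrow> ereal p \<in> P_w))"

definition star_space :: "bool \<Rightarrow> (nat \<Rightarrow> nat) \<Rightarrow> (nat \<Rightarrow> nat \<Rightarrow> real) \<Rightarrow> nat \<Rightarrow> (nat + nat) weighted_space" where
  "star_space b N m n =
     (hub_points (N n), hub_dist (\<lambda>i. if i = 0 then 0 else 1), hub_weight b (m n))"

text \<open>Normalised so that the longest branch has length 1, in accordance with the diameter
  bound; what matters is the ratio \<sigma> of consecutive lengths.\<close>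

definition chain_space :: "real \<Rightarrow> nat \<Rightarrow> (nat + nat) weighted_space" where
  "chain_space \<sigma> n =
     (hub_points n, hub_dist (\<lambda>i. if i = 0 then 0 else \<sigma> powr (real i - real n)),
      hub_weight False (\<lambda>i. 4 ^ (i * i)))"

lemma star_locale: "(\<And>i. 1 \<le> m n i) \<Longrightarrow> star (N n) (\<lambda>i. if i = 0 then 0 else 1) (m n)"
  by unfold_locales auto

lemma star_upper_bounds:
  assumes m: "\<And>n i. 1 \<le> m n i" and k: "1 \<le> k" and p: "1 \<le> p"
  shows "(\<And>n. (\<Sum>i=1..N n. m n i powr (1 - p)) \<le> C) \<Longrightarrow> \<exists>C. \<forall>n. strong_p k p (star_space b N m n) C"
    and "(\<And>n T. 0 < T \<Longrightarrow> (\<Sum>i | i \<in> {1..N n} \<and> m n i \<le> T. m n i) \<le> C * T powr p) \<Longrightarrow>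
      \<exists>C. \<forall>n. weak_p k p (star_space b N m n) C"
proof -
  assume C: "\<And>n. (\<Sum>i=1..N n. m n i powr (1 - p)) \<le> C"
  have "strong_p k p (star_space b N m n) (8 * 2 powr p + (2 powr p + 8 powr p * C))" for n
  proof -
    interpret star "N n" "\<lambda>i. if i = 0 then 0 else 1" "m n" b using m by (rule star_locale)
    show ?thesis unfolding strong_p_def star_space_def split
      by (rule strong_const_mono[OF _ _ star_strong_const[OF p k]])
        (use C[of n] in \<open>auto intro: mult_left_mono w_pos\<close>)
  qed
  then show "\<exists>C. \<forall>n. strong_p k p (star_space b N m n) C" by blast
next
  assume C: "\<And>n T. 0 < T \<Longrightarrow> (\<Sum>i | i \<in> {1..N n} \<and> m n i \<le> T. m n i) \<le> C * T powr p"
  have C': "(\<Sum>i | i \<in> {1..N n} \<and> m n i \<le> T. m n i) \<le> max 0 C * T powr p" if "0 < T" for n T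
    by (rule order_trans[OF C[OF that]]) (auto intro: mult_right_mono)
  have "weak_p k p (star_space b N m n) (8 * 2 powr p + (2 powr p + 8 powr p * max 0 C))" for n
  proof -
    interpret star "N n" "\<lambda>i. if i = 0 then 0 else 1" "m n" b using m by (rule star_locale)
    show ?thesis unfolding weak_p_def star_space_def split
      using C' by (intro star_weak_const[OF p k]) auto
  qed
  then show "\<exists>C. \<forall>n. weak_p k p (star_space b N m n) C" by blast
qed

lemma star_mms: "(\<And>n i. 1 \<le> m n i) \<Longrightarrow> case star_space b N m n of (S, d, w) \<Rightarrow> finite_mms S d w"
  unfolding star_space_def split by (rule hub.finite_mms[OF star.axioms(1)[OF star_locale]])

lemma star_upper:
  assumes M: "mass_exponents N m P_s P_w" and k: "1 \<le> k" and p: "1 \<le> p"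
  shows "ereal p \<in> P_s \<Longrightarrow> \<exists>C. \<forall>n. strong_p k p (star_space b N m n) C"
    and "ereal p \<in> P_w \<Longrightarrow> \<exists>C. \<forall>n. weak_p k p (star_space b N m n) C"
proof -
  have m: "1 \<le> m n i" for n i using M by (simp add: mass_exponents_def)
  show "\<exists>C. \<forall>n. strong_p k p (star_space b N m n) C" if P: "ereal p \<in> P_s"
  proof -
    obtain C where "\<And>n. (\<Sum>i=1..N n. m n i powr (1 - p)) \<le> C"
      using M P p unfolding mass_exponents_def by blast
    with m k p show ?thesis by (rule star_upper_bounds(1))
  qed
  show "\<exists>C. \<forall>n. weak_p k p (star_space b N m n) C" if P: "ereal p \<in> P_w"
  proof -
    obtain C where "\<And>n T. 0 < T \<Longrightarrow> (\<Sum>i | i \<in> {1..N n} \<and> m n i \<le> T. m n i) \<le> C * T powr p"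
      using M P p unfolding mass_exponents_def by blast
    with m k p show ?thesis by (rule star_upper_bounds(2))
  qed
qed

text \<open>The pairs stay arbitrary, because the critical balls are centered ones when the z_i are
  heavy and non-centered ones when the x_i are heavy.\<close>

lemma star_lower:
  assumes M: "mass_exponents N m P_s P_w" and p: "1 \<le> p"
    and ex: "\<And>n q. q \<in> hub_points (N n) \<Longrightarrow> \<exists>(B, B')\<in>\<B> n q. B \<subseteq> hub_points (N n)"
    and heavy: "\<And>n i. i \<in> {1..N n} \<Longrightarrow> \<exists>(B, B')\<in>\<B> n (hub_heavy b i).
      hub_center \<in> B \<and> B \<subseteq> hub_points (N n) \<and> sum (hub_weight b (m n)) B' \<le> 4 * m n i"
  shows "(\<And>n. strong_const (hub_points (N n)) (hub_weight b (m n)) (\<B> n) p C) \<Longrightarrow> ereal p \<in> P_s"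
    and "(\<And>n. weak_const (hub_points (N n)) (hub_weight b (m n)) (\<B> n) p C) \<Longrightarrow> ereal p \<in> P_w"
proof -
  have m: "1 \<le> m n i" for n i using M by (simp add: mass_exponents_def)
  have "star (N n) (\<lambda>i. if i = 0 then 0 else 1) (m n)" for n using m by (rule star_locale)
  note hub = star.axioms(1)[OF this]
  have "(\<Sum>i=1..N n. m n i powr (1 - p)) \<le> 4 powr p * C"
    if "strong_const (hub_points (N n)) (hub_weight b (m n)) (\<B> n) p C" for n
    using that heavy ex p by (rule hub.strong_const_imp_sum_le[OF hub])
  then show "(\<And>n. strong_const (hub_points (N n)) (hub_weight b (m n)) (\<B> n) p C) \<Longrightarrow> ereal p \<in> P_s"
    using M p unfolding mass_exponents_def by blast
  have "(\<Sum>i | i \<in> {1..N n} \<and> m n i \<le> T. m n i) \<le> 8 powr p * C * T powr p"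
    if "weak_const (hub_points (N n)) (hub_weight b (m n)) (\<B> n) p C" "0 < T" for n T
    using that(1) heavy that(2) by (rule hub.weak_const_imp_sum_le[OF hub])
  then show "(\<And>n. weak_const (hub_points (N n)) (hub_weight b (m n)) (\<B> n) p C) \<Longrightarrow> ereal p \<in> P_w"
    using M p unfolding mass_exponents_def by blast
qed

text \<open>Upper bounds are known for the non-centered operator and lower bounds for the centered
  one. The former dominates the latter, so the conditions for both coincide.\<close>

lemma star_heavy_light:
  assumes M: "mass_exponents N m P_s P_w" and k: "1 \<le> k" "k < 2"
  shows "realizes k (star_space True N m) P_s P_s P_w P_w"
proof (rule realizesI)
  have m: "\<And>n i. 1 \<le> m n i" using M by (simp add: mass_exponents_def)
  note mms = star_mms[OF m, where b = True and N = N]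
  show "case star_space True N m n of (S, d, w) \<Rightarrow> finite_mms S d w" for n by (rule mms)
  fix p :: real assume p: "1 \<le> p"
  show s: "\<exists>C. \<forall>n. strong_p k p (star_space True N m n) C" if "ereal p \<in> P_s"
    using M k(1) p that by (rule star_upper(1))
  show "\<exists>C. \<forall>n. strong_pc k p (star_space True N m n) C" if "ereal p \<in> P_s"
    using s[OF that] by (rule uniform_implications(1)[OF mms])
  show w: "\<exists>C. \<forall>n. weak_p k p (star_space True N m n) C" if "ereal p \<in> P_w"
    using M k(1) p that by (rule star_upper(2))
  show "\<exists>C. \<forall>n. weak_pc k p (star_space True N m n) C" if "ereal p \<in> P_w"
    using w[OF that] by (rule uniform_implications(2)[OF mms])
  fix C :: real
  have star: "star (N n) (\<lambda>i. if i = 0 then 0 else 1) (m n)" for n using m by (rule star_locale)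
  note lower = star_lower[where b = True and \<B> = "\<lambda>n. centered_pairs (hub_points (N n)) (hub_dist (\<lambda>i. if i = 0 then 0 else 1)) k",
      OF M p centered_pairs_ex star.centered_star_pair[OF star TrueI k]]
  have s: "ereal p \<in> P_s" if "\<And>n. strong_pc k p (star_space True N m n) C"
    by (rule lower(1)[where C = C]) (use that in \<open>simp_all add: strong_pc_def star_space_def\<close>)
  then show "(\<And>n. strong_pc k p (star_space True N m n) C) \<Longrightarrow> ereal p \<in> P_s" .
  show "ereal p \<in> P_s" if "\<And>n. strong_p k p (star_space True N m n) C"
    by (rule s, rule finite_mms_implications(1)[OF mms that])
  have w: "ereal p \<in> P_w" if "\<And>n. weak_pc k p (star_space True N m n) C"
    by (rule lower(2)[where C = C]) (use that in \<open>simp_all add: weak_pc_def star_space_def\<close>)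
  then show "(\<And>n. weak_pc k p (star_space True N m n) C) \<Longrightarrow> ereal p \<in> P_w" .
  show "ereal p \<in> P_w" if "\<And>n. weak_p k p (star_space True N m n) C"
    by (rule w, rule finite_mms_implications(2)[OF mms that])
qed

lemma star_light_heavy:
  assumes M: "mass_exponents N m P_s P_w" and k: "1 \<le> k" "k < 3"
  shows "realizes k (star_space False N m) {1..} P_s {1..} P_w"
proof (rule realizesI)
  have m: "\<And>n i. 1 \<le> m n i" using M by (simp add: mass_exponents_def)
  note mms = star_mms[OF m, where b = False and N = N]
  show "case star_space False N m n of (S, d, w) \<Rightarrow> finite_mms S d w" for n by (rule mms)
  fix p :: real assume p: "1 \<le> p"
  show "ereal p \<in> P_s \<Longrightarrow> \<exists>C. \<forall>n. strong_p k p (star_space False N m n) C"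
    using M k(1) p by (rule star_upper(1))
  show "ereal p \<in> P_w \<Longrightarrow> \<exists>C. \<forall>n. weak_p k p (star_space False N m n) C"
    using M k(1) p by (rule star_upper(2))
  have "strong_pc k p (star_space False N m n) (8 * 2 powr p)" for n
  proof -
    interpret star "N n" "\<lambda>i. if i = 0 then 0 else 1" "m n" False using m by (rule star_locale)
    show ?thesis unfolding strong_pc_def star_space_def split
      using centered_star_strong_const p k by simp
  qed
  then show s: "\<exists>C. \<forall>n. strong_pc k p (star_space False N m n) C" by blast
  then show "\<exists>C. \<forall>n. weak_pc k p (star_space False N m n) C"
    by (rule uniform_implications(4)[OF mms])
  show "ereal p \<in> {1..}" "ereal p \<in> {1..}" using p by auto
  fix C :: real
  have star: "star (N n) (\<lambda>i. if i = 0 then 0 else 1) (m n)" for n using m by (rule star_locale)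
  have M': "Metric_space (hub_points (N n)) (hub_dist (\<lambda>i. if i = 0 then 0 else 1))" for n
    by (rule hub.metric[OF star.axioms(1)[OF star]])
  have "\<not> False" by simp
  note heavy = star.noncentered_star_pair[OF star this k]
  note lower = star_lower[where b = False and \<B> = "\<lambda>n. noncentered_pairs (hub_points (N n)) (hub_dist (\<lambda>i. if i = 0 then 0 else 1)) k",
      OF M p noncentered_pairs_ex[OF M'] heavy]
  show "ereal p \<in> P_s" if "\<And>n. strong_p k p (star_space False N m n) C"
    by (rule lower(1)[where C = C]) (use that in \<open>simp_all add: strong_p_def star_space_def\<close>)
  show "ereal p \<in> P_w" if "\<And>n. weak_p k p (star_space False N m n) C"
    by (rule lower(2)[where C = C]) (use that in \<open>simp_all add: weak_p_def star_space_def\<close>)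
qed

lemma chain_locale:
  assumes "1 \<le> \<sigma>"
  shows "chain n (\<lambda>i. if i = 0 then 0 else \<sigma> powr (real i - real n)) (\<lambda>i. 4 ^ (i * i))"
proof unfold_locales
  show "(if i = 0 then 0 else \<sigma> powr (real i - real n)) \<le> 1" if "i \<le> n" for i
  proof -
    have "\<sigma> powr (real i - real n) \<le> \<sigma> powr 0" using that assms by (intro powr_mono) auto
    then show ?thesis using assms by simp
  qed
qed (use assms in auto)

lemma chain_upper:
  assumes \<sigma>: "1 \<le> \<sigma>" and k: "1 \<le> k" and p: "1 \<le> p"
  shows "1 < p \<Longrightarrow> \<exists>C. \<forall>n. strong_p k p (chain_space \<sigma> n) C"
    and "\<exists>C. \<forall>n. weak_p k p (chain_space \<sigma> n) C"
    and "case chain_space \<sigma> n of (S, d, w) \<Rightarrow> finite_mms S d w"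
proof -
  show mms: "case chain_space \<sigma> n of (S, d, w) \<Rightarrow> finite_mms S d w" for n
    unfolding chain_space_def split by (rule hub.finite_mms[OF chain.axioms(1)[OF chain_locale[OF \<sigma>]]])
  have *: "\<exists>C. \<forall>n. strong_p k p (chain_space \<sigma> n) C" if "1 < p"
  proof (intro exI allI)
    fix n
    interpret chain n "\<lambda>i. if i = 0 then 0 else \<sigma> powr (real i - real n)" "\<lambda>i. 4 ^ (i * i)" False
      using \<sigma> by (rule chain_locale)
    show "strong_p k p (chain_space \<sigma> n)
        (8 * 2 powr p + 2 * (2 powr p * (1 + 2 powr p * (1 / (1 - 16 powr (1 - p))))))"
      unfolding strong_p_def chain_space_def split using that k by (rule chain_strong_const)
  qed
  then show "1 < p \<Longrightarrow> \<exists>C. \<forall>n. strong_p k p (chain_space \<sigma> n) C" .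
  show "\<exists>C. \<forall>n. weak_p k p (chain_space \<sigma> n) C"
  proof (cases "p = 1")
    case True
    have "weak_p k p (chain_space \<sigma> n) 24" for n
    proof -
      interpret chain n "\<lambda>i. if i = 0 then 0 else \<sigma> powr (real i - real n)" "\<lambda>i. 4 ^ (i * i)" False
        using \<sigma> by (rule chain_locale)
      show ?thesis unfolding weak_p_def chain_space_def split True using k by (rule chain_weak_const)
    qed
    then show ?thesis by blast
  next
    case False
    then have "1 < p" using p by simp
    from *[OF this] show ?thesis by (rule uniform_implications(3)[OF mms])
  qed
qed

lemma chain_step:
  assumes "1 \<le> \<sigma>" "i < j" "1 \<le> i"
  shows "\<sigma> * \<sigma> powr (real i - real n) \<le> \<sigma> powr (real j - real n)"
proof -
  have "\<sigma> * \<sigma> powr (real i - real n) = \<sigma> powr (1 + (real i - real n))"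
    using assms by (simp add: powr_add)
  also have "\<dots> \<le> \<sigma> powr (real j - real n)" using assms by (intro powr_mono) auto
  finally show ?thesis .
qed

lemma not_all_nat_le: "\<not> (\<forall>n. real n \<le> c)"
  by (meson not_le reals_Archimedean2)

text \<open>At p = 1 every summand m_i^(1-p) equals 1, so the test on the center would give n \<le>
  4 C for all n.\<close>

lemma chain_lower:
  fixes \<sigma> :: real
  assumes \<sigma>: "1 \<le> \<sigma>" and p: "1 \<le> p"
    and ex: "\<And>n q. q \<in> hub_points n \<Longrightarrow> \<exists>(B, B')\<in>\<B> n q. B \<subseteq> hub_points n"
    and heavy: "\<And>n i. i \<in> {1..n} \<Longrightarrow> \<exists>(B, B')\<in>\<B> n (hub_heavy False i).
      hub_center \<in> B \<and> B \<subseteq> hub_points n \<and> sum (hub_weight False (\<lambda>i. 4 ^ (i * i))) B' \<le> 4 * 4 ^ (i * i)"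
    and C: "\<And>n. strong_const (hub_points n) (hub_weight False (\<lambda>i. 4 ^ (i * i))) (\<B> n) p C"
  shows "ereal p \<in> {1<..}"
proof (rule ccontr)
  assume "ereal p \<notin> {1<..}"
  then have p1: "p = 1" using p by (simp add: one_ereal_def)
  have "real n \<le> 4 powr 1 * C" for n
  proof -
    have "(\<Sum>i=1..n. (4 ^ (i * i)) powr (1 - p)) \<le> 4 powr p * C"
      using C heavy ex p
      by (rule hub.strong_const_imp_sum_le[OF chain.axioms(1)[OF chain_locale[OF \<sigma>]]])
    then show ?thesis by (simp add: p1)
  qed
  then show False using not_all_nat_le by blast
qed

text \<open>With ratio 2 k even a ball around x_i can take in the center while its enlargement stops
  before x_(i+1); both operators are damaged.\<close>

lemma chain_coarse:
  assumes k: "1 \<le> k"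
  shows "realizes k (chain_space (2 * k)) {1<..} {1<..} {1..} {1..}"
proof (rule realizesI)
  have \<sigma>: "1 \<le> 2 * k" using k by simp
  note mms = chain_upper(3)[OF \<sigma> k order_refl]
  show "case chain_space (2 * k) n of (S, d, w) \<Rightarrow> finite_mms S d w" for n by (rule mms)
  fix p :: real assume p: "1 \<le> p"
  show s: "\<exists>C. \<forall>n. strong_p k p (chain_space (2 * k) n) C" if "ereal p \<in> {1<..}"
    using that by (intro chain_upper(1)[OF \<sigma> k p]) (simp add: one_ereal_def)
  show "\<exists>C. \<forall>n. strong_pc k p (chain_space (2 * k) n) C" if "ereal p \<in> {1<..}"
    using s[OF that] by (rule uniform_implications(1)[OF mms])
  show w: "\<exists>C. \<forall>n. weak_p k p (chain_space (2 * k) n) C" by (rule chain_upper(2)[OF \<sigma> k p])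
  then show "\<exists>C. \<forall>n. weak_pc k p (chain_space (2 * k) n) C"
    by (rule uniform_implications(2)[OF mms])
  show "ereal p \<in> {1..}" "ereal p \<in> {1..}" using p by auto
  fix C :: real
  have lower: "ereal p \<in> {1<..}" if C: "\<And>n. strong_pc k p (chain_space (2 * k) n) C"
    using \<sigma> p centered_pairs_ex _ C[unfolded strong_pc_def chain_space_def split]
  proof (rule chain_lower)
    fix n i :: nat assume i: "i \<in> {1..n}"
    interpret chain n "\<lambda>i. if i = 0 then 0 else (2 * k) powr (real i - real n)" "\<lambda>i. 4 ^ (i * i)" False
      using \<sigma> by (rule chain_locale)
    show "\<exists>(B, B')\<in>centered_pairs S d k (h i). a \<in> B \<and> B \<subseteq> S \<and> sum w B' \<le> 4 * 4 ^ (i * i)"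
      using chain_step[OF \<sigma>, of i _ n] i k by (intro centered_chain_pair) auto
  qed
  then show "(\<And>n. strong_pc k p (chain_space (2 * k) n) C) \<Longrightarrow> ereal p \<in> {1<..}" .
  show "ereal p \<in> {1<..}" if "\<And>n. strong_p k p (chain_space (2 * k) n) C"
    by (rule lower, rule finite_mms_implications(1)[OF mms that])
qed

text \<open>With ratio k the enlargement of a centered ball that reaches the center always catches
  the next heavy point, whereas balls around midpoints can still avoid it. For k = 1 all branches
  have length 1 and the chain degenerates to a star.\<close>

lemma chain_fine:
  assumes k: "1 \<le> k"
  shows "realizes k (chain_space k) {1..} {1<..} {1..} {1..}"
proof (rule realizesI)
  note mms = chain_upper(3)[OF k k order_refl]
  show "case chain_space k n of (S, d, w) \<Rightarrow> finite_mms S d w" for n by (rule mms)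
  fix p :: real assume p: "1 \<le> p"
  show "ereal p \<in> {1<..} \<Longrightarrow> \<exists>C. \<forall>n. strong_p k p (chain_space k n) C"
    using chain_upper(1)[OF k k p] by (simp add: one_ereal_def)
  show w: "\<exists>C. \<forall>n. weak_p k p (chain_space k n) C" by (rule chain_upper(2)[OF k k p])
  then show "\<exists>C. \<forall>n. weak_pc k p (chain_space k n) C"
    by (rule uniform_implications(2)[OF mms])
  have "strong_pc k p (chain_space k n) (10 * 2 powr p)" for n
  proof -
    interpret chain n "\<lambda>i. if i = 0 then 0 else k powr (real i - real n)" "\<lambda>i. 4 ^ (i * i)" False
      using k by (rule chain_locale)
    have "k powr (1 + (real i - real n)) = k * k powr (real i - real n)" for i
      using k by (simp add: powr_add)
    then show ?thesis unfolding strong_pc_def chain_space_def split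
      using p k by (intro centered_chain_strong_const) (auto simp: algebra_simps)
  qed
  then show "\<exists>C. \<forall>n. strong_pc k p (chain_space k n) C" by blast
  show "ereal p \<in> {1..}" "ereal p \<in> {1..}" "ereal p \<in> {1..}" using p by auto
  fix C :: real
  have M: "Metric_space (hub_points n) (hub_dist (\<lambda>i. if i = 0 then 0 else k powr (real i - real n)))" for n
    by (rule hub.metric[OF chain.axioms(1)[OF chain_locale[OF k]]])
  show "ereal p \<in> {1<..}" if C: "\<And>n. strong_p k p (chain_space k n) C"
    using k p noncentered_pairs_ex[OF M] _ C[unfolded strong_p_def chain_space_def split]
  proof (rule chain_lower)
    fix n i :: nat assume i: "i \<in> {1..n}"
    interpret chain n "\<lambda>i. if i = 0 then 0 else k powr (real i - real n)" "\<lambda>i. 4 ^ (i * i)" False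
      using k by (rule chain_locale)
    show "\<exists>(B, B')\<in>noncentered_pairs S d k (h i). a \<in> B \<and> B \<subseteq> S \<and> sum w B' \<le> 4 * 4 ^ (i * i)"
      using chain_step[OF k, of i _ n] i k by (intro noncentered_chain_pair[of k k]) auto
  qed
qed

text \<open>One heavy point per space contributes at most 1 to the mass sum however heavy it is. The
  family serves as a neutral element for \<open>interleave\<close>, and its unbounded mass destroys
  doubling.\<close>

lemma trivial_realizes:
  assumes k: "1 \<le> k"
  shows "realizes k (star_space True (\<lambda>_. 1) (\<lambda>n _. real n + 1)) {1..} {1..} {1..} {1..}"
proof -
  let ?F = "star_space True (\<lambda>_. 1) (\<lambda>n _. real n + 1)"
  note mms = star_mms[of "\<lambda>n _. real n + 1" True "\<lambda>_. 1"]
  have mms: "case ?F n of (S, d, w) \<Rightarrow> finite_mms S d w" for n by (rule mms) simp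
  have s: "\<exists>C. \<forall>n. strong_p k p (?F n) C" if p: "1 \<le> p" for p
  proof (rule star_upper_bounds(1)[OF _ k p])
    show "(\<Sum>i=1..(1::nat). (real n + 1) powr (1 - p)) \<le> 1" for n
      using powr_mono[of "1 - p" 0 "real n + 1"] p by simp
  qed simp
  note c = uniform_implications(1)[OF mms s] and w = uniform_implications(3)[OF mms s]
  note wc = uniform_implications(2)[OF mms w]
  show ?thesis unfolding realizes_def using mms s c w wc by simp
qed

section \<open>Prescribing the masses\<close>

lemma not_power_bounded:
  fixes x :: real
  assumes "1 < x"
  shows "\<not> (\<forall>n. x ^ n \<le> C)"
proof
  assume *: "\<forall>n. x ^ n \<le> C"
  have "real n \<le> (C - 1) / (x - 1)" for n
    using Bernoulli_inequality[of "x - 1" n] *[rule_format, of n] assms by (simp add: pos_le_divide_eq)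
  then show False using not_all_nat_le by blast
qed

text \<open>If all masses of the n-th star equal 2^n, the weak condition is decided at T = 2^n,
  where it says the same as the strong one: the number of points times (2^n)^(1-p) stays bounded.
  Rounding \<open>a n\<close> up costs at most 1 in the constant.\<close>

lemma single_scale:
  assumes a: "\<And>n. 0 \<le> a n"
    and P: "\<And>p. 1 \<le> p \<Longrightarrow> (\<exists>C. \<forall>n. a n * (2 ^ n) powr (1 - p) \<le> C) \<longleftrightarrow> ereal p \<in> P"
  shows "mass_exponents (\<lambda>n. nat \<lceil>a n\<rceil>) (\<lambda>n _. 2 ^ n) P P"
proof -
  define N where "N n = nat \<lceil>a n\<rceil>" for n
  have N: "a n \<le> real (N n)" "real (N n) \<le> a n + 1" for n
    using a[of n] ceiling_correct[of "a n"] by (auto simp: N_def)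
  have iff: "(\<exists>C. \<forall>n. real (N n) * (2 ^ n) powr (1 - p) \<le> C) \<longleftrightarrow> ereal p \<in> P" if p: "1 \<le> p" for p
  proof -
    have "\<exists>C. \<forall>n. a n * (2 ^ n) powr (1 - p) \<le> C"
      if C: "\<forall>n. real (N n) * (2 ^ n) powr (1 - p) \<le> C" for C
    proof (intro exI allI)
      fix n
      have "a n * (2 ^ n) powr (1 - p) \<le> real (N n) * (2 ^ n) powr (1 - p)"
        using N by (intro mult_right_mono) auto
      then show "a n * (2 ^ n) powr (1 - p) \<le> C" using C[rule_format, of n] by linarith
    qed
    moreover have "\<exists>C. \<forall>n. real (N n) * (2 ^ n) powr (1 - p) \<le> C"
      if C: "\<forall>n. a n * (2 ^ n) powr (1 - p) \<le> C" for C
    proof (intro exI allI)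
      fix n
      have "real (N n) * (2 ^ n) powr (1 - p) \<le> (a n + 1) * (2 ^ n) powr (1 - p)"
        using N by (intro mult_right_mono) auto
      moreover have "(2 ^ n) powr (1 - p) \<le> (2 ^ n :: real) powr 0" using p by (intro powr_mono) auto
      ultimately show "real (N n) * (2 ^ n) powr (1 - p) \<le> C + 1"
        using C[rule_format, of n] by (simp add: distrib_right)
    qed
    ultimately show ?thesis using P[OF p] by blast
  qed
  have sum: "(\<Sum>i | i \<in> {1..N n} \<and> 2 ^ n \<le> T. 2 ^ n) = (if 2 ^ n \<le> T then real (N n) * 2 ^ n else 0)"
    for n and T :: real
  proof -
    have "{i. i \<in> {1..N n} \<and> 2 ^ n \<le> T} = (if 2 ^ n \<le> T then {1..N n} else {})" by auto
    then show ?thesis by simp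
  qed
  have "(\<exists>C. \<forall>n. \<forall>T>0. (\<Sum>i | i \<in> {1..N n} \<and> 2 ^ n \<le> T. 2 ^ n) \<le> C * T powr p) \<longleftrightarrow> ereal p \<in> P"
    if p: "1 \<le> p" for p
  proof
    assume "ereal p \<in> P"
    then obtain C where C: "\<And>n. real (N n) * (2 ^ n) powr (1 - p) \<le> C" using iff[OF p] by blast
    have C0: "0 \<le> C" using C[of 0] by (meson mult_nonneg_nonneg of_nat_0_le_iff order_trans powr_ge_zero)
    have "(\<Sum>i | i \<in> {1..N n} \<and> 2 ^ n \<le> T. 2 ^ n) \<le> C * T powr p" if T: "0 < T" for n T
    proof (cases "2 ^ n \<le> T")
      case True
      have "real (N n) * 2 ^ n = (real (N n) * (2 ^ n) powr (1 - p)) * (2 ^ n) powr p"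
        by (simp add: mult.assoc flip: powr_add)
      also have "\<dots> \<le> C * T powr p"
        using C C0 True p by (intro mult_mono powr_mono2) auto
      finally show ?thesis unfolding sum using True by simp
    qed (use C0 in \<open>simp add: sum\<close>)
    then show "\<exists>C. \<forall>n. \<forall>T>0. (\<Sum>i | i \<in> {1..N n} \<and> 2 ^ n \<le> T. 2 ^ n) \<le> C * T powr p" by blast
  next
    assume "\<exists>C. \<forall>n. \<forall>T>0. (\<Sum>i | i \<in> {1..N n} \<and> 2 ^ n \<le> T. 2 ^ n) \<le> C * T powr p"
    then obtain C where C: "\<And>n T. 0 < T \<Longrightarrow> (\<Sum>i | i \<in> {1..N n} \<and> 2 ^ n \<le> T. 2 ^ n) \<le> C * T powr p"
      by blast
    have "real (N n) * (2 ^ n) powr (1 - p) \<le> C" for n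
    proof -
      have "real (N n) * 2 ^ n \<le> C * (2 ^ n) powr p" using C[of "2 ^ n" n] unfolding sum by simp
      then have "real (N n) * 2 ^ n * (2 ^ n) powr (- p) \<le> C * (2 ^ n) powr p * (2 ^ n) powr (- p)"
        by (intro mult_right_mono) auto
      then show ?thesis by (simp add: mult.assoc powr_minus powr_diff divide_inverse)
    qed
    then show "ereal p \<in> P" using iff[OF p] by blast
  qed
  then show ?thesis using iff unfolding mass_exponents_def N_def[symmetric] by simp
qed

lemma power_powr: "0 < x \<Longrightarrow> (x ^ n) powr a = (x powr a) ^ n" for x :: real
  by (simp add: powr_powr mult.commute flip: powr_realpow)

text \<open>About 2^(n (p0 - 1)) points turn the criterion into boundedness of 2^(n (p0 -
  p)).\<close>

lemma single_scale_closed: "\<exists>N m. mass_exponents N m {ereal p0..} {ereal p0..}"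
proof (intro exI, rule single_scale)
  show "0 \<le> (2 ^ n :: real) powr (p0 - 1)" for n by simp
  fix p :: real assume "1 \<le> p"
  have eq: "(2 ^ n) powr (p0 - 1) * (2 ^ n) powr (1 - p) = (2 powr (p0 - p)) ^ n" for n
    by (subst power_powr[symmetric]) (simp_all flip: powr_add)
  have "(2 powr (p0 - p)) ^ n \<le> (1::real)" if "p0 \<le> p" for n
    using powr_mono[of "p0 - p" 0 2] that by (intro power_le_one) auto
  moreover have "\<not> (\<forall>n. (2 powr (p0 - p)) ^ n \<le> C)" if "\<not> p0 \<le> p" for C :: real
    using that by (intro not_power_bounded) simp
  ultimately show "(\<exists>C. \<forall>n. (2 ^ n) powr (p0 - 1) * (2 ^ n) powr (1 - p) \<le> C) \<longleftrightarrow> ereal p \<in> {ereal p0..}"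
    unfolding eq by auto
qed

text \<open>An additional factor n spoils boundedness at p = p0 and is absorbed by the geometric
  decay for p > p0.\<close>

lemma single_scale_open: "\<exists>N m. mass_exponents N m {ereal p0<..} {ereal p0<..}"
proof (intro exI, rule single_scale)
  show "0 \<le> real n * (2 ^ n :: real) powr (p0 - 1)" for n by simp
  fix p :: real assume "1 \<le> p"
  have eq: "real n * (2 ^ n) powr (p0 - 1) * (2 ^ n) powr (1 - p) = real n * (2 powr (p0 - p)) ^ n" for n
    by (subst power_powr[symmetric]) (simp_all add: mult.assoc flip: powr_add)
  have "\<exists>C. \<forall>n. real n * (2 powr (p0 - p)) ^ n \<le> C" if "p0 < p"
  proof (intro exI allI)
    fix n
    define e where "e = 2 powr (p - p0) - (1::real)"
    have e: "0 < e" using that by (simp add: e_def)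
    have "1 + real n * e \<le> (1 + e) ^ n" using e by (intro Bernoulli_inequality) simp
    then have "real n * e \<le> (1 + e) ^ n" by simp
    moreover have r: "(2 powr (p0 - p)) ^ n = 1 / (1 + e) ^ n"
      by (simp add: e_def powr_diff power_divide)
    moreover have "0 < (1 + e) ^ n" using e by simp
    ultimately show "real n * (2 powr (p0 - p)) ^ n \<le> 1 / e"
      unfolding r using e by (simp add: pos_divide_le_eq pos_le_divide_eq)
  qed
  moreover have False if "\<not> p0 < p" "\<forall>n. real n * (2 powr (p0 - p)) ^ n \<le> C" for C
  proof -
    have "real n \<le> C" for n
    proof -
      have "1 \<le> (2 powr (p0 - p) :: real)" using that(1) by (simp add: ge_one_powr_ge_zero)
      then have "real n * 1 \<le> real n * (2 powr (p0 - p)) ^ n" by (intro mult_left_mono one_le_power) auto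
      then show ?thesis using that(2)[rule_format, of n] by simp
    qed
    then show False using not_all_nat_le by blast
  qed
  ultimately show "(\<exists>C. \<forall>n. real n * (2 ^ n) powr (p0 - 1) * (2 ^ n) powr (1 - p) \<le> C) \<longleftrightarrow>
      ereal p \<in> {ereal p0<..}"
    unfolding eq by auto
qed

text \<open>With 2^(n^2) points the exponent is n (n + 1 - p), which tends to infinity for every
  finite p.\<close>

lemma single_scale_infinity: "\<exists>N m. mass_exponents N m {\<infinity>} {\<infinity>}"
proof (intro exI, rule single_scale)
  show "0 \<le> (2 ^ (n * n) :: real)" for n by simp
  fix p :: real assume "1 \<le> p"
  have False if C: "\<forall>n. 2 ^ (n * n) * (2 ^ n) powr (1 - p) \<le> C" for C
  proof -
    have "real n \<le> max p C" for n
    proof (cases "p \<le> real n")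
      case True
      have "real n \<le> 2 powr real n" using of_nat_less_two_power[of n] by (simp add: powr_realpow less_imp_le)
      also have "\<dots> \<le> 2 powr (real n * (real n + (1 - p)))"
        using mult_left_mono[of 1 "real n + (1 - p)" "real n"] True by (intro powr_mono) auto
      also have "\<dots> = 2 ^ (n * n) * (2 ^ n) powr (1 - p)"
        by (simp add: powr_powr distrib_left flip: powr_add powr_realpow)
      also have "\<dots> \<le> C" using C by blast
      finally show ?thesis by simp
    qed auto
    then show False using not_all_nat_le by blast
  qed
  then show "(\<exists>C. \<forall>n. 2 ^ (n * n) * (2 ^ n) powr (1 - p) \<le> C) \<longleftrightarrow> ereal p \<in> {\<infinity>}" by auto
qed

text \<open>The exponent \<alpha> makes m_i^(1-p) equal to (i+1)^s with s < -1 if and only if p >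
  p0. At most T^(p0-1) masses are below T, so their sum is at most T^p0; masses start at 1, so only
  T \<ge> 1 counts and the endpoint p = p0 is included.\<close>

lemma power_masses:
  assumes p0: "1 < p0"
  defines "\<alpha> \<equiv> 1 / (p0 - 1)"
  shows "mass_exponents (\<lambda>n. n) (\<lambda>_ i. real (Suc i) powr \<alpha>) {ereal p0<..} {ereal p0..}"
  unfolding mass_exponents_def
proof (intro conjI allI impI)
  have \<alpha>: "0 < \<alpha>" using p0 by (simp add: \<alpha>_def)
  show "1 \<le> real (Suc i) powr \<alpha>" for i using \<alpha> by (intro ge_one_powr_ge_zero) auto
  fix p :: real assume p: "1 \<le> p"
  define s where "s = \<alpha> * (1 - p)"
  have s: "s < -1 \<longleftrightarrow> p0 < p" using p0 by (simp add: s_def \<alpha>_def field_simps)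
  have eq: "(\<Sum>i=1..n. (real (Suc i) powr \<alpha>) powr (1 - p)) = (\<Sum>i=1..n. real (Suc i) powr s)" for n
    by (simp add: powr_powr s_def)
  have "\<exists>C. \<forall>n. (\<Sum>i=1..n. real (Suc i) powr s) \<le> C" if "p0 < p"
  proof (intro exI allI)
    fix n
    have "summable (\<lambda>i. real i powr s)" using s that summable_real_powr_iff by blast
    then have "summable (\<lambda>i. real (Suc i) powr s)" by (subst summable_Suc_iff)
    then show "(\<Sum>i=1..n. real (Suc i) powr s) \<le> (\<Sum>i. real (Suc i) powr s)"
      by (intro sum_le_suminf) auto
  qed
  moreover have "p0 < p" if C: "\<forall>n. (\<Sum>i=1..n. real (Suc i) powr s) \<le> C" for C
  proof -
    have "(\<Sum>i<n. real (Suc (Suc i)) powr s) \<le> C" for n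
    proof -
      have "(\<Sum>i<n. real (Suc (Suc i)) powr s) = (\<Sum>i=1..n. real (Suc i) powr s)"
        by (rule sum.reindex_bij_witness[of _ "\<lambda>i. i - 1" Suc]) auto
      then show ?thesis using C by simp
    qed
    then have "summable (\<lambda>i. real (Suc (Suc i)) powr s)"
      by (intro summableI_nonneg_bounded[of _ C]) auto
    then have "summable (\<lambda>i. real i powr s)"
      using summable_Suc_iff[of "\<lambda>i. real i powr s"] summable_Suc_iff[of "\<lambda>i. real (Suc i) powr s"] by blast
    then show ?thesis using s summable_real_powr_iff by blast
  qed
  ultimately show "(\<exists>C. \<forall>n. (\<Sum>i=1..n. (real (Suc i) powr \<alpha>) powr (1 - p)) \<le> C) \<longleftrightarrow> ereal p \<in> {ereal p0<..}"
    unfolding eq by auto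
  have "(\<Sum>i | i \<in> {1..n} \<and> real (Suc i) powr \<alpha> \<le> T. real (Suc i) powr \<alpha>) \<le> 1 * T powr p"
    if T: "0 < T" and "p0 \<le> p" for n T
  proof -
    let ?I = "{i. i \<in> {1..n} \<and> real (Suc i) powr \<alpha> \<le> T}"
    show ?thesis
    proof (cases "?I = {}")
      case False
      then obtain i0 where "real (Suc i0) powr \<alpha> \<le> T" by auto
      moreover have "1 \<le> real (Suc i0) powr \<alpha>" using \<alpha> by (intro ge_one_powr_ge_zero) auto
      ultimately have T1: "1 \<le> T" by linarith
      have "real i \<le> T powr (p0 - 1)" if "i \<in> ?I" for i
      proof -
        have "(real (Suc i) powr \<alpha>) powr (p0 - 1) \<le> T powr (p0 - 1)"
          using that p0 by (intro powr_mono2) auto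
        moreover have "(real (Suc i) powr \<alpha>) powr (p0 - 1) = real (Suc i)"
          using p0 by (simp add: powr_powr \<alpha>_def)
        ultimately show ?thesis by simp
      qed
      then have "?I \<subseteq> {1..nat \<lfloor>T powr (p0 - 1)\<rfloor>}" by (auto simp: le_nat_floor)
      then have "card ?I \<le> card {1..nat \<lfloor>T powr (p0 - 1)\<rfloor>}" by (intro card_mono) auto
      then have card: "real (card ?I) \<le> T powr (p0 - 1)"
        by (simp add: le_nat_iff le_floor_iff)
      have "(\<Sum>i\<in>?I. real (Suc i) powr \<alpha>) \<le> (\<Sum>i\<in>?I. T)" by (intro sum_mono) auto
      also have "\<dots> = real (card ?I) * T" by simp
      also have "\<dots> \<le> T powr (p0 - 1) * T" using card T by (intro mult_right_mono) auto
      also have "\<dots> = T powr p0" using T by (simp add: powr_diff)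
      also have "\<dots> \<le> T powr p" using T1 that by (intro powr_mono) auto
      finally show ?thesis by simp
    next
      case True
      show ?thesis unfolding True by simp
    qed
  qed
  moreover have "p0 \<le> p"
    if C: "\<forall>n. \<forall>T>0. (\<Sum>i | i \<in> {1..n} \<and> real (Suc i) powr \<alpha> \<le> T. real (Suc i) powr \<alpha>) \<le> C * T powr p" for C
  proof (rule ccontr)
    assume "\<not> p0 \<le> p"
    define \<theta> where "\<theta> = \<alpha> * (p - 1)"
    have \<theta>: "0 < 1 - \<theta>" using p0 \<open>\<not> p0 \<le> p\<close> by (simp add: \<theta>_def \<alpha>_def field_simps)
    define K where "K = C * 3 powr (\<alpha> * p)"
    \<comment> \<open>Take T to be the largest of the first 2 (j + 1) masses and keep only the upper
      half of the indices, each of mass at least (j+1)^\<alpha>. This yields (j+1)^(1+\<alpha>)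
      \<le> C (3 (j+1))^(\<alpha> p), and for p < p0 the difference 1 + \<alpha> - \<alpha> p = 1 -
      \<theta> is positive.\<close>
    have bound: "real (Suc j) powr (1 - \<theta>) \<le> K" for j
    proof -
      let ?n = "2 * Suc j"
      let ?T = "real (Suc ?n) powr \<alpha>"
      have "0 < ?T" by simp
      have I: "{i. i \<in> {1..?n} \<and> real (Suc i) powr \<alpha> \<le> ?T} = {1..?n}"
        using \<alpha> by (auto intro!: powr_mono2)
      have C0: "0 \<le> C"
      proof -
        have "(0::real) \<le> C * 1 powr p"
          using C[rule_format, of 1 0] by simp
        then show ?thesis by simp
      qed
      have "real (Suc j) * real (Suc j) powr \<alpha> = (\<Sum>i\<in>{Suc j<..?n}. real (Suc j) powr \<alpha>)" by simp
      also have "\<dots> \<le> (\<Sum>i\<in>{Suc j<..?n}. real (Suc i) powr \<alpha>)"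
        using \<alpha> by (intro sum_mono powr_mono2) auto
      also have "\<dots> \<le> (\<Sum>i=1..?n. real (Suc i) powr \<alpha>)" by (intro sum_mono2) auto
      also have "\<dots> \<le> C * ?T powr p" using C[rule_format, of ?T ?n] \<open>0 < ?T\<close> unfolding I by simp
      also have "\<dots> = C * real (Suc ?n) powr (\<alpha> * p)" by (simp add: powr_powr)
      also have "\<dots> \<le> C * (3 * real (Suc j)) powr (\<alpha> * p)"
        using C0 \<alpha> p by (intro mult_left_mono powr_mono2) auto
      also have "(3 * real (Suc j)) powr (\<alpha> * p) = 3 powr (\<alpha> * p) * real (Suc j) powr (\<alpha> * p)"
        by (rule powr_mult)
      also have "C * \<dots> = K * real (Suc j) powr (\<alpha> * p)" by (simp only: K_def mult.assoc)
      finally have "real (Suc j) powr (1 + \<alpha>) \<le> K * real (Suc j) powr (\<alpha> * p)"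
        by (simp add: powr_add)
      then have "real (Suc j) powr (1 + \<alpha>) * real (Suc j) powr (- (\<alpha> * p)) \<le>
          K * real (Suc j) powr (\<alpha> * p) * real (Suc j) powr (- (\<alpha> * p))"
        by (intro mult_right_mono) auto
      then show ?thesis by (simp add: mult.assoc \<theta>_def algebra_simps flip: powr_add)
    qed
    have "real n \<le> max 1 K powr (1 / (1 - \<theta>))" for n
    proof -
      have "real n \<le> (real (Suc n) powr (1 - \<theta>)) powr (1 / (1 - \<theta>))" using \<theta> by (simp add: powr_powr)
      also have "\<dots> \<le> max 1 K powr (1 / (1 - \<theta>))" using bound[of n] \<theta> by (intro powr_mono2) auto
      finally show ?thesis .
    qed
    then show False using not_all_nat_le by blast
  qed
  ultimately show "(\<exists>C. \<forall>n. \<forall>T>0. (\<Sum>i | i \<in> {1..n} \<and> real (Suc i) powr \<alpha> \<le> T. real (Suc i) powr \<alpha>) \<le>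
      C * T powr p) \<longleftrightarrow> ereal p \<in> {ereal p0..}" unfolding atLeast_iff ereal_less_eq by blast
qed

section \<open>Case distinction on the exponent sets and assembly\<close>

lemma exponents_cases:
  assumes "admissible_exponents P_s" "admissible_exponents P_w" "P_s \<subseteq> P_w" "P_w \<subseteq> closure P_s"
  obtains "P_w = P_s" | p0 :: real where "1 \<le> p0" "P_s = {ereal p0<..}" "P_w = {ereal p0..}"
proof -
  consider "P_s = {\<infinity>}" | p0 :: real where "P_s = {ereal p0..}"
    | p0 :: real where "1 \<le> p0" "P_s = {ereal p0<..}"
    using assms(1) unfolding admissible_exponents_def by blast
  then show thesis
  proof cases
    case 1
    then have "P_w = P_s" using assms(3,4) by auto
    then show thesis by (rule that(1))
  next
    case (2 p0)
    then have "P_w = P_s" using assms(3,4) by auto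
    then show thesis by (rule that(1))
  next
    case (3 p0)
    \<comment> \<open>The closure adds nothing but the endpoint, which leaves two possibilities for
      \<open>P_w\<close>.\<close>
    have "closure P_s \<subseteq> {ereal p0..}"
      unfolding 3(2) by (rule closure_minimal) (auto simp: less_imp_le)
    then have "P_w \<subseteq> {ereal p0..}" using assms(4) by simp
    then have "P_w = P_s \<or> P_w = {ereal p0..}" using assms(3) 3(2)
      by (cases "ereal p0 \<in> P_w") (auto simp: less_le)
    then show thesis using that 3 by blast
  qed
qed

text \<open>\<open>K\<close> is the value of the parameter from which on the star spaces are of no use.\<close>

lemma component_cases:
  fixes k K :: real
  assumes adm: "admissible_exponents P_s" "admissible_exponents P_w" "P_s \<subseteq> P_w" "P_w \<subseteq> closure P_s"
    and K: "K \<le> k \<Longrightarrow> P_w = {1..}"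
  obtains (chain) "P_s = {1<..}" "P_w = {1..}" | (all) "P_s = {1..}" "P_w = {1..}"
    | (star) N m where "k < K" "mass_exponents N m P_s P_w"
  using adm
proof (cases rule: exponents_cases)
  case 1
  show thesis
  proof (cases "k < K")
    case True
    obtain N m where "mass_exponents N m P_s P_w"
      using adm(1) 1 single_scale_closed single_scale_open single_scale_infinity
      unfolding admissible_exponents_def by metis
    with True show thesis by (rule star)
  next
    case False
    then have "P_w = {1..}" using K by simp
    then show thesis using 1 by (intro all) simp_all
  qed
next
  case (2 p0)
  show thesis
  \<comment> \<open>The construction in \<open>power_masses\<close> requires p0 > 1. At p0 = 1
    chains take over, with no restriction on \<open>k\<close>.\<close>
  proof (cases "p0 = 1")
    case True
    then show thesis using 2 chain by (simp add: one_ereal_def)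
  next
    case False
    \<comment> \<open>For p0 > 1 the set [p0, \<infinity>] differs from [1, \<infinity>], which
      rules out K \<le> k.\<close>
    then have "k < K" using K 2 by (cases "k < K") (auto simp: one_ereal_def atLeast_eq_iff)
    then show thesis using star power_masses[of p0] False 2 by simp
  qed
qed

lemma glue_realized:
  assumes k: "1 \<le> k" and F: "realizes k (F :: nat \<Rightarrow> (nat + nat) weighted_space) P_s_c P_s P_w_c P_w"
    and inf: "\<infinity> \<in> P_s_c" "\<infinity> \<in> P_s" "\<infinity> \<in> P_w_c" "\<infinity> \<in> P_w"
    and growth: "\<And>K. \<exists>n S d w. F n = (S, d, w) \<and> (\<exists>q\<in>S. \<exists>r. 0 < r \<and> 2 * r \<le> 3 \<and>
      K * sum w (fball S d q r) < sum w (fball S d q (2 * r)))"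
  shows "\<exists>(X :: real set) (d :: real \<Rightarrow> real \<Rightarrow> real) (\<mu> :: real measure).
    metric_measure_space X d \<mu> \<and>
    \<not> metric_measure_space.doubling X d \<mu> \<and>
    (\<forall>p\<ge>1.
      (strong_type \<mu> p (metric_measure_space.centered_maximal X d \<mu> k) \<longleftrightarrow> p \<in> P_s_c) \<and>
      (strong_type \<mu> p (metric_measure_space.noncentered_maximal X d \<mu> k) \<longleftrightarrow> p \<in> P_s) \<and>
      (weak_type \<mu> p (metric_measure_space.centered_maximal X d \<mu> k) \<longleftrightarrow> p \<in> P_w_c) \<and>
      (weak_type \<mu> p (metric_measure_space.noncentered_maximal X d \<mu> k) \<longleftrightarrow> p \<in> P_w))"
proof -
  define S where "S n = fst (F n)" for n
  define D where "D n = fst (snd (F n))" for n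
  define W where "W n = snd (snd (F n))" for n
  have F_eq: "F n = (S n, D n, W n)" for n by (simp add: S_def D_def W_def)
  interpret glued S D W k
    using F k by unfold_locales (simp_all add: realizes_def F_eq)
  have "\<not> doubling"
  proof (rule not_doubling)
    fix K
    obtain n S' d w q r where "F n = (S', d, w)" "q \<in> S'" "0 < r" "2 * r \<le> 3"
      "K * sum w (fball S' d q r) < sum w (fball S' d q (2 * r))"
      using growth[of K] by blast
    then show "\<exists>n. \<exists>q\<in>S n. \<exists>r. 0 < r \<and> 2 * r \<le> 3 \<and>
        K * sum (W n) (fball (S n) (D n) q r) < sum (W n) (fball (S n) (D n) q (2 * r))"
      using F_eq[of n] by auto
  qed
  moreover have "(strong_type \<mu> p (centered_maximal k) \<longleftrightarrow> p \<in> P_s_c) \<and>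
      (strong_type \<mu> p (noncentered_maximal k) \<longleftrightarrow> p \<in> P_s) \<and>
      (weak_type \<mu> p (centered_maximal k) \<longleftrightarrow> p \<in> P_w_c) \<and>
      (weak_type \<mu> p (noncentered_maximal k) \<longleftrightarrow> p \<in> P_w)" if p: "1 \<le> p" for p :: ereal
  proof (cases p)
    case (real r)
    then have r: "1 \<le> r" using p by (simp add: one_ereal_def)
    note c = represents_centered and n = represents_noncentered
    have "strong_type \<mu> (ereal r) (centered_maximal k) \<longleftrightarrow> (\<exists>C. \<forall>n. strong_pc k r (F n) C)"
      unfolding strong_pc_def F_eq split
      using strong_type_if[OF c r] strong_type_imp[OF c r] by blast
    moreover have "strong_type \<mu> (ereal r) (noncentered_maximal k) \<longleftrightarrow> (\<exists>C. \<forall>n. strong_p k r (F n) C)"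
      unfolding strong_p_def F_eq split
      using strong_type_if[OF n r] strong_type_imp[OF n r] by blast
    moreover have "weak_type \<mu> (ereal r) (centered_maximal k) \<longleftrightarrow> (\<exists>C. \<forall>n. weak_pc k r (F n) C)"
      unfolding weak_pc_def F_eq split
      using weak_type_if[OF c r] weak_type_imp[OF c r] by blast
    moreover have "weak_type \<mu> (ereal r) (noncentered_maximal k) \<longleftrightarrow> (\<exists>C. \<forall>n. weak_p k r (F n) C)"
      unfolding weak_p_def F_eq split
      using weak_type_if[OF n r] weak_type_imp[OF n r] by blast
    ultimately show ?thesis using F r real unfolding realizes_def by simp
  next
    case PInf
    then show ?thesis
      using inf strong_type_infinity[OF represents_centered] strong_type_infinity[OF represents_noncentered]
        weak_type_infinity[OF represents_centered] weak_type_infinity[OF represents_noncentered] by simp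
  qed (use p in simp)
  ultimately show ?thesis
    using metric_measure_space_axioms by blast
qed

text \<open>The heavy point is at distance 1/2 from the center: the open ball of radius 1/2 around
  the center has mass 1, the ball of radius 1 has mass n + 2.\<close>

lemma trivial_growth:
  "\<exists>n S d w. star_space True (\<lambda>_. 1) (\<lambda>n _. real n + 1) n = (S, d, w) \<and> (\<exists>q\<in>S. \<exists>r. 0 < r \<and> 2 * r \<le> 3 \<and>
      K * sum w (fball S d q r) < sum w (fball S d q (2 * r)))"
proof -
  obtain n where n: "K < real n" using reals_Archimedean2 by blast
  let ?d = "hub_dist (\<lambda>i. if i = 0 then 0 else 1)" and ?w = "hub_weight True (\<lambda>_. real n + 1)"
  have 1: "fball (hub_points 1) ?d hub_center (1 / 2) = {hub_center}"
    "fball (hub_points 1) ?d hub_center 1 = {hub_center, Inr 1}"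
    by (auto simp: fball_def hub_points_def)
  have "?w hub_center = 1" "?w (Inr 1) = real n + 1"
    by (auto simp: hub_weight_def hub_heavy_def hub_index_def)
  then have "K * sum ?w (fball (hub_points 1) ?d hub_center (1 / 2)) <
      sum ?w (fball (hub_points 1) ?d hub_center (2 * (1 / 2)))"
    using n by (simp add: 1[simplified])
  then show ?thesis unfolding star_space_def
    by (intro exI[of _ n] exI[of _ "hub_points 1"] exI[of _ ?d] exI[of _ ?w] conjI
        bexI[of _ hub_center] exI[of _ "1 / 2"]) (auto simp: hub_points_def)
qed

theorem theorem1:
  fixes k :: real
    and P_s_c P_s P_w_c P_w :: "ereal set"
  assumes "1 \<le> k"
    and "admissible_exponents P_s_c"
    and "admissible_exponents P_s"
    and "admissible_exponents P_w_c"
    and "admissible_exponents P_w"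
    and "P_s \<subseteq> P_s_c"
    and "P_w \<subseteq> P_w_c"
    and "P_s_c \<subseteq> P_w_c"
    and "P_w_c \<subseteq> closure P_s_c"
    and "P_s \<subseteq> P_w"
    and "P_w \<subseteq> closure P_s"
    and "2 \<le> k \<Longrightarrow> P_w_c = {1..}"
    and "3 \<le> k \<Longrightarrow> P_w = {1..}"
  shows "\<exists>(X :: real set) (d :: real \<Rightarrow> real \<Rightarrow> real) (\<mu> :: real measure).
    metric_measure_space X d \<mu> \<and>
    \<not> metric_measure_space.doubling X d \<mu> \<and>
    (\<forall>p\<ge>1.
      (strong_type \<mu> p (metric_measure_space.centered_maximal X d \<mu> k) \<longleftrightarrow> p \<in> P_s_c) \<and>
      (strong_type \<mu> p (metric_measure_space.noncentered_maximal X d \<mu> k) \<longleftrightarrow> p \<in> P_s) \<and>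
      (weak_type \<mu> p (metric_measure_space.centered_maximal X d \<mu> k) \<longleftrightarrow> p \<in> P_w_c) \<and>
      (weak_type \<mu> p (metric_measure_space.noncentered_maximal X d \<mu> k) \<longleftrightarrow> p \<in> P_w))"
proof -
  note k = \<open>1 \<le> k\<close>
  have inf: "\<infinity> \<in> P" and ge1: "P \<subseteq> {1..}" if "admissible_exponents P" for P
    using that by (auto simp: admissible_exponents_def one_ereal_def) (metis ereal_less_eq(3) order_trans less_imp_le)+
  let ?triv = "star_space True (\<lambda>_. 1) (\<lambda>n _. real n + 1)"
  obtain F1 :: "nat \<Rightarrow> (nat + nat) weighted_space" where
    F1: "realizes k F1 P_s_c P_s_c P_w_c P_w_c"
  proof -
    consider (chain) "P_s_c = {1<..}" "P_w_c = {1..}" | (all) "P_s_c = {1..}" "P_w_c = {1..}"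
      | (star) N m where "k < 2" "mass_exponents N m P_s_c P_w_c"
      by (rule component_cases[OF assms(2,4,8,9,12)])
    then show thesis
    proof cases
      case chain
      have "realizes k (chain_space (2 * k)) P_s_c P_s_c P_w_c P_w_c"
        unfolding chain using k by (rule chain_coarse)
      then show thesis by (rule that)
    next
      case all
      show thesis by (rule that[of ?triv]) (use trivial_realizes[OF k] all in simp)
    next
      case (star N m)
      show thesis using star_heavy_light[OF star(2) k star(1)] by (rule that)
    qed
  qed
  obtain F2 :: "nat \<Rightarrow> (nat + nat) weighted_space" where
    F2: "realizes k F2 {1..} P_s {1..} P_w"
  proof -
    consider (chain) "P_s = {1<..}" "P_w = {1..}" | (all) "P_s = {1..}" "P_w = {1..}"
      | (star) N m where "k < 3" "mass_exponents N m P_s P_w"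
      by (rule component_cases[OF assms(3,5,10,11,13)])
    then show thesis
    proof cases
      case chain
      have "realizes k (chain_space k) {1..} P_s {1..} P_w"
        unfolding chain using k by (rule chain_fine)
      then show thesis by (rule that)
    next
      case all
      show thesis by (rule that[of ?triv]) (use trivial_realizes[OF k] all in simp)
    next
      case (star N m)
      show thesis using star_light_heavy[OF star(2) k star(1)] by (rule that)
    qed
  qed
  \<comment> \<open>The family \<open>F1\<close> imposes the centered sets on both operators and
    \<open>F2\<close> only restricts the non-centered one; \<open>?triv\<close> changes no exponent
    set and is there for the failure of doubling.\<close>
  have "realizes k (interleave (interleave F1 F2) ?triv)
      (P_s_c \<inter> {1..} \<inter> {1..}) (P_s_c \<inter> P_s \<inter> {1..}) (P_w_c \<inter> {1..} \<inter> {1..}) (P_w_c \<inter> P_w \<inter> {1..})"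
    by (intro realizes_interleave F1 F2 trivial_realizes k)
  also have "P_s_c \<inter> {1..} \<inter> {1..} = P_s_c" using ge1[OF assms(2)] by blast
  also have "P_s_c \<inter> P_s \<inter> {1..} = P_s" using ge1[OF assms(3)] assms(6) by blast
  also have "P_w_c \<inter> {1..} \<inter> {1..} = P_w_c" using ge1[OF assms(4)] by blast
  also have "P_w_c \<inter> P_w \<inter> {1..} = P_w" using ge1[OF assms(5)] assms(7) by blast
  finally have real: "realizes k (interleave (interleave F1 F2) ?triv) P_s_c P_s P_w_c P_w" .
  show ?thesis
  proof (rule glue_realized[OF k real])
    fix K :: real
    obtain n S d w where *: "?triv n = (S, d, w)" "\<exists>q\<in>S. \<exists>r. 0 < r \<and> 2 * r \<le> 3 \<and>
      K * sum w (fball S d q r) < sum w (fball S d q (2 * r))" using trivial_growth[of K] by blast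
    have "interleave (interleave F1 F2) ?triv (2 * n + 1) = ?triv n" by (simp add: interleave_def)
    with * show "\<exists>n S d w. interleave (interleave F1 F2) ?triv n = (S, d, w) \<and> (\<exists>q\<in>S. \<exists>r. 0 < r \<and> 2 * r \<le> 3 \<and>
      K * sum w (fball S d q r) < sum w (fball S d q (2 * r)))" by metis
  qed (use inf assms in auto)
qed

end
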